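(* Let $n\geq1$ and $p<-2n-5$. The constant function $u\equiv1$ belongs to $\mathcal{B}$ and is a critical point of $I$ on $\mathcal{B}$, and it is unstable: there exists a smooth $(n+2)$-symmetric function $\xi$ on $\mathbb{S}^n$ such that, with $$\varphi_\varepsilon=\frac{|\mathbb{S}^n|^{1/p}(1+\varepsilon\xi)}{\big(\int_{\mathbb{S}^n}(1+\varepsilon\xi)^p\,d\sigma\big)^{1/p}},$$ one has $\frac{d^2}{d\varepsilon^2}\big|_{\varepsilon=0}I(\varphi_\varepsilon)<0$. As a result, $u\equiv1$ is not a minimizer of $I$ in $\mathcal{B}$.
   Context: Fix $n+2$ points $q_1,\dots,q_{n+2}\in\mathbb{S}^n\subset\mathbb{R}^{n+1}$ spread evenly on $\mathbb{S}^n$ (vertices of an inscribed regular simplex). $\mathcal{S}_{n+2}(q)$ is the set of $\phi\in SO(n+1)$ mapping $\{q_1,\dots,q_{n+2}\}$ onto itself; a function is $(n+2)$-symmetric if it is invariant under all $\phi\in\mathcal{S}_{n+2}(q)$. $H^*_+(\mathbb{S}^n)$ is the set of support functions $u$ of convex bodies $\Omega_u\subset\mathbb{R}^{n+1}$ with $u>0$ and $|\Omega_u|<\infty$. $\mathcal{B}=\{u\in H^*_+(\mathbb{S}^n): u \text{ is }(n+2)\text{-symmetric}, \int_{\mathbb{S}^n}u^p\,d\sigma=|\mathbb{S}^n|\}$ and $I(u)=-(n+1)V(\Omega_u)$, $V$ the volume; for smooth $u$, $-I(u)=\int_{\mathbb{S}^n}u\det(\nabla^2u+uI)\,d\sigma$.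 Critical point means $\frac{d}{d\varepsilon}\big|_{\varepsilon=0}I(\varphi_\varepsilon)=0$ for every smooth $(n+2)$-symmetric $\xi$. *)

theory Defs
  imports "HOL-Analysis.Analysis"
begin

text \<open>Ambient space R^(n+1) is the type real^'n with CARD('n) = n+1.
  The unit sphere S^n is sphere 0 1.\<close>

text \<open>Integration over S^n w.r.t. the standard surface measure, via the cone
  formula: integral over S^n of f = (n+1) * integral over the unit ball of f(x/|x|).\<close>
definition sph_int :: "(real^'n \<Rightarrow> real) \<Rightarrow> real" where
  "sph_int f = real CARD('n) * integral (cball 0 1) (\<lambda>x. f (x /\<^sub>R norm x))"

definition regular_simplex :: "(nat \<Rightarrow> real^'n) \<Rightarrow> bool" where
  "regular_simplex q \<longleftrightarrow>
     (\<forall>i < CARD('n) + 1. norm (q i) = 1) \<and>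
     (\<forall>i < CARD('n) + 1. \<forall>j < CARD('n) + 1. i \<noteq> j \<longrightarrow>
        q i \<bullet> q j = - 1 / real CARD('n))"

definition sym_group :: "(nat \<Rightarrow> real^'n) \<Rightarrow> (real^'n^'n) set" where
  "sym_group q = {A. orthogonal_matrix A \<and> det A = 1 \<and>
     (\<lambda>x. A *v x) ` (q ` {..<CARD('n) + 1}) = q ` {..<CARD('n) + 1}}"

definition symmetric_fun :: "(nat \<Rightarrow> real^'n) \<Rightarrow> (real^'n \<Rightarrow> real) \<Rightarrow> bool" where
  "symmetric_fun q f \<longleftrightarrow> (\<forall>A \<in> sym_group q. \<forall>x \<in> sphere 0 1. f (A *v x) = f x)"

text \<open>C^infinity functions on R^(n+1): all iterated (Frechet) directional derivatives exist.
  A smooth function on S^n is the restriction of such a function.\<close>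
coinductive smooth_fun :: "(real^'n \<Rightarrow> real) \<Rightarrow> bool" where
  "(\<forall>x. f differentiable (at x)) \<Longrightarrow>
   (\<forall>v. smooth_fun (\<lambda>x. frechet_derivative f (at x) v)) \<Longrightarrow> smooth_fun f"

definition support_fun :: "(real^'n) set \<Rightarrow> real^'n \<Rightarrow> real" where
  "support_fun \<Omega> x = (SUP y\<in>\<Omega>. x \<bullet> y)"

definition Hstar_plus :: "(real^'n \<Rightarrow> real) set" where
  "Hstar_plus = {u. \<exists>\<Omega>. convex \<Omega> \<and> compact \<Omega> \<and> \<Omega> \<noteq> {} \<and>
      emeasure lebesgue \<Omega> < \<infinity> \<and>
      (\<forall>x \<in> sphere 0 1. u x = support_fun \<Omega> x \<and> u x > 0)}"

text \<open>The body Omega_u determined by u (Wulff shape); equals the convex body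
  whose support function is u whenever u is a support function.\<close>
definition body :: "(real^'n \<Rightarrow> real) \<Rightarrow> (real^'n) set" where
  "body u = {y. \<forall>x \<in> sphere 0 1. x \<bullet> y \<le> u x}"

definition I_fun :: "(real^'n \<Rightarrow> real) \<Rightarrow> real" where
  "I_fun u = - real CARD('n) * measure lebesgue (body u)"

definition B_set :: "(nat \<Rightarrow> real^'n) \<Rightarrow> real \<Rightarrow> (real^'n \<Rightarrow> real) set" where
  "B_set q p = {u \<in> Hstar_plus. symmetric_fun q u \<and>
      sph_int (\<lambda>x. u x powr p) = sph_int (\<lambda>x::real^'n. 1)}"

definition phi :: "real \<Rightarrow> (real^'n \<Rightarrow> real) \<Rightarrow> real \<Rightarrow> real^'n \<Rightarrow> real" where
  "phi p \<xi> \<epsilon> = (\<lambda>x. sph_int (\<lambda>y::real^'n. 1) powr (1/p) * (1 + \<epsilon> * \<xi> x) /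
      sph_int (\<lambda>y. (1 + \<epsilon> * \<xi> y) powr p) powr (1/p))"

end

theory Submission
  imports Defs
begin

text \<open>
  Perturb along the cubic \<open>\<xi> x = (\<Sum>i. (q i \<bullet> x) ^ 3)\<close>. Since the unit vectors \<open>q i\<close> sum to zero it is a
  harmonic polynomial of degree 3, so that the integral of the squared tangential gradient is
  \<open>3 (n + 2)\<close> times that of \<open>\<xi>\<^sup>2\<close>. The second variation of \<open>I\<close> along the normalised perturbation is then
  \<open>(n + 1) (p + 2 n + 5)\<close> times the integral of \<open>\<xi>\<^sup>2\<close>.

  The volume of the Wulff shape is handled through its radial function
  \<open>\<rho> \<epsilon> x = min z. (1 + \<epsilon> * \<xi> z) / (z \<bullet> x)\<close>, a minimum of functions that are affine in \<open>\<epsilon>\<close>. By Danskin's theorem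
  \<open>d\<rho>/d\<epsilon> = \<xi> z / (z \<bullet> x)\<close> at the minimiser \<open>z\<close>, which is the outer normal at the boundary point \<open>\<rho> \<epsilon> x *\<^sub>R x\<close>;
  expanding \<open>z\<close> to first order gives \<open>d\<rho>/d\<epsilon> = \<xi> - \<epsilon> |\<nabla>\<xi>|\<^sup>2 + o(\<epsilon>)\<close>. Neither curvature measures nor a change
  of variables is needed, and dominated convergence transfers everything to the integrals.
\<close>

section \<open>Integration over the sphere\<close>

text \<open>Write N for \<open>CARD('n)\<close>, so N = n + 1. Degree 3 is the lowest degree in
  which the simplex group has an invariant that is not constant on the sphere: invariant linear
  forms vanish and invariant quadratic forms are multiples of \<open>x \<bullet> x\<close>. For a
  spherical harmonic of degree k \<ge> 1 the second variation has the sign of p - N + k * (k + N -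
  2), which grows with k; k = 3 gives p + 2 * N + 3 = p + 2 * n + 5, hence the threshold on p.

  The obstacle is that a second derivative at 0 needs the first derivative on a whole neighbourhood,
  while \<open>I_fun\<close> is given only as a Lebesgue measure. At 0 itself the radius is known up
  to O(\<epsilon>^2) for every Lipschitz direction, which settles criticality. Away from 0 the
  perturbed function has to stay strictly convex, with a quantitative gap; \<open>\<delta>\<close>
  is chosen for this.

  The eigenvalue identity is obtained without a Laplacian: rotations of coordinate planes preserve
  the integral, and differentiating this at angle 0 is the only form of integration by parts
  used.\<close>

definition sph_integrable :: "(real^'n \<Rightarrow> real) \<Rightarrow> bool" where
  "sph_integrable f \<longleftrightarrow> (\<lambda>x. f (x /\<^sub>R norm x)) integrable_on cball 0 1"

lemma norm_dir: "x \<noteq> 0 \<Longrightarrow> norm (x /\<^sub>R norm x) = 1"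
  for x :: "'a::real_normed_vector"
  by simp

lemma integrable_integral_minus_origin:
  fixes h :: "real^'n \<Rightarrow> real"
  shows "(h integrable_on cball 0 1 - {0} \<longleftrightarrow> h integrable_on cball 0 1) \<and>
    integral (cball 0 1 - {0}) h = integral (cball 0 1) h"
  by (intro conjI integrable_spike_set_eq integral_spike_set)
     (auto intro: negligible_subset[of "{0}"])

lemma spike_origin:
  fixes f g :: "real^'n \<Rightarrow> real"
  assumes "\<And>x. x \<in> sphere 0 1 \<Longrightarrow> f x = g x"
  shows "((\<lambda>x. f (x /\<^sub>R norm x)) has_integral i) (cball 0 1) \<longleftrightarrow>
         ((\<lambda>x. g (x /\<^sub>R norm x)) has_integral i) (cball 0 1)"
  by (rule has_integral_spike_finite_eq[of "{0}"]) (use assms in auto)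

text \<open>Integrability is not at issue: the two \<open>has_integral\<close> predicates agree for
  every value, so \<open>integral\<close> picks the same number in the non-integrable case as
  well.\<close>

lemma sph_int_cong:
  assumes "\<And>x. x \<in> sphere 0 1 \<Longrightarrow> f x = g x"
  shows "sph_int f = sph_int g"
proof -
  have "((\<lambda>x. f (x /\<^sub>R norm x)) has_integral i) (cball 0 1) \<longleftrightarrow>
        ((\<lambda>x. g (x /\<^sub>R norm x)) has_integral i) (cball 0 1)" for i
    by (rule spike_origin) (rule assms)
  then show ?thesis
    by (simp add: sph_int_def integral_def integrable_on_def)
qed

lemma sph_int_diff:
  "sph_integrable f \<Longrightarrow> sph_integrable g \<Longrightarrow> sph_int (\<lambda>x. f x - g x) = sph_int f - sph_int g"
  unfolding sph_int_def sph_integrable_def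
  by (subst Henstock_Kurzweil_Integration.integral_diff) (auto simp: algebra_simps)

lemma sph_int_cmult: "sph_int (\<lambda>x. c * f x) = c * sph_int f"
  unfolding sph_int_def by simp

lemma sph_int_sum:
  "finite I \<Longrightarrow> (\<And>i. i \<in> I \<Longrightarrow> sph_integrable (f i)) \<Longrightarrow>
   sph_int (\<lambda>x. \<Sum>i\<in>I. f i x) = (\<Sum>i\<in>I. sph_int (f i))"
  unfolding sph_int_def sph_integrable_def
  by (subst Henstock_Kurzweil_Integration.integral_sum) (auto simp: sum_distrib_left)

lemma borel_measurable_dir:
  fixes f :: "real^'n \<Rightarrow> real"
  assumes "continuous_on (sphere 0 1) f"
  shows "(\<lambda>x. if x \<in> {0} then 0 else f (x /\<^sub>R norm x)) \<in> borel_measurable borel"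
proof (rule borel_measurable_continuous_on_if)
  show "continuous_on (- {0}) (\<lambda>x. f (x /\<^sub>R norm x))"
    by (rule continuous_on_compose2[OF assms])
       (auto intro!: continuous_intros simp del: norm_scaleR simp: norm_dir image_subset_iff)
qed auto

lemma sph_continuous_bounded:
  fixes f :: "real^'n \<Rightarrow> real"
  assumes "continuous_on (sphere 0 1) f"
  obtains B where "B \<ge> 0" "\<And>x. x \<in> sphere 0 1 \<Longrightarrow> \<bar>f x\<bar> \<le> B"
proof -
  have "bounded (f ` sphere 0 1)"
    by (intro compact_imp_bounded compact_continuous_image assms compact_sphere)
  then obtain B where "\<And>y. y \<in> f ` sphere 0 1 \<Longrightarrow> norm y \<le> B"
    by (meson bounded_iff)
  then show ?thesis
    by (intro that[of "max B 0"]) fastforce+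
qed

lemma integrable_dir_lborel:
  fixes f :: "real^'n \<Rightarrow> real"
  assumes "continuous_on (sphere 0 1) f"
  shows "integrable lborel (\<lambda>x. indicator (cball 0 1 - {0}) x * f (x /\<^sub>R norm x))"
proof -
  obtain B where B: "B \<ge> 0" "\<And>x. x \<in> sphere 0 1 \<Longrightarrow> \<bar>f x\<bar> \<le> B"
    using sph_continuous_bounded[OF assms] by blast
  have eq: "(\<lambda>x. indicator (cball 0 1 - {0}) x * f (x /\<^sub>R norm x)) =
    (\<lambda>x. indicator (cball 0 1 - {0}) x * (if x \<in> {0} then 0 else f (x /\<^sub>R norm x)))"
    by (auto simp: indicator_def)
  have "integrable lborel (\<lambda>x::real^'n. indicator (cball 0 1) x *\<^sub>R B)"
    by (intro integrable_scaleR_left) (use emeasure_lborel_cball_finite[of "0::real^'n" 1] in \<open>auto simp: integrable_indicator_iff\<close>)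
  then show ?thesis
    unfolding eq
  proof (rule Bochner_Integration.integrable_bound)
    show "(\<lambda>x. indicator (cball 0 1 - {0}) x * (if x \<in> {0} then 0 else f (x /\<^sub>R norm x)))
        \<in> borel_measurable lborel"
      using borel_measurable_dir[OF assms] by (auto intro!: borel_measurable_times borel_measurable_indicator)
  qed (use B in \<open>auto simp: indicator_def\<close>)
qed

lemma dir_has_integral:
  fixes f :: "real^'n \<Rightarrow> real"
  assumes "continuous_on (sphere 0 1) f"
  shows "((\<lambda>x. f (x /\<^sub>R norm x)) has_integral
    (\<integral>x. indicator (cball 0 1 - {0}) x * f (x /\<^sub>R norm x) \<partial>lborel)) (cball 0 1)"
proof -
  have "((\<lambda>x. indicator (cball 0 1 - {0}) x * f (x /\<^sub>R norm x)) has_integral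
    (\<integral>x. indicator (cball 0 1 - {0}) x * f (x /\<^sub>R norm x) \<partial>lborel)) UNIV"
    by (rule has_integral_integral_lborel[OF integrable_dir_lborel[OF assms]])
  moreover have "(\<lambda>x. indicator (cball 0 1 - {0}) x * f (x /\<^sub>R norm x)) =
      (\<lambda>x. if x \<in> cball 0 1 - {0} then f (x /\<^sub>R norm x) else 0)"
    by (auto simp: indicator_def)
  ultimately have "((\<lambda>x. f (x /\<^sub>R norm x)) has_integral
    (\<integral>x. indicator (cball 0 1 - {0}) x * f (x /\<^sub>R norm x) \<partial>lborel)) (cball 0 1 - {0})"
    by (simp only: has_integral_restrict_UNIV)
  then show ?thesis
    by (rule has_integral_spike_set_eq[THEN iffD1, rotated -1])
       (auto intro: negligible_subset[of "{0}"])
qed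

lemma sph_integrable_continuous:
  "continuous_on (sphere 0 1) f \<Longrightarrow> sph_integrable f"
  using dir_has_integral unfolding sph_integrable_def by blast

text \<open>Rotation invariance is proved for the measure \<open>lborel\<close>; this form carries
  it over to the gauge integral in \<open>sph_int\<close>.\<close>

lemma sph_int_eq_lborel:
  fixes f :: "real^'n \<Rightarrow> real"
  assumes "continuous_on (sphere 0 1) f"
  shows "sph_int f = real CARD('n) *
    (\<integral>x. indicator (cball 0 1 - {0}) x * f (x /\<^sub>R norm x) \<partial>lborel)"
  unfolding sph_int_def using dir_has_integral[OF assms] by (simp add: integral_unique)

lemma sph_int_mono:
  assumes "sph_integrable f" "sph_integrable g" "\<And>x. x \<in> sphere 0 1 \<Longrightarrow> f x \<le> g x"
  shows "sph_int f \<le> sph_int g"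
proof -
  let ?B = "cball (0::real^'n) 1 - {0}"
  have spike: "(h integrable_on ?B \<longleftrightarrow> h integrable_on cball 0 1) \<and> integral ?B h = integral (cball 0 1) h"
    for h :: "real^'n \<Rightarrow> real"
    by (rule integrable_integral_minus_origin)
  have "integral ?B (\<lambda>x. f (x /\<^sub>R norm x)) \<le> integral ?B (\<lambda>x. g (x /\<^sub>R norm x))"
    using assms unfolding sph_integrable_def spike[THEN conjunct1, symmetric]
    by (intro integral_le) auto
  then have "integral (cball 0 1) (\<lambda>x. f (x /\<^sub>R norm x)) \<le> integral (cball 0 1) (\<lambda>x. g (x /\<^sub>R norm x))"
    by (simp add: spike)
  then show ?thesis unfolding sph_int_def by (simp add: mult_left_mono)
qed

lemma sph_int_one: "sph_int (\<lambda>x::real^'n. 1) = real CARD('n) * measure lebesgue (cball (0::real^'n) 1)"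
  unfolding sph_int_def lmeasure_integral[OF lmeasurable_cball] by simp

lemma sph_int_one_pos: "sph_int (\<lambda>x::real^'n. 1) > 0"
  unfolding sph_int_one using content_cball_pos[of 1 "0::real^'n"] by simp

text \<open>The integrand of \<open>sph_int f\<close> has the junk value \<open>f 0\<close> at the origin, a null set; hence all
  hypotheses concern the sphere only.\<close>

lemma sph_int_dominated_derivative:
  fixes f :: "real \<Rightarrow> real^'n \<Rightarrow> real"
  assumes d: "d > 0"
    and int: "\<And>t. \<bar>t - t0\<bar> < d \<Longrightarrow> sph_integrable (f t)"
    and deriv: "\<And>x. x \<in> sphere 0 1 \<Longrightarrow> ((\<lambda>t. f t x) has_real_derivative m x) (at t0)"
    and lip: "\<And>t x. \<bar>t - t0\<bar> < d \<Longrightarrow> x \<in> sphere 0 1 \<Longrightarrow> \<bar>f t x - f t0 x\<bar> \<le> L * \<bar>t - t0\<bar>"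
  shows "sph_integrable m"
    and "((\<lambda>t. sph_int (f t)) has_real_derivative sph_int m) (at t0)"
proof -
  \<comment> \<open>Along a null sequence of nonzero increments the quotients are bounded by
    \<open>L\<close>. Dominated convergence yields integrability of \<open>m\<close> together with
    the limit, hence the conjunction.\<close>
  have main: "sph_integrable m \<and> (\<lambda>k. (sph_int (f (t0 + X k)) - sph_int (f t0)) / X k) \<longlonglongrightarrow> sph_int m"
    if X: "\<And>k. X k \<noteq> 0" "\<And>k. \<bar>X k\<bar> < d" "X \<longlonglongrightarrow> 0" for X
  proof -
    let ?B = "cball (0::real^'n) 1 - {0}"
    let ?q = "\<lambda>k x. (f (t0 + X k) (x /\<^sub>R norm x) - f t0 (x /\<^sub>R norm x)) / X k"
    have spike: "(h integrable_on ?B \<longleftrightarrow> h integrable_on cball 0 1) \<and> integral ?B h = integral (cball 0 1) h"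
      for h :: "real^'n \<Rightarrow> real"
      by (rule integrable_integral_minus_origin)
    have i1: "(\<lambda>x. f (t0 + X k) (x /\<^sub>R norm x)) integrable_on ?B"
             "(\<lambda>x. f t0 (x /\<^sub>R norm x)) integrable_on ?B" for k
      using int[of "t0 + X k"] int[of t0] X d unfolding sph_integrable_def spike[THEN conjunct1] by auto
    have i2: "?q k integrable_on ?B" for k
      using integrable_diff[OF i1] by (intro integrable_on_divide) auto
    have hint: "(\<lambda>x. L) integrable_on ?B"
      unfolding spike[THEN conjunct1] by (intro integrable_on_const) auto
    have le: "norm (?q k x) \<le> L" if "x \<in> ?B" for k x
      using lip[of "t0 + X k" "x /\<^sub>R norm x"] X(1)[of k] X(2)[of k] that
      by (simp add: divide_simps)
    have lim: "(\<lambda>k. ?q k x) \<longlonglongrightarrow> m (x /\<^sub>R norm x)" if "x \<in> ?B" for x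
    proof -
      have "(\<lambda>h. (f (t0 + h) (x /\<^sub>R norm x) - f t0 (x /\<^sub>R norm x)) / h) \<midarrow>0\<rightarrow> m (x /\<^sub>R norm x)"
        using deriv[of "x /\<^sub>R norm x"] that by (simp add: DERIV_def)
      moreover have "filterlim X (at 0) sequentially"
        using X by (auto simp: filterlim_at)
      ultimately show ?thesis
        by (rule filterlim_compose)
    qed
    note dc = dominated_convergence[where f="?q" and h="\<lambda>_. L", OF i2 hint le lim]
    have q: "integral ?B (?q k) = (integral (cball 0 1) (\<lambda>x. f (t0 + X k) (x /\<^sub>R norm x))
        - integral (cball 0 1) (\<lambda>x. f t0 (x /\<^sub>R norm x))) / X k" for k
      using i1 by (simp add: Henstock_Kurzweil_Integration.integral_diff spike[THEN conjunct2, symmetric])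
    have c: "(\<lambda>x. m (x /\<^sub>R norm x)) integrable_on cball 0 1"
      "(\<lambda>k. (integral (cball 0 1) (\<lambda>x. f (t0 + X k) (x /\<^sub>R norm x))
        - integral (cball 0 1) (\<lambda>x. f t0 (x /\<^sub>R norm x))) / X k) \<longlonglongrightarrow>
        integral (cball 0 1) (\<lambda>x. m (x /\<^sub>R norm x))"
      using dc unfolding q spike[THEN conjunct2] spike[THEN conjunct1] by auto
    have "(\<lambda>k. (sph_int (f (t0 + X k)) - sph_int (f t0)) / X k) \<longlonglongrightarrow> sph_int m"
      using tendsto_mult[OF tendsto_const[of "real CARD('n)"] c(2)] unfolding sph_int_def
      by (simp add: algebra_simps)
    then show ?thesis using c(1) by (simp add: sph_integrable_def)
  qed
  \<comment> \<open>One explicit admissible sequence is enough for the integrability of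
    \<open>m\<close>.\<close>
  have "(\<lambda>n. d / 2 * (1 / real (Suc n))) \<longlonglongrightarrow> d / 2 * 0"
    by (intro tendsto_intros LIMSEQ_Suc lim_1_over_n[where 'a=real])
  moreover have "\<bar>d / 2 * (1 / real (Suc n))\<bar> < d" for n
    using d by (simp add: field_simps add_pos_nonneg)
  ultimately show "sph_integrable m"
    using main[of "\<lambda>n. d / 2 * (1 / real (Suc n))"] d by simp
  show "((\<lambda>t. sph_int (f t)) has_real_derivative sph_int m) (at t0)"
    unfolding DERIV_def tendsto_at_iff_sequentially comp_def
  proof (intro allI impI)
    fix X :: "nat \<Rightarrow> real" assume X: "\<forall>i. X i \<in> UNIV - {0}" "X \<longlonglongrightarrow> 0"
    \<comment> \<open>An arbitrary null sequence enters the window of radius \<open>d\<close> only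
      eventually, so an initial segment is cut off before \<open>main\<close> applies.\<close>
    have "\<forall>\<^sub>F k in sequentially. \<bar>X k\<bar> < d"
      using X(2) d by (auto simp: tendsto_iff dist_real_def)
    then obtain K where K: "\<And>k. k \<ge> K \<Longrightarrow> \<bar>X k\<bar> < d"
      by (auto simp: eventually_sequentially)
    have "(\<lambda>k. (sph_int (f (t0 + X (k + K))) - sph_int (f t0)) / X (k + K)) \<longlonglongrightarrow> sph_int m"
      using main[of "\<lambda>k. X (k + K)"] X(1) K LIMSEQ_ignore_initial_segment[OF X(2), of K] by auto
    then show "(\<lambda>k. (sph_int (f (t0 + X k)) - sph_int (f t0)) / X k) \<longlonglongrightarrow> sph_int m"
      by (rule LIMSEQ_offset)
  qed
qed

section \<open>Volume of star bodies\<close>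

text \<open>On the cone the set lies between the dilates of \<open>cball 0 1 \<inter> C\<close> by
  the N-th roots of \<open>a\<close> and \<open>b\<close>, and dilation by c multiplies volume by c
  ^ N. Bounding the power of \<open>F\<close> keeps these roots inside the proof.\<close>

lemma star_body_cone_measure:
  fixes F :: "real^'n \<Rightarrow> real"
  assumes F: "F \<in> borel_measurable borel"
    and hom: "\<And>s x. s > 0 \<Longrightarrow> F (s *\<^sub>R x) = F x"
    and C: "C \<in> sets borel" "\<And>s x. s > 0 \<Longrightarrow> s *\<^sub>R x \<in> C \<longleftrightarrow> x \<in> C"
    and ab: "0 \<le> a" "\<And>x. x \<in> C \<Longrightarrow> a \<le> F x ^ CARD('n) \<and> F x ^ CARD('n) \<le> b \<and> 0 \<le> F x"
  shows "{x \<in> C. norm x \<le> F x} \<in> lmeasurable"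
    and "a * measure lebesgue (cball 0 1 \<inter> C) \<le> measure lebesgue {x \<in> C. norm x \<le> F x}"
    and "measure lebesgue {x \<in> C. norm x \<le> F x} \<le> b * measure lebesgue (cball 0 1 \<inter> C)"
proof -
  note [measurable] = F C(1)
  define N where "N = CARD('n)"
  have N: "N > 0" by (simp add: N_def)
  have root: "\<exists>c\<ge>0. c ^ N = t" if "t \<ge> 0" for t :: real
    using N that by (metis real_root_ge_zero real_root_pow_pos2)
  have scale: "{x \<in> C. norm x \<le> c} \<in> lmeasurable \<and>
      measure lebesgue {x \<in> C. norm x \<le> c} = c ^ N * measure lebesgue (cball 0 1 \<inter> C)" if "c > 0" for c
  proof -
    have "{x \<in> C. norm x \<le> c} = (\<lambda>x. c *\<^sub>R x + 0) ` (cball 0 1 \<inter> C)"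
    proof (intro equalityI subsetI)
      fix x assume x: "x \<in> {x \<in> C. norm x \<le> c}"
      then have "(1/c) *\<^sub>R x \<in> cball 0 1 \<inter> C"
        using that C(2)[of "1/c" x] by (simp add: divide_simps)
      moreover have "x = c *\<^sub>R ((1/c) *\<^sub>R x) + 0" using that by simp
      ultimately show "x \<in> (\<lambda>x. c *\<^sub>R x + 0) ` (cball 0 1 \<inter> C)" by blast
    next
      fix x assume "x \<in> (\<lambda>x. c *\<^sub>R x + 0) ` (cball 0 1 \<inter> C)"
      then show "x \<in> {x \<in> C. norm x \<le> c}"
        using that C(2)[of c] by (auto simp: mult_left_le)
    qed
    moreover have "{x \<in> C. norm x \<le> c} \<in> lmeasurable"
    proof (rule bounded_set_imp_lmeasurable)
      show "bounded {x \<in> C. norm x \<le> c}" by (auto simp: bounded_iff)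
      have "{x \<in> C. norm x \<le> c} \<in> sets borel" by measurable
      then show "{x \<in> C. norm x \<le> c} \<in> sets lebesgue" by simp
    qed
    ultimately show ?thesis
      using measure_lebesgue_affine[of c 0 "cball 0 1 \<inter> C"] that by (simp add: N_def)
  qed
  have b: "b \<ge> 0" if "x \<in> C" for x using ab(2)[OF that] ab(1) by linarith
  show K: "{x \<in> C. norm x \<le> F x} \<in> lmeasurable"
  proof (cases "C = {}")
    case False
    then obtain c where c: "c \<ge> 0" "c ^ N = b" using b root by (meson ex_in_conv)
    have "F x \<le> c" if "x \<in> C" for x
      using ab(2)[OF that] c N unfolding N_def by (metis power_mono_iff zero_less_card_finite)
    then have "bounded {x \<in> C. norm x \<le> F x}"
      unfolding bounded_iff by (intro exI[of _ c]) force
    moreover have "{x \<in> C. norm x \<le> F x} \<in> sets borel" by measurable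
    ultimately show ?thesis by (intro bounded_set_imp_lmeasurable) auto
  qed auto
  show "a * measure lebesgue (cball 0 1 \<inter> C) \<le> measure lebesgue {x \<in> C. norm x \<le> F x}"
  proof (cases "a = 0")
    case False
    then obtain c where c: "c \<ge> 0" "c ^ N = a" using ab(1) root by metis
    with False N have "c > 0" by (cases "c = 0") auto
    have "c \<le> F x" if "x \<in> C" for x
      using ab(2)[OF that] c N unfolding N_def by (metis power_mono_iff zero_less_card_finite)
    then have "{x \<in> C. norm x \<le> c} \<subseteq> {x \<in> C. norm x \<le> F x}" by force
    then have "measure lebesgue {x \<in> C. norm x \<le> c} \<le> measure lebesgue {x \<in> C. norm x \<le> F x}"
      using scale[OF \<open>c > 0\<close>] K by (intro measure_mono_fmeasurable) auto
    then show ?thesis using scale[OF \<open>c > 0\<close>] c by simp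
  qed auto
  show "measure lebesgue {x \<in> C. norm x \<le> F x} \<le> b * measure lebesgue (cball 0 1 \<inter> C)"
  proof (cases "C = {}")
    case False
    then obtain c where c: "c \<ge> 0" "c ^ N = b" using b root by (meson ex_in_conv)
    have Fc: "F x \<le> c" if "x \<in> C" for x
      using ab(2)[OF that] c N unfolding N_def by (metis power_mono_iff zero_less_card_finite)
    show ?thesis
    \<comment> \<open>Dilation by 0 is outside \<open>scale\<close>; the set then lies in
      \<open>{0}\<close>.\<close>
    proof (cases "c = 0")
      case True
      then have "x = 0" if "x \<in> C" "norm x \<le> F x" for x
        using Fc[OF that(1)] that(2) norm_ge_zero[of x] by (metis norm_le_zero_iff order_trans)
      then have "{x \<in> C. norm x \<le> F x} \<subseteq> {0}" by blast
      then have "negligible {x \<in> C. norm x \<le> F x}" by (rule negligible_subset[rotated]) auto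
      then have "measure lebesgue {x \<in> C. norm x \<le> F x} = 0"
        by (rule negligible_imp_measure0)
      then show ?thesis using b False by auto
    next
      case False
      with c have "c > 0" by simp
      have "{x \<in> C. norm x \<le> F x} \<subseteq> {x \<in> C. norm x \<le> c}" using Fc by force
      then have "measure lebesgue {x \<in> C. norm x \<le> F x} \<le> measure lebesgue {x \<in> C. norm x \<le> c}"
        using scale[OF \<open>c > 0\<close>] K by (intro measure_mono_fmeasurable) auto
      then show ?thesis using scale[OF \<open>c > 0\<close>] c by simp
    qed
  qed auto
qed

text \<open>Both sides are compared on the finitely many cones where \<open>\<lfloor>m * r ^ N\<rfloor>\<close> is constant.\<close>

lemma star_body_volume:
  fixes r :: "real^'n \<Rightarrow> real"
  assumes r: "continuous_on (sphere 0 1) r" and pos: "\<And>x. x \<in> sphere 0 1 \<Longrightarrow> r x > 0"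
    and K: "\<And>x. x \<noteq> 0 \<Longrightarrow> x \<in> K \<longleftrightarrow> norm x \<le> r (x /\<^sub>R norm x)"
  shows "sph_int (\<lambda>x. r x ^ CARD('n)) = real CARD('n) * measure lebesgue K"
proof -
  let ?N = "CARD('n)"
  define F where "F x = (if x \<in> {0} then 0 else r (x /\<^sub>R norm x))" for x
  define G where "G x = F x ^ ?N" for x
  have Fm[measurable]: "F \<in> borel_measurable borel"
    unfolding F_def by (rule borel_measurable_dir[OF r])
  have Gm[measurable]: "G \<in> borel_measurable borel" unfolding G_def by measurable
  have hom: "F (s *\<^sub>R x) = F x" if "s > 0" for s x
  proof -
    have "inverse (norm (s *\<^sub>R x)) * s = inverse (norm x)" using that by simp
    then have "(s *\<^sub>R x) /\<^sub>R norm (s *\<^sub>R x) = x /\<^sub>R norm x" by (simp only: scaleR_scaleR)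
    then show ?thesis using that by (simp add: F_def del: norm_scaleR scaleR_scaleR)
  qed
  have Fpos: "F x > 0" if "x \<noteq> 0" for x
    using that pos[of "x /\<^sub>R norm x"] by (simp add: F_def)
  obtain B where B: "B \<ge> 0" "\<And>x. x \<in> sphere 0 1 \<Longrightarrow> \<bar>r x ^ ?N\<bar> \<le> B"
    using sph_continuous_bounded[of "\<lambda>x. r x ^ ?N"] r by (auto intro: continuous_intros)
  have GB: "0 \<le> G x \<and> G x \<le> B" for x
  proof (cases "x = 0")
    case False
    then show ?thesis using B(2)[of "x /\<^sub>R norm x"] Fpos[of x] by (simp add: G_def F_def)
  qed (simp add: G_def F_def B power_0_left)
  let ?I = "integral (cball 0 1) G"
  have Gint: "G integrable_on cball 0 1"
    using sph_integrable_continuous[of "\<lambda>x. r x ^ ?N"] r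
    unfolding sph_integrable_def
    by (rule_tac integrable_spike_finite[of "{0}", rotated 2]) (auto simp: G_def F_def intro: continuous_intros)
  have I: "sph_int (\<lambda>x. r x ^ ?N) = real ?N * ?I"
    unfolding sph_int_def
    by (simp, intro integral_spike[of "{0}"]) (auto simp: G_def F_def)
  let ?v = "measure lebesgue (cball (0::real^'n) 1)"
  \<comment> \<open>1 / m is the mesh of the level partition of \<open>G\<close>. Each cone
    contributes to the error at most its share of the ball volume divided by m, and the shares add
    up to \<open>?v\<close>.\<close>
  have bound: "\<bar>measure lebesgue K - ?I\<bar> \<le> ?v / real m" if m: "m > 0" for m :: nat
  proof -
    define J where "J = nat \<lfloor>real m * B\<rfloor>"
    \<comment> \<open>\<open>K\<close> is unconstrained at the origin, so the cones cover only the
      complement of 0; the missing point is restored as a null set.\<close>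
    define C where "C j = {x. x \<noteq> 0 \<and> nat \<lfloor>real m * G x\<rfloor> = j}" for j
    let ?J = "{..J}"
    have Cm: "C j \<in> sets borel" for j unfolding C_def by measurable
    have Chom: "s *\<^sub>R x \<in> C j \<longleftrightarrow> x \<in> C j" if "s > 0" for s x j
      using that by (auto simp: C_def G_def hom)
    have cover: "(\<Union>j\<in>?J. C j) = - {0}"
    proof -
      have "nat \<lfloor>real m * G x\<rfloor> \<le> J" for x
        unfolding J_def using GB[of x] by (intro nat_mono floor_mono mult_left_mono) auto
      then show ?thesis by (auto simp: C_def)
    qed
    have bd: "real j / real m \<le> G x \<and> G x \<le> (real j + 1) / real m \<and> 0 \<le> F x" if "x \<in> C j" for x j
    proof -
      have "real j = of_int \<lfloor>real m * G x\<rfloor>" using that GB[of x] by (auto simp: C_def)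
      then have "real j \<le> real m * G x" "real m * G x \<le> real j + 1" by linarith+
      then show ?thesis using m Fpos[of x] that by (auto simp: divide_simps mult.commute C_def less_imp_le)
    qed
    let ?K = "\<lambda>j. {x \<in> C j. norm x \<le> F x}"
    let ?T = "\<lambda>j. cball 0 1 \<inter> C j"
    have cone: "?K j \<in> lmeasurable"
      "real j / real m * measure lebesgue (?T j) \<le> measure lebesgue (?K j)"
      "measure lebesgue (?K j) \<le> (real j + 1) / real m * measure lebesgue (?T j)" for j
    proof -
      have bdj: "real j / real m \<le> F x ^ ?N \<and> F x ^ ?N \<le> (real j + 1) / real m \<and> 0 \<le> F x"
        if "x \<in> C j" for x
        using bd[OF that] by (simp add: G_def)
      show "?K j \<in> lmeasurable"
        "real j / real m * measure lebesgue (?T j) \<le> measure lebesgue (?K j)"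
        "measure lebesgue (?K j) \<le> (real j + 1) / real m * measure lebesgue (?T j)"
        using star_body_cone_measure[OF Fm hom Cm[of j] Chom _ bdj] by auto
    qed
    have one: "((\<lambda>x. 1::real) has_integral measure lebesgue S) S" if "S \<in> lmeasurable" for S :: "(real^'n) set"
      using lmeasure_integral[OF that] that by (simp only: has_integral_iff lmeasurable_iff_integrable_on)
    \<comment> \<open>Reads a volume off \<open>has_integral\<close> alone. \<open>K\<close> comes
      without a measurability assumption and receives its measure this way.\<close>
    have one': "measure lebesgue S = t" if "((\<lambda>x. 1::real) has_integral t) S" for S :: "(real^'n) set" and t
      using that lmeasure_integral[of S] by (simp only: has_integral_iff lmeasurable_iff_integrable_on)
    have Tm: "?T j \<in> lmeasurable" for j
      using Cm[of j] by (intro bounded_set_imp_lmeasurable) (auto intro: bounded_subset)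
    have disj: "pairwise (\<lambda>i j. negligible (S i \<inter> S j)) ?J" if S: "\<And>j. S j \<subseteq> C j" for S
    proof -
      have "C i \<inter> C j = {}" if "i \<noteq> j" for i j
        using that by (auto simp: C_def)
      then have "S i \<inter> S j = {}" if "i \<noteq> j" for i j
        using that S[of i] S[of j] by blast
      then show ?thesis by (auto simp: pairwise_def)
    qed
    have T_union: "(\<Union>j\<in>?J. ?T j) = cball 0 1 - {0}" using cover by auto
    have K_union: "(\<Union>j\<in>?J. ?K j) = K - {0}"
      using cover K by (auto simp: F_def)
    have Gj: "G integrable_on ?T j" for j
    proof (rule measurable_bounded_by_integrable_imp_integrable_real)
      show "G \<in> borel_measurable (lebesgue_on (?T j))"
        using Gm by (intro measurable_restrict_space1 measurable_completion) simp
      show "(\<lambda>x. B) integrable_on ?T j"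
        by (rule integrable_on_const[OF Tm])
    qed (use GB Tm[of j] in auto)
    have "(G has_integral (\<Sum>j\<in>?J. integral (?T j) G)) (cball 0 1 - {0})"
      unfolding T_union[symmetric]
      by (intro has_integral_UN disj integrable_integral Gj) auto
    then have sumG: "?I = (\<Sum>j\<in>?J. integral (?T j) G)"
      using integrable_integral_minus_origin[of G] by (simp add: integral_unique)
    have "((\<lambda>x. 1) has_integral (\<Sum>j\<in>?J. measure lebesgue (?K j))) (K - {0})"
      unfolding K_union[symmetric]
      by (intro has_integral_UN disj) (auto intro: one cone(1))
    then have "((\<lambda>x. 1) has_integral (\<Sum>j\<in>?J. measure lebesgue (?K j))) K"
      by (rule has_integral_spike_set_eq[THEN iffD1, rotated -1])
         (auto intro: negligible_subset[of "{0}"])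
    then have sumK: "measure lebesgue K = (\<Sum>j\<in>?J. measure lebesgue (?K j))"
      by (rule one')
    have "((\<lambda>x. 1) has_integral (\<Sum>j\<in>?J. measure lebesgue (?T j))) (cball (0::real^'n) 1 - {0})"
      unfolding T_union[symmetric]
      by (intro has_integral_UN disj) (auto intro: one Tm)
    then have "((\<lambda>x. 1) has_integral (\<Sum>j\<in>?J. measure lebesgue (?T j))) (cball (0::real^'n) 1)"
      by (rule has_integral_spike_set_eq[THEN iffD1, rotated -1])
         (auto intro: negligible_subset[of "{0}"])
    then have sumT: "?v = (\<Sum>j\<in>?J. measure lebesgue (?T j))"
      by (rule one')
    have cmp: "\<bar>measure lebesgue (?K j) - integral (?T j) G\<bar> \<le> measure lebesgue (?T j) / real m" for j
    proof -
      have int1: "(\<lambda>x. c) integrable_on ?T j" "integral (?T j) (\<lambda>x. c) = c * measure lebesgue (?T j)" for c :: real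
        using integrable_on_const[OF Tm] has_integral_mult_right[OF one[OF Tm[of j]], of c]
        by (auto simp: integral_unique)
      have "integral (?T j) (\<lambda>x. real j / real m) \<le> integral (?T j) G"
        by (intro integral_le int1 Gj) (use bd in auto)
      moreover have "integral (?T j) G \<le> integral (?T j) (\<lambda>x. (real j + 1) / real m)"
        by (intro integral_le int1 Gj) (use bd in auto)
      ultimately show ?thesis
        using cone(2,3)[of j] unfolding int1 by (auto simp: add_divide_distrib algebra_simps)
    qed
    then have "\<bar>\<Sum>j\<in>?J. measure lebesgue (?K j) - integral (?T j) G\<bar> \<le> (\<Sum>j\<in>?J. measure lebesgue (?T j) / real m)"
      by (intro order_trans[OF sum_abs] sum_mono)
    then show ?thesis
      unfolding sumG sumK sumT by (simp add: sum_subtractf sum_divide_distrib)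
  qed
  have "(\<lambda>m. ?v / real m) \<longlonglongrightarrow> 0" by (rule lim_const_over_n)
  then have "\<bar>measure lebesgue K - ?I\<bar> \<le> 0"
    by (rule LIMSEQ_le_const) (use bound in \<open>auto intro!: exI[of _ 1]\<close>)
  then show ?thesis unfolding I by simp
qed

section \<open>Rotation invariance\<close>

text \<open>Fubini with the \<open>c\<close> coordinate innermost: once the others are fixed,
  \<open>x \<bullet> b\<close> is constant because \<open>b \<noteq> c\<close>, and the shear
  becomes a translation of the real line.\<close>

lemma lborel_distr_shear:
  fixes b c :: "'a::euclidean_space"
  assumes b: "b \<in> Basis" and c: "c \<in> Basis" and ne: "b \<noteq> c"
  shows "distr lborel borel (\<lambda>x. x + (s * (x \<bullet> b)) *\<^sub>R c) = lborel"
proof -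
  let ?S = "\<lambda>x::'a. x + (s * (x \<bullet> b)) *\<^sub>R c"
  let ?P = "\<lambda>f::'a\<Rightarrow>real. \<Sum>b\<in>Basis. f b *\<^sub>R b"
  interpret product_sigma_finite "\<lambda>_::'a. lborel :: real measure"
    by (simp add: product_sigma_finite_def lborel.sigma_finite_measure_axioms)
  have S[measurable]: "?S \<in> borel \<rightarrow>\<^sub>M borel" by measurable
  have P[measurable]: "?P \<in> Pi\<^sub>M Basis (\<lambda>_. lborel) \<rightarrow>\<^sub>M borel"
    by measurable
  have ins: "insert c (Basis - {c}) = (Basis :: 'a set)" using c by auto
  have nn: "(\<integral>\<^sup>+x. f x \<partial>lborel) =
     (\<integral>\<^sup>+y. \<integral>\<^sup>+t. f (?P (y(c := t))) \<partial>lborel \<partial>Pi\<^sub>M (Basis - {c}) (\<lambda>_. lborel))"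
    if f[measurable]: "f \<in> borel_measurable borel" for f :: "'a \<Rightarrow> ennreal"
  proof -
    have "(\<integral>\<^sup>+x. f x \<partial>lborel) = (\<integral>\<^sup>+y. f (?P y) \<partial>Pi\<^sub>M Basis (\<lambda>_. lborel))"
      unfolding lborel_eq_real[symmetric] by (subst lborel_def) (simp add: nn_integral_distr lborel_eq_real)
    also have "\<dots> = (\<integral>\<^sup>+y. f (?P y) \<partial>Pi\<^sub>M (insert c (Basis - {c})) (\<lambda>_. lborel))"
      unfolding ins ..
    also have "\<dots> = (\<integral>\<^sup>+y. \<integral>\<^sup>+t. f (?P (y(c := t))) \<partial>lborel \<partial>Pi\<^sub>M (Basis - {c}) (\<lambda>_. lborel))"
      by (subst product_nn_integral_insert) (auto simp: ins)
    finally show ?thesis .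
  qed
  show ?thesis
  proof (rule measure_eqI)
    fix A assume "A \<in> sets (distr lborel borel ?S)"
    then have A[measurable]: "A \<in> sets borel" by simp
    \<comment> \<open>The factor 1 gives the affine shape of
      \<open>nn_integral_real_affine\<close>.\<close>
    have shift: "?S (?P (y(c := t))) = ?P (y(c := s * y b + 1 * t))" for y t
    proof -
      have "?P (y(c := t)) \<bullet> b = y b" using b ne by (simp add: inner_sum_left_Basis)
      moreover have "?P (y(c := s * y b + t)) = ?P (y(c := t)) + (s * y b) *\<^sub>R c" for t
        using c by (simp add: sum.remove[of Basis c] scaleR_add_left)
      ultimately show ?thesis by simp
    qed
    have "emeasure (distr lborel borel ?S) A = (\<integral>\<^sup>+x. indicator A (?S x) \<partial>lborel)"
      by (simp add: nn_integral_indicator[symmetric] nn_integral_distr del: nn_integral_indicator)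
    also have "\<dots> = (\<integral>\<^sup>+y. \<integral>\<^sup>+t. indicator A (?P (y(c := s * y b + 1 * t))) \<partial>lborel
        \<partial>Pi\<^sub>M (Basis - {c}) (\<lambda>_. lborel))"
      by (subst nn) (simp_all only: shift, measurable)
    also have "\<dots> = (\<integral>\<^sup>+y. \<integral>\<^sup>+t. indicator A (?P (y(c := t))) \<partial>lborel
        \<partial>Pi\<^sub>M (Basis - {c}) (\<lambda>_. lborel))"
    proof (rule nn_integral_cong)
      fix y assume y: "y \<in> space (Pi\<^sub>M (Basis - {c}) (\<lambda>_. lborel :: real measure))"
      have "(\<lambda>t. ?P (y(c := t))) = (\<lambda>t. ?P (y(c := 0)) + t *\<^sub>R c)"
        using c by (auto simp: sum.remove[of Basis c])
      then have "(\<lambda>t. indicator A (?P (y(c := t))) :: ennreal) \<in> borel_measurable borel"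
        by (simp add: measurable_compose[OF _ borel_measurable_indicator[OF A]])
      from nn_integral_real_affine[OF this, of 1 "s * y b"]
      show "(\<integral>\<^sup>+t. indicator A (?P (y(c := s * y b + 1 * t))) \<partial>lborel) =
        (\<integral>\<^sup>+t. indicator A (?P (y(c := t))) \<partial>lborel :: ennreal)" by simp
    qed
    also have "\<dots> = emeasure lborel A"
      by (subst nn[symmetric]) auto
    finally show "emeasure (distr lborel borel ?S) A = emeasure lborel A" .
  qed simp
qed

text \<open>Rotation by the angle \<open>t\<close> in the plane of \<open>b\<close> and
  \<open>c\<close>, written as the identity plus a correction in that plane. Its velocity at
  \<open>t = 0\<close> is the field
  \<open>(x \<bullet> b) *\<^sub>R c - (x \<bullet> c) *\<^sub>R b\<close>.\<close>

definition plane_rotation :: "'a::euclidean_space \<Rightarrow> 'a \<Rightarrow> real \<Rightarrow> 'a \<Rightarrow> 'a" where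
  "plane_rotation b c t x = x + ((cos t - 1) * (x \<bullet> b) - sin t * (x \<bullet> c)) *\<^sub>R b
     + ((cos t - 1) * (x \<bullet> c) + sin t * (x \<bullet> b)) *\<^sub>R c"

text \<open>A rotation is a product of three shears.\<close>

lemma lborel_distr_plane_rotation:
  fixes b c :: "'a::euclidean_space"
  assumes b: "b \<in> Basis" and c: "c \<in> Basis" and ne: "b \<noteq> c" and t: "sin t \<noteq> 0"
  shows "distr lborel borel (plane_rotation b c t) = lborel"
proof -
  \<comment> \<open>This is - tan (t / 2), which is why \<open>sin t\<close> must not vanish;
    \<open>k1\<close> and \<open>k2\<close> are half-angle identities.\<close>
  define k where "k = (cos t - 1) / sin t"
  let ?S1 = "\<lambda>x::'a. x + (k * (x \<bullet> c)) *\<^sub>R b"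
  let ?S2 = "\<lambda>x::'a. x + (sin t * (x \<bullet> b)) *\<^sub>R c"
  have bc: "b \<bullet> b = 1" "c \<bullet> c = 1" "b \<bullet> c = 0" "c \<bullet> b = 0"
    using assms by (auto simp: inner_Basis)
  have k1: "k * sin t = cos t - 1" using t by (simp add: k_def)
  have k2: "k * (cos t + 1) = - sin t"
    using t unfolding k_def by (simp add: field_simps)
  have "plane_rotation b c t = (\<lambda>x. ?S1 (?S2 (?S1 x)))"
  proof
    fix x :: 'a
    define p q where "p = k * (x \<bullet> c) + k * (x \<bullet> c + sin t * (x \<bullet> b + k * (x \<bullet> c)))"
      and "q = sin t * (x \<bullet> b + k * (x \<bullet> c))"
    have "p = (k * sin t) * (x \<bullet> b) + (k * (k * sin t + 2)) * (x \<bullet> c)"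
      unfolding p_def q_def by algebra
    moreover have "k * (k * sin t + 2) = - sin t" using k2 unfolding k1 by (simp add: algebra_simps)
    ultimately have p: "p = (cos t - 1) * (x \<bullet> b) - sin t * (x \<bullet> c)"
      unfolding k1 by simp
    have "q = sin t * (x \<bullet> b) + (k * sin t) * (x \<bullet> c)"
      unfolding p_def q_def by algebra
    then have q: "q = (cos t - 1) * (x \<bullet> c) + sin t * (x \<bullet> b)"
      unfolding k1 by simp
    have "?S1 (?S2 (?S1 x)) = x + (sin t * (x \<bullet> b + k * (x \<bullet> c))) *\<^sub>R c +
        (k * (x \<bullet> c)) *\<^sub>R b + (k * (x \<bullet> c + sin t * (x \<bullet> b + k * (x \<bullet> c)))) *\<^sub>R b"
      by (simp add: inner_add_left bc add_ac)
    then have "?S1 (?S2 (?S1 x)) = x + q *\<^sub>R c + p *\<^sub>R b"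
      unfolding p_def q_def by (simp only: scaleR_add_left add.assoc)
    then show "plane_rotation b c t x = ?S1 (?S2 (?S1 x))"
      unfolding p q plane_rotation_def by (simp only: add_ac)
  qed
  moreover have "distr (distr (distr lborel borel ?S1) borel ?S2) borel ?S1 =
      distr lborel borel (?S1 \<circ> (?S2 \<circ> ?S1))"
    by (simp add: distr_distr)
  ultimately show ?thesis
    using lborel_distr_shear[OF b c ne, of "sin t"] lborel_distr_shear[OF c b ne[symmetric], of k]
    by (simp add: comp_def)
qed

lemma inner_plane_rotation:
  fixes b c :: "'a::euclidean_space"
  assumes "b \<in> Basis" "c \<in> Basis" "b \<noteq> c"
  shows "plane_rotation b c t x \<bullet> plane_rotation b c t x = x \<bullet> x"
proof -
  have bc: "b \<bullet> b = 1" "c \<bullet> c = 1" "b \<bullet> c = 0" "c \<bullet> b = 0"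
    using assms by (auto simp: inner_Basis)
  have cs: "(cos t)\<^sup>2 + (sin t)\<^sup>2 = 1" by simp
  define u v C S where "u = x \<bullet> b" "v = x \<bullet> c" "C = cos t" "S = sin t"
  have "plane_rotation b c t x \<bullet> plane_rotation b c t x = x \<bullet> x
    + 2 * ((C - 1) * u - S * v) * u + 2 * ((C - 1) * v + S * u) * v
    + ((C - 1) * u - S * v)\<^sup>2 + ((C - 1) * v + S * u)\<^sup>2"
    unfolding plane_rotation_def u_v_C_S_def
    by (simp add: inner_add_left inner_add_right bc inner_commute[of b x] inner_commute[of c x])
       (simp add: algebra_simps power2_eq_square)
  also have "\<dots> = x \<bullet> x + (u\<^sup>2 + v\<^sup>2) * (C\<^sup>2 + S\<^sup>2 - 1)" by algebra
  finally show ?thesis using cs unfolding u_v_C_S_def by simp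
qed

lemma norm_plane_rotation:
  assumes "b \<in> Basis" "c \<in> Basis" "b \<noteq> c"
  shows "norm (plane_rotation b c t x) = norm x"
  unfolding norm_eq_sqrt_inner inner_plane_rotation[OF assms] ..

lemma plane_rotation_scaleR: "plane_rotation b c t (s *\<^sub>R x) = s *\<^sub>R plane_rotation b c t x"
  by (simp add: plane_rotation_def algebra_simps)

lemma continuous_plane_rotation [continuous_intros]:
  "continuous_on A (plane_rotation b c t)"
  unfolding plane_rotation_def by (intro continuous_intros)

text \<open>The punctured ball and the projection \<open>x /\<^sub>R norm x\<close> are both
  compatible with the rotation, so invariance of Lebesgue measure descends to the sphere.\<close>

lemma sph_int_plane_rotation:
  fixes f :: "real^'n \<Rightarrow> real"
  assumes b: "b \<in> Basis" and c: "c \<in> Basis" and ne: "b \<noteq> c" and t: "sin t \<noteq> 0"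
    and f: "continuous_on (sphere 0 1) f"
  shows "sph_int (\<lambda>x. f (plane_rotation b c t x)) = sph_int f"
proof -
  let ?R = "plane_rotation b c t"
  let ?h = "\<lambda>x. indicator (cball 0 1 - {0}) x * f (x /\<^sub>R norm x)"
  have R: "continuous_on (sphere 0 1) (\<lambda>x. f (?R x))"
    by (rule continuous_on_compose2[OF f]) (auto intro: continuous_intros simp: norm_plane_rotation[OF b c ne])
  have Rm: "?R \<in> borel \<rightarrow>\<^sub>M borel"
    by (intro borel_measurable_continuous_onI continuous_intros)
  have hm: "?h \<in> borel_measurable borel"
    using integrable_dir_lborel[OF f] by (simp add: borel_measurable_integrable)
  have "integral\<^sup>L lborel ?h = integral\<^sup>L (distr lborel borel ?R) ?h"
    by (simp add: lborel_distr_plane_rotation[OF b c ne t])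
  also have "\<dots> = (\<integral>x. ?h (?R x) \<partial>lborel)"
    by (rule integral_distr) (use Rm hm in auto)
  also have "(\<lambda>x. ?h (?R x)) = (\<lambda>x. indicator (cball 0 1 - {0}) x * f (?R (x /\<^sub>R norm x)))"
  proof
    fix x :: "real^'n"
    have "?R x = 0 \<longleftrightarrow> x = 0" by (metis norm_plane_rotation[OF b c ne] norm_eq_zero)
    then show "?h (?R x) = indicator (cball 0 1 - {0}) x * f (?R (x /\<^sub>R norm x))"
      by (simp add: norm_plane_rotation[OF b c ne] plane_rotation_scaleR indicator_def)
  qed
  finally show ?thesis
    unfolding sph_int_eq_lborel[OF f] sph_int_eq_lborel[OF R] by simp
qed

section \<open>Integration by parts on the sphere\<close>

text \<open>A crude bound, linear in \<open>t\<close> and uniform over the sphere: it supplies the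
  domination when the rotated integral is differentiated.\<close>

lemma norm_plane_rotation_diff:
  fixes b c x :: "'a::euclidean_space"
  assumes "b \<in> Basis" "c \<in> Basis" "norm x = 1"
  shows "norm (plane_rotation b c t x - x) \<le> 6 * \<bar>t\<bar>"
proof -
  have xb: "\<bar>x \<bullet> b\<bar> \<le> 1" "\<bar>x \<bullet> c\<bar> \<le> 1"
    using assms Basis_le_norm[of b x] Basis_le_norm[of c x] by auto
  have s: "\<bar>sin t\<bar> \<le> \<bar>t\<bar>" by (rule abs_sin_x_le_abs_x)
  have co: "\<bar>cos t - 1\<bar> \<le> 2 * \<bar>t\<bar>"
  proof -
    have "cos t - 1 = - 2 * (sin (t/2) * sin (t/2))"
      using cos_double[of "t/2"] sin_cos_squared_add[of "t/2"] by (simp add: power2_eq_square)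
    then have "\<bar>cos t - 1\<bar> = 2 * (\<bar>sin (t/2)\<bar> * \<bar>sin (t/2)\<bar>)" by (simp add: abs_mult)
    also have "\<dots> \<le> 2 * (\<bar>t/2\<bar> * 1)"
      by (intro mult_left_mono mult_mono abs_sin_x_le_abs_x) auto
    finally show ?thesis by simp
  qed
  have e: "\<bar>p * u + q * v\<bar> \<le> 3 * \<bar>t\<bar>"
    if "\<bar>p\<bar> \<le> 2 * \<bar>t\<bar>" "\<bar>q\<bar> \<le> \<bar>t\<bar>" "\<bar>u\<bar> \<le> 1" "\<bar>v\<bar> \<le> 1" for p q u v
  proof -
    have "\<bar>p\<bar> * \<bar>u\<bar> \<le> (2 * \<bar>t\<bar>) * 1" "\<bar>q\<bar> * \<bar>v\<bar> \<le> \<bar>t\<bar> * 1"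
      by (rule mult_mono; use that in simp)+
    then have "\<bar>p * u\<bar> \<le> 2 * \<bar>t\<bar>" "\<bar>q * v\<bar> \<le> \<bar>t\<bar>"
      by (simp_all add: abs_mult)
    then show ?thesis by linarith
  qed
  have nb: "norm b = 1" "norm c = 1" using assms by auto
  have "norm (plane_rotation b c t x - x) \<le>
      norm (((cos t - 1) * (x \<bullet> b) + (- sin t) * (x \<bullet> c)) *\<^sub>R b) +
      norm (((cos t - 1) * (x \<bullet> c) + sin t * (x \<bullet> b)) *\<^sub>R c)"
    unfolding plane_rotation_def by (rule order_trans[OF _ norm_triangle_ineq]) simp
  also have "\<dots> \<le> 3 * \<bar>t\<bar> + 3 * \<bar>t\<bar>"
    unfolding norm_scaleR nb mult_1_right real_norm_def
    by (intro add_mono e) (use xb s co in auto)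
  finally show ?thesis by simp
qed

text \<open>The mean value inequality wants a convex domain, hence the ball; the estimate is applied
  on the sphere inside it.\<close>

lemma gradient_lipschitz_on_ball:
  fixes P :: "real^'n \<Rightarrow> real"
  assumes P: "\<And>x. (P has_derivative (\<lambda>v. D x \<bullet> v)) (at x)" and D: "continuous_on UNIV D"
  obtains L where "L \<ge> 0" "\<And>x y. x \<in> cball 0 1 \<Longrightarrow> y \<in> cball 0 1 \<Longrightarrow> \<bar>P x - P y\<bar> \<le> L * norm (x - y)"
proof -
  have "bounded (D ` cball 0 1)"
    by (intro compact_imp_bounded compact_continuous_image continuous_on_subset[OF D]) auto
  then obtain L where L: "\<And>x. x \<in> cball 0 1 \<Longrightarrow> norm (D x) \<le> L"
    unfolding bounded_iff by (meson image_eqI)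
  have "norm (P x - P y) \<le> max L 0 * norm (x - y)" if "x \<in> cball 0 1" "y \<in> cball 0 1" for x y
  proof (rule differentiable_bound[of "cball 0 1"])
    fix x :: "real^'n" assume x: "x \<in> cball 0 1"
    show "(P has_derivative (\<lambda>v. D x \<bullet> v)) (at x within cball 0 1)"
      using P by (rule has_derivative_at_withinI)
    have "\<bar>D x \<bullet> v\<bar> \<le> max L 0 * norm v" for v
    proof -
      have "\<bar>D x \<bullet> v\<bar> \<le> norm (D x) * norm v" by (rule Cauchy_Schwarz_ineq2)
      also have "\<dots> \<le> max L 0 * norm v" using L[OF x] by (intro mult_right_mono) auto
      finally show ?thesis .
    qed
    then show "onorm ((\<bullet>) (D x)) \<le> max L 0"
      by (intro onorm_bound) auto
  qed (use that in auto)
  then show ?thesis by (intro that[of "max L 0"]) auto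
qed

text \<open>The rotated integral is constant in the angle, so its derivative at angle 0, computed
  under the integral sign, vanishes.\<close>

lemma sph_int_rotation_field:
  fixes P :: "real^'n \<Rightarrow> real"
  assumes P: "\<And>x. (P has_derivative (\<lambda>v. D x \<bullet> v)) (at x)" and D: "continuous_on UNIV D"
    and b: "b \<in> Basis" and c: "c \<in> Basis"
  shows "sph_int (\<lambda>x. D x \<bullet> ((x \<bullet> b) *\<^sub>R c - (x \<bullet> c) *\<^sub>R b)) = 0"
proof (cases "b = c")
  case True
  then show ?thesis by (simp add: sph_int_def)
next
  case ne: False
  let ?R = "plane_rotation b c"
  have Pc: "continuous_on A P" for A
    using P by (intro continuous_at_imp_continuous_on ballI) (rule has_derivative_continuous)
  obtain L where L: "L \<ge> 0" "\<And>x y. x \<in> cball 0 1 \<Longrightarrow> y \<in> cball 0 1 \<Longrightarrow> \<bar>P x - P y\<bar> \<le> L * norm (x - y)"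
    using gradient_lipschitz_on_ball[OF P D] by blast
  have R0: "?R 0 x = x" for x by (simp add: plane_rotation_def)
  \<comment> \<open>The shear decomposition needs \<open>sin t \<noteq> 0\<close>; for angles below
    1 this fails only at \<open>t = 0\<close>, where the rotation is the identity.\<close>
  have const: "sph_int (\<lambda>x. P (?R t x)) = sph_int P" if "\<bar>t\<bar> < 1" for t
  proof (cases "t = 0")
    case False
    have "sin t \<noteq> 0"
    proof (cases "t > 0")
      case True
      then show ?thesis using sin_gt_zero[of t] that pi_gt3 by auto
    next
      case f: False
      then show ?thesis using sin_gt_zero[of "- t"] that pi_gt3 False by auto
    qed
    then show ?thesis by (rule sph_int_plane_rotation[OF b c ne _ Pc])
  qed (simp add: R0)
  have "((\<lambda>t. sph_int (\<lambda>x. P (?R t x))) has_real_derivative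
      sph_int (\<lambda>x. D x \<bullet> ((x \<bullet> b) *\<^sub>R c - (x \<bullet> c) *\<^sub>R b))) (at 0)"
  proof (rule sph_int_dominated_derivative(2)[where d=1 and L="L * 6"])
    show "sph_integrable (\<lambda>x. P (?R t x))" for t
      by (intro sph_integrable_continuous continuous_on_compose2[OF Pc[of UNIV]] continuous_intros) auto
    fix x :: "real^'n" assume x: "x \<in> sphere 0 1"
    have "((\<lambda>t. ?R t x) has_vector_derivative ((x \<bullet> b) *\<^sub>R c - (x \<bullet> c) *\<^sub>R b)) (at 0)"
      unfolding plane_rotation_def
      by (auto intro!: derivative_eq_intros simp: has_vector_derivative_def fun_eq_iff algebra_simps)
    then have "((\<lambda>t. P (?R t x)) has_derivative (\<lambda>t. D (?R 0 x) \<bullet> (t *\<^sub>R ((x \<bullet> b) *\<^sub>R c - (x \<bullet> c) *\<^sub>R b)))) (at 0)"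
      unfolding has_vector_derivative_def by (rule has_derivative_compose) (rule P)
    then show "((\<lambda>t. P (?R t x)) has_real_derivative D x \<bullet> ((x \<bullet> b) *\<^sub>R c - (x \<bullet> c) *\<^sub>R b)) (at 0)"
      by (simp add: has_field_derivative_def R0 mult_commute_abs)
    fix t :: real
    have "\<bar>P (?R t x) - P x\<bar> \<le> L * norm (?R t x - x)"
      using x by (intro L) (auto simp: norm_plane_rotation[OF b c ne])
    also have "\<dots> \<le> L * (6 * \<bar>t\<bar>)"
      using x by (intro mult_left_mono norm_plane_rotation_diff b c L) auto
    finally show "\<bar>P (?R t x) - P (?R 0 x)\<bar> \<le> L * 6 * \<bar>t - 0\<bar>" by (simp add: R0)
  qed auto
  moreover have "((\<lambda>t. sph_int (\<lambda>x. P (?R t x))) has_real_derivative 0) (at 0)"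
    by (rule has_field_derivative_transform_within[OF DERIV_const[of "sph_int P"], of 1]) (auto simp: const)
  ultimately show ?thesis by (rule DERIV_unique)
qed

text \<open>Apply the previous lemma to \<open>(x \<bullet> b) * P x\<close> and sum over the basis vectors \<open>b\<close>.\<close>

lemma sph_int_gradient_Basis:
  fixes P :: "real^'n \<Rightarrow> real"
  assumes P: "\<And>x. (P has_derivative (\<lambda>v. D x \<bullet> v)) (at x)" and D: "continuous_on UNIV D"
    and c: "c \<in> Basis"
  shows "sph_int (\<lambda>x. D x \<bullet> c) =
    (real CARD('n) - 1) * sph_int (\<lambda>x. (x \<bullet> c) * P x) + sph_int (\<lambda>x. (x \<bullet> c) * (D x \<bullet> x))"
proof -
  have Pc: "continuous_on A P" for A
    using P by (intro continuous_at_imp_continuous_on ballI) (rule has_derivative_continuous)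
  have Dc: "continuous_on A D" for A by (rule continuous_on_subset[OF D]) auto
  let ?f = "\<lambda>b x. (P x *\<^sub>R b + (x \<bullet> b) *\<^sub>R D x) \<bullet> ((x \<bullet> b) *\<^sub>R c - (x \<bullet> c) *\<^sub>R b)"
  have 0: "sph_int (?f b) = 0" if "b \<in> Basis" for b
  proof (rule sph_int_rotation_field[where P="\<lambda>x. (x \<bullet> b) * P x"])
    show "((\<lambda>x. (x \<bullet> b) * P x) has_derivative (\<lambda>v. (P x *\<^sub>R b + (x \<bullet> b) *\<^sub>R D x) \<bullet> v)) (at x)" for x
      by (auto intro!: derivative_eq_intros P simp: fun_eq_iff inner_add_left inner_add_right inner_commute)
    show "continuous_on UNIV (\<lambda>x. P x *\<^sub>R b + (x \<bullet> b) *\<^sub>R D x)"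
      by (intro continuous_intros Pc D)
  qed (use that c in auto)
  \<comment> \<open>The factor N - 1 arises because N copies of \<open>P x * (x \<bullet> c)\<close>
    are subtracted, one per basis vector, and the expansion of \<open>x \<bullet> c\<close> gives
    one copy back.\<close>
  have sum: "(\<Sum>b\<in>Basis. ?f b x) = D x \<bullet> c - (real CARD('n) - 1) * ((x \<bullet> c) * P x) - (x \<bullet> c) * (D x \<bullet> x)"
    if x: "x \<in> sphere 0 1" for x
  proof -
    have xx: "(\<Sum>b\<in>Basis. (x \<bullet> b) * (x \<bullet> b)) = 1"
      using x euclidean_inner[of x x] by (simp add: norm_eq_1)
    have "?f b x = P x * ((x \<bullet> b) * (c \<bullet> b)) - P x * (x \<bullet> c)
       + (D x \<bullet> c) * ((x \<bullet> b) * (x \<bullet> b)) - (x \<bullet> c) * ((D x \<bullet> b) * (x \<bullet> b))" if "b \<in> Basis" for b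
      using that by (simp add: inner_add_left inner_diff_right inner_commute[of b c] algebra_simps inner_same_Basis)
    then have "(\<Sum>b\<in>Basis. ?f b x) = (\<Sum>b\<in>Basis. P x * ((x \<bullet> b) * (c \<bullet> b)) - P x * (x \<bullet> c)
       + (D x \<bullet> c) * ((x \<bullet> b) * (x \<bullet> b)) - (x \<bullet> c) * ((D x \<bullet> b) * (x \<bullet> b)))"
      by (rule sum.cong[OF refl])
    also have "\<dots> = P x * (\<Sum>b\<in>Basis. (x \<bullet> b) * (c \<bullet> b)) - real CARD('n) * (P x * (x \<bullet> c))
       + (D x \<bullet> c) * (\<Sum>b\<in>Basis. (x \<bullet> b) * (x \<bullet> b)) - (x \<bullet> c) * (\<Sum>b\<in>Basis. (D x \<bullet> b) * (x \<bullet> b))"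
      by (simp add: sum.distrib sum_subtractf sum_distrib_left)
    also have "\<dots> = P x * (x \<bullet> c) - real CARD('n) * (P x * (x \<bullet> c)) + (D x \<bullet> c) - (x \<bullet> c) * (D x \<bullet> x)"
      unfolding xx euclidean_inner[symmetric] by simp
    finally show ?thesis by (simp add: algebra_simps)
  qed
  have "0 = (\<Sum>b\<in>Basis. sph_int (?f b))" using 0 by simp
  also have "\<dots> = sph_int (\<lambda>x. \<Sum>b\<in>Basis. ?f b x)"
    by (intro sph_int_sum[symmetric] sph_integrable_continuous continuous_intros Pc Dc) auto
  also have "\<dots> = sph_int (\<lambda>x. D x \<bullet> c - (real CARD('n) - 1) * ((x \<bullet> c) * P x) - (x \<bullet> c) * (D x \<bullet> x))"
    by (rule sph_int_cong) (rule sum)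
  also have "\<dots> = sph_int (\<lambda>x. D x \<bullet> c) - (real CARD('n) - 1) * sph_int (\<lambda>x. (x \<bullet> c) * P x)
      - sph_int (\<lambda>x. (x \<bullet> c) * (D x \<bullet> x))"
    by (subst sph_int_diff sph_int_cmult; (intro sph_integrable_continuous continuous_intros Pc Dc)?)+
       (rule refl)
  finally show ?thesis by simp
qed

text \<open>The divergence theorem on the sphere: with the last term moved to the left, the
  tangential gradient is paired with \<open>u\<close>, and N - 1 is the mean curvature. Both sides
  are linear in \<open>u\<close>, so the basis case suffices.\<close>

lemma sph_int_gradient:
  fixes P :: "real^'n \<Rightarrow> real"
  assumes P: "\<And>x. (P has_derivative (\<lambda>v. D x \<bullet> v)) (at x)" and D: "continuous_on UNIV D"
  shows "sph_int (\<lambda>x. D x \<bullet> u) =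
    (real CARD('n) - 1) * sph_int (\<lambda>x. (x \<bullet> u) * P x) + sph_int (\<lambda>x. (x \<bullet> u) * (D x \<bullet> x))"
proof -
  have Pc: "continuous_on A P" for A
    using P by (intro continuous_at_imp_continuous_on ballI) (rule has_derivative_continuous)
  have Dc: "continuous_on A D" for A by (rule continuous_on_subset[OF D]) auto
  have expand: "sph_int (\<lambda>x. g x * (h x \<bullet> u)) = (\<Sum>c\<in>Basis. (u \<bullet> c) * sph_int (\<lambda>x. g x * (h x \<bullet> c)))"
    if "continuous_on (sphere 0 1) g" "continuous_on (sphere 0 1) h"
    for g :: "real^'n \<Rightarrow> real" and h :: "real^'n \<Rightarrow> real^'n"
  proof -
    have "sph_int (\<lambda>x. g x * (h x \<bullet> u)) = sph_int (\<lambda>x. \<Sum>c\<in>Basis. (u \<bullet> c) * (g x * (h x \<bullet> c)))"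
      by (rule sph_int_cong) (simp add: euclidean_inner[of _ u] sum_distrib_left mult_ac)
    also have "\<dots> = (\<Sum>c\<in>Basis. sph_int (\<lambda>x. (u \<bullet> c) * (g x * (h x \<bullet> c))))"
      by (intro sph_int_sum sph_integrable_continuous continuous_intros that) auto
    finally show ?thesis by (simp add: sph_int_cmult)
  qed
  have "sph_int (\<lambda>x. 1 * (D x \<bullet> u)) = (\<Sum>c\<in>Basis. (u \<bullet> c) * sph_int (\<lambda>x. 1 * (D x \<bullet> c)))"
    by (intro expand Dc continuous_intros)
  also have "\<dots> = (real CARD('n) - 1) * (\<Sum>c\<in>Basis. (u \<bullet> c) * sph_int (\<lambda>x. P x * (x \<bullet> c)))
       + (\<Sum>c\<in>Basis. (u \<bullet> c) * sph_int (\<lambda>x. (D x \<bullet> x) * (x \<bullet> c)))"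
    unfolding sum_distrib_left sum.distrib[symmetric]
    by (rule sum.cong[OF refl]) (simp add: sph_int_gradient_Basis[OF P D] algebra_simps)
  also have "\<dots> = (real CARD('n) - 1) * sph_int (\<lambda>x. P x * (x \<bullet> u)) + sph_int (\<lambda>x. (D x \<bullet> x) * (x \<bullet> u))"
    by (subst expand, intro Pc, intro continuous_intros, subst expand) (auto intro!: continuous_intros Dc)
  finally show ?thesis by (simp add: mult.commute)
qed

section \<open>Radial functions of Wulff shapes\<close>

definition radial :: "(real^'n \<Rightarrow> real) \<Rightarrow> real^'n \<Rightarrow> real" where
  "radial u x = Sup {s. s *\<^sub>R x \<in> body u}"

lemma body_iff: "y \<in> body u \<longleftrightarrow> (\<forall>z. norm z = 1 \<longrightarrow> z \<bullet> y \<le> u z)"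
  by (auto simp: body_def)

lemma closed_body: "closed (body u)"
proof -
  have "body u = (\<Inter>z\<in>sphere 0 1. {y. z \<bullet> y \<le> u z})" by (auto simp: body_def)
  then show ?thesis by (auto intro!: closed_INT closed_halfspace_le)
qed

lemma convex_body: "convex (body u)"
proof -
  have "body u = (\<Inter>z\<in>sphere 0 1. {y. z \<bullet> y \<le> u z})" by (auto simp: body_def)
  then show ?thesis by (auto intro!: convex_INT convex_halfspace_le)
qed

text \<open>Positivity makes 0 interior to the Wulff shape, and continuity lets the extremal
  constraints be attained. Every bounded continuous perturbation of 1 with small parameter is
  covered.\<close>

locale positive_sphere_fun =
  fixes u :: "real^'n \<Rightarrow> real"
  assumes cont: "continuous_on (sphere 0 1) u"
    and pos: "x \<in> sphere 0 1 \<Longrightarrow> u x > 0"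
begin

lemma bounds:
  obtains l h where "l > 0" "h > 0" "\<And>x. x \<in> sphere 0 1 \<Longrightarrow> l \<le> u x \<and> u x \<le> h"
proof -
  have ne: "sphere (0::real^'n) 1 \<noteq> {}" by auto
  obtain a where a: "a \<in> sphere 0 1" "\<And>x. x \<in> sphere 0 1 \<Longrightarrow> u a \<le> u x"
    using continuous_attains_inf[OF compact_sphere ne cont] by blast
  obtain b where b: "b \<in> sphere 0 1" "\<And>x. x \<in> sphere 0 1 \<Longrightarrow> u x \<le> u b"
    using continuous_attains_sup[OF compact_sphere ne cont] by blast
  show ?thesis using a b pos[OF a(1)] pos[OF b(1)] by (intro that[of "u a" "u b"]) auto
qed

lemma compact_body: "compact (body u)"
proof -
  obtain l h where lh: "l > 0" "h > 0" "\<And>x. x \<in> sphere 0 1 \<Longrightarrow> l \<le> u x \<and> u x \<le> h" using bounds by blast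
  have "norm y \<le> max h 0" if "y \<in> body u" for y
  proof (cases "y = 0")
    case False
    let ?z = "y /\<^sub>R norm y"
    have z: "norm ?z = 1" using False by (rule norm_dir)
    have "?z \<bullet> y = norm y" using False by (simp add: dot_square_norm power2_eq_square)
    moreover have "?z \<bullet> y \<le> u ?z" using that z unfolding body_iff by blast
    moreover have "u ?z \<le> h" using lh(3)[of ?z] z by (simp only: mem_sphere_0)
    ultimately show ?thesis by linarith
  qed auto
  then show ?thesis using closed_body by (auto simp: compact_eq_bounded_closed bounded_iff)
qed

lemma zero_in_body: "0 \<in> body u"
  using pos by (auto simp: body_iff less_imp_le)

text \<open>\<open>radial_contact\<close> provides the active constraint at the boundary point in
  direction \<open>x\<close>, that is, an outer normal there; the later estimates test with
  it.\<close>

lemma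
  assumes x: "x \<in> sphere 0 1"
  shows radial_pos: "radial u x > 0"
    and radial_le: "radial u x \<le> u x"
    and in_body_iff_radial: "s \<ge> 0 \<Longrightarrow> s *\<^sub>R x \<in> body u \<longleftrightarrow> s \<le> radial u x"
    and radial_contact: "\<exists>z\<in>sphere 0 1. radial u x * (z \<bullet> x) = u z"
proof -
  let ?S = "{s. s *\<^sub>R x \<in> body u}"
  obtain l h where lh: "l > 0" "h > 0" "\<And>x. x \<in> sphere 0 1 \<Longrightarrow> l \<le> u x \<and> u x \<le> h" using bounds by blast
  have xx: "x \<bullet> x = 1" using x by (simp add: norm_eq_1)
  have ub: "s \<le> u x" if "s \<in> ?S" for s using that x xx by (force simp: body_iff)
  have zx: "z \<bullet> x \<le> 1" if "norm z = 1" for z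
    using norm_cauchy_schwarz[of z x] that x by simp
  have l: "l \<in> ?S"
  proof -
    have "z \<bullet> (l *\<^sub>R x) \<le> u z" if "norm z = 1" for z
    proof -
      have "l * (z \<bullet> x) \<le> l * 1" using zx[OF that] lh(1) by (intro mult_left_mono) auto
      also have "\<dots> \<le> u z" using lh(3)[of z] that by simp
      finally show ?thesis by simp
    qed
    then show ?thesis by (simp add: body_iff)
  qed
  have bdd: "bdd_above ?S" using ub by (rule bdd_aboveI)
  have cl: "closed ?S"
  proof -
    have "?S = (\<lambda>s. s *\<^sub>R x) -` body u" by auto
    then show ?thesis by (simp, intro closed_vimage closed_body continuous_intros)
  qed
  have mem: "radial u x \<in> ?S"
    unfolding radial_def using l bdd cl by (intro closed_contains_Sup) auto
  have up: "s \<le> radial u x" if "s \<in> ?S" for s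
    unfolding radial_def using that bdd by (rule cSup_upper)
  show rp: "radial u x > 0" using up[OF l] lh by linarith
  show "radial u x \<le> u x" using ub mem by blast
  show "s *\<^sub>R x \<in> body u \<longleftrightarrow> s \<le> radial u x" if "s \<ge> 0"
  proof
    assume s: "s \<le> radial u x"
    have "z \<bullet> (s *\<^sub>R x) \<le> u z" if z: "norm z = 1" for z
    proof (cases "z \<bullet> x \<ge> 0")
      case True
      then have "s * (z \<bullet> x) \<le> radial u x * (z \<bullet> x)" using s by (intro mult_right_mono)
      then show ?thesis using mem z by (force simp: body_iff)
    next
      case False
      then have "s * (z \<bullet> x) \<le> 0" using \<open>s \<ge> 0\<close> by (simp add: mult_nonneg_nonpos)
      then show ?thesis using pos[of z] z by simp
    qed
    then show "s *\<^sub>R x \<in> body u" by (simp add: body_iff)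
  qed (use up in auto)
  \<comment> \<open>Without a contact the slack has a positive minimum over the compact sphere, and
    the radius could be enlarged by that minimum.\<close>
  show "\<exists>z\<in>sphere 0 1. radial u x * (z \<bullet> x) = u z"
  proof (rule ccontr)
    assume neg: "\<not> ?thesis"
    let ?g = "\<lambda>z. u z - radial u x * (z \<bullet> x)"
    have "continuous_on (sphere 0 1) ?g" by (intro continuous_intros cont)
    then obtain a where a: "a \<in> sphere 0 1" "\<And>z. z \<in> sphere 0 1 \<Longrightarrow> ?g a \<le> ?g z"
      using continuous_attains_inf[OF compact_sphere, of 0 1 ?g] by auto
    have "?g a \<ge> 0" using mem a(1) by (auto simp: body_iff)
    moreover have "?g a \<noteq> 0" using neg a(1) by force
    ultimately have d: "?g a > 0" by simp
    have "z \<bullet> ((radial u x + ?g a) *\<^sub>R x) \<le> u z" if z: "norm z = 1" for z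
    proof -
      have "(radial u x + ?g a) * (z \<bullet> x) \<le> radial u x * (z \<bullet> x) + ?g a"
        using mult_left_mono[OF zx[OF z], of "?g a"] d by (simp add: algebra_simps)
      then show ?thesis using a(2)[of z] z by simp
    qed
    then have "radial u x + ?g a \<in> ?S" by (simp add: body_iff)
    from up[OF this] d show False by simp
  qed
qed

lemma radial_inner_le:
  assumes "x \<in> sphere 0 1" "z \<in> sphere 0 1"
  shows "radial u x * (z \<bullet> x) \<le> u z"
  using in_body_iff_radial[OF assms(1), of "radial u x"] radial_pos[OF assms(1)] assms(2)
  by (auto simp: body_iff)

text \<open>The contact normal at \<open>x\<close> also bounds the radius at \<open>y\<close>. Its
  inner product with \<open>x\<close> is at least \<open>l / h\<close>, which turns this into a
  one-sided Lipschitz estimate; exchanging the points gives the other side.\<close>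

lemma continuous_radial: "continuous_on (sphere 0 1) (radial u)"
proof -
  obtain l h where lh: "l > 0" "h > 0" "\<And>x. x \<in> sphere 0 1 \<Longrightarrow> l \<le> u x \<and> u x \<le> h" using bounds by blast
  have rh: "radial u x \<le> h" if "x \<in> sphere 0 1" for x
    using radial_le[OF that] lh(3)[OF that] by simp
  note h = lh(2)
  have le: "radial u y - radial u x \<le> (h * h / l) * norm (x - y)"
    if x: "x \<in> sphere 0 1" and y: "y \<in> sphere 0 1" for x y
  proof -
    obtain z where z: "z \<in> sphere 0 1" "radial u x * (z \<bullet> x) = u z" using radial_contact[OF x] by blast
    have "h * (z \<bullet> x) \<ge> u z"
    proof -
      have "z \<bullet> x > 0" using z(2) pos[OF z(1)] radial_pos[OF x] by (metis zero_less_mult_pos)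
      then show ?thesis using rh[OF x] z(2) by (metis less_imp_le mult_right_mono)
    qed
    then have zx: "z \<bullet> x \<ge> l / h" using lh(3)[OF z(1)] h by (simp add: divide_simps mult.commute)
    have "(radial u y - radial u x) * (z \<bullet> x) \<le> radial u y * (z \<bullet> (x - y))"
      using radial_inner_le[OF y z(1)] z(2) by (simp add: algebra_simps inner_diff_right)
    also have "\<dots> \<le> radial u y * norm (x - y)"
      using norm_cauchy_schwarz[of z "x - y"] z(1) radial_pos[OF y] by (intro mult_left_mono) auto
    also have "\<dots> \<le> h * norm (x - y)"
      using rh[OF y] by (intro mult_right_mono) auto
    finally have *: "(radial u y - radial u x) * (z \<bullet> x) \<le> h * norm (x - y)" .
    show ?thesis
    proof (cases "radial u y - radial u x \<le> 0")
      case True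
      moreover have "(h * h / l) * norm (x - y) \<ge> 0" using h lh(1) by simp
      ultimately show ?thesis by linarith
    next
      case False
      then have "(radial u y - radial u x) * (l / h) \<le> (radial u y - radial u x) * (z \<bullet> x)"
        using zx by (intro mult_left_mono) auto
      with * have "(radial u y - radial u x) * (l / h) \<le> h * norm (x - y)" by linarith
      then show ?thesis using h lh(1) by (simp add: field_simps)
    qed
  qed
  have "(h * h / l)-lipschitz_on (sphere 0 1) (radial u)"
  proof (rule lipschitz_onI)
    fix x y :: "real^'n" assume "x \<in> sphere 0 1" "y \<in> sphere 0 1"
    from le[OF this] le[OF this(2,1)]
    show "dist (radial u x) (radial u y) \<le> h * h / l * dist x y"
      unfolding dist_real_def dist_norm by (simp only: norm_minus_commute[of y x])
  qed (use h lh(1) in auto)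
  then show ?thesis by (rule lipschitz_on_continuous_on)
qed

lemma body_volume: "real CARD('n) * measure lebesgue (body u) = sph_int (\<lambda>x. radial u x ^ CARD('n))"
proof (rule star_body_volume[symmetric])
  fix x :: "real^'n" assume x: "x \<noteq> 0"
  have "x = norm x *\<^sub>R (x /\<^sub>R norm x)" using x by simp
  then show "x \<in> body u \<longleftrightarrow> norm x \<le> radial u (x /\<^sub>R norm x)"
    using in_body_iff_radial[of "x /\<^sub>R norm x" "norm x"] x norm_dir[OF x] by (metis mem_sphere_0 norm_ge_zero)
qed (use continuous_radial radial_pos in auto)

end

text \<open>The summand 0 gives the image the affine shape that
  \<open>measure_lebesgue_affine\<close> expects.\<close>

lemma body_scale:
  assumes "c > 0"
  shows "body (\<lambda>x. c * u x) = (\<lambda>y. c *\<^sub>R y + 0) ` body u"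
proof (intro equalityI subsetI)
  fix y assume y: "y \<in> body (\<lambda>x. c * u x)"
  have "(1/c) *\<^sub>R y \<in> body u" using y assms by (auto simp: body_iff divide_simps mult.commute)
  moreover have "y = c *\<^sub>R ((1/c) *\<^sub>R y) + 0" using assms by simp
  ultimately show "y \<in> (\<lambda>y. c *\<^sub>R y + 0) ` body u" by blast
qed (use assms in \<open>auto simp: body_iff\<close>)

lemma I_fun_scale:
  fixes u :: "real^'n \<Rightarrow> real"
  assumes "c > 0"
  shows "I_fun (\<lambda>x. c * u x) = c ^ CARD('n) * I_fun u"
  unfolding I_fun_def body_scale[OF assms] measure_lebesgue_affine using assms by simp

section \<open>First variation\<close>

lemma power_lipschitz:
  fixes a b :: real
  assumes "\<bar>a\<bar> \<le> 2" "\<bar>b\<bar> \<le> 2"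
  shows "\<bar>a ^ n - b ^ n\<bar> \<le> real n * 2 ^ n * \<bar>a - b\<bar>"
proof (induction n)
  case (Suc n)
  have "a ^ Suc n - b ^ Suc n = a * (a ^ n - b ^ n) + (a - b) * b ^ n" by (simp add: algebra_simps)
  then have "\<bar>a ^ Suc n - b ^ Suc n\<bar> \<le> \<bar>a\<bar> * \<bar>a ^ n - b ^ n\<bar> + \<bar>a - b\<bar> * \<bar>b\<bar> ^ n"
    by (metis abs_mult abs_triangle_ineq power_abs)
  also have "\<dots> \<le> 2 * (real n * 2 ^ n * \<bar>a - b\<bar>) + \<bar>a - b\<bar> * 2 ^ n"
    by (intro add_mono mult_mono Suc.IH power_mono) (use assms in auto)
  also have "\<dots> \<le> real (Suc n) * 2 ^ Suc n * \<bar>a - b\<bar>"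
    by (simp add: algebra_simps)
  finally show ?case .
qed simp

text \<open>The interval contains the values of \<open>pert\<close>, which stay between 7/8 and 9/8,
  and it avoids 0, so negative exponents are harmless.\<close>

lemma powr_lipschitz:
  fixes a :: real
  obtains K where "K \<ge> 0"
    "\<And>s t. 1/2 \<le> s \<Longrightarrow> s \<le> 3/2 \<Longrightarrow> 1/2 \<le> t \<Longrightarrow> t \<le> 3/2 \<Longrightarrow> \<bar>s powr a - t powr a\<bar> \<le> K * \<bar>s - t\<bar>"
proof -
  have "compact ((\<lambda>s. a * s powr (a - 1)) ` {1/2..3/2})"
    by (intro compact_continuous_image continuous_intros) auto
  then obtain K where K: "\<And>s. s \<in> {1/2..3/2} \<Longrightarrow> norm (a * s powr (a - 1)) \<le> K"
    by (meson bounded_iff compact_imp_bounded image_eqI)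
  have "norm (s powr a - t powr a) \<le> max K 0 * norm (s - t)" if "s \<in> {1/2..3/2}" "t \<in> {1/2..3/2}" for s t
  proof (rule field_differentiable_bound[of "{1/2..3/2}" "\<lambda>s. s powr a" "\<lambda>s. a * s powr (a - 1)"])
    fix s :: real assume s: "s \<in> {1/2..3/2}"
    then show "((\<lambda>s. s powr a) has_field_derivative a * s powr (a - 1)) (at s within {1/2..3/2})"
      by (intro DERIV_subset[OF has_real_derivative_powr]) auto
    show "norm (a * s powr (a - 1)) \<le> max K 0" using K[OF s] by simp
  qed (use that in auto)
  then show ?thesis by (intro that[of "max K 0"]) auto
qed

lemma radial_one:
  assumes "x \<in> sphere 0 1"
  shows "radial (\<lambda>x. 1) x = 1"
proof -
  interpret positive_sphere_fun "\<lambda>x::real^'n. 1" by standard auto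
  obtain z where z: "z \<in> sphere 0 1" "radial (\<lambda>x. 1) x * (z \<bullet> x) = 1" using radial_contact[OF assms] by auto
  have "z \<bullet> x \<le> 1" using norm_cauchy_schwarz[of z x] z assms by simp
  then have "radial (\<lambda>x. 1) x * (z \<bullet> x) \<le> radial (\<lambda>x. 1) x * 1"
    using radial_pos[OF assms] by (intro mult_left_mono) auto
  then show ?thesis using z radial_le[OF assms] by simp
qed

lemma inner_sphere: "norm x = 1 \<Longrightarrow> norm z = 1 \<Longrightarrow> z \<bullet> x = 1 - (norm (x - z))\<^sup>2 / 2"
  for x z :: "'a::real_inner"
  unfolding power2_norm_eq_inner inner_diff_left inner_diff_right
  by (simp add: norm_eq_1 inner_commute field_simps)

locale bounded_perturbation =
  fixes \<xi> :: "real^'n \<Rightarrow> real" and M :: real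
  assumes cont_\<xi>: "continuous_on (sphere 0 1) \<xi>"
    and M1: "M \<ge> 1"
    and \<xi>_bound: "x \<in> sphere 0 1 \<Longrightarrow> \<bar>\<xi> x\<bar> \<le> M"
begin

abbreviation "pert \<epsilon> \<equiv> \<lambda>x. 1 + \<epsilon> * \<xi> x"
definition "\<rho> \<epsilon> = radial (pert \<epsilon>)"
text \<open>Below this size the perturbation moves 1 by at most 1/8. The same bound absorbs the
  second-order error in \<open>support_gap\<close>, which becomes 3/16 against a main term of
  1/2.\<close>

definition "\<delta> = 1 / (8 * M)"

lemma \<delta>_pos: "\<delta> > 0" using M1 by (simp add: \<delta>_def)

lemma pert_diff:
  assumes "\<bar>\<epsilon>\<bar> \<le> \<delta>" "x \<in> sphere 0 1" shows "\<bar>\<epsilon> * \<xi> x\<bar> \<le> 1/8"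
proof -
  have "\<bar>\<epsilon> * \<xi> x\<bar> \<le> \<delta> * M" unfolding abs_mult
    using assms \<xi>_bound[OF assms(2)] by (intro mult_mono) auto
  then show ?thesis using M1 by (simp add: \<delta>_def)
qed

lemma pert_bounds: "\<bar>\<epsilon>\<bar> \<le> \<delta> \<Longrightarrow> x \<in> sphere 0 1 \<Longrightarrow> 7/8 \<le> pert \<epsilon> x \<and> pert \<epsilon> x \<le> 9/8"
  using pert_diff[of \<epsilon> x] by (auto simp: abs_le_iff)

lemma pert_positive: "\<bar>\<epsilon>\<bar> \<le> \<delta> \<Longrightarrow> positive_sphere_fun (pert \<epsilon>)"
  using pert_bounds[of \<epsilon>] by unfold_locales (force intro: continuous_intros cont_\<xi>)+

lemma \<rho>_bounds:
  assumes e: "\<bar>\<epsilon>\<bar> \<le> \<delta>" and x: "x \<in> sphere 0 1"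
  shows "7/8 \<le> \<rho> \<epsilon> x" "\<rho> \<epsilon> x \<le> pert \<epsilon> x" "\<rho> \<epsilon> x \<le> 9/8"
proof -
  interpret positive_sphere_fun "pert \<epsilon>" by (rule pert_positive[OF e])
  show "\<rho> \<epsilon> x \<le> pert \<epsilon> x" using radial_le[OF x] by (simp add: \<rho>_def)
  then show "\<rho> \<epsilon> x \<le> 9/8" using pert_bounds[OF e x] by simp
  obtain z where z: "z \<in> sphere 0 1" "\<rho> \<epsilon> x * (z \<bullet> x) = pert \<epsilon> z" using radial_contact[OF x] by (auto simp: \<rho>_def)
  have "z \<bullet> x \<le> 1" using norm_cauchy_schwarz[of z x] z x by simp
  then have "\<rho> \<epsilon> x * (z \<bullet> x) \<le> \<rho> \<epsilon> x * 1"
    using radial_pos[OF x] by (intro mult_left_mono) (auto simp: \<rho>_def)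
  then show "7/8 \<le> \<rho> \<epsilon> x" using z pert_bounds[OF e z(1)] by simp
qed

lemma continuous_\<rho>: "\<bar>\<epsilon>\<bar> \<le> \<delta> \<Longrightarrow> continuous_on (sphere 0 1) (\<rho> \<epsilon>)"
  unfolding \<rho>_def by (intro positive_sphere_fun.continuous_radial pert_positive)

lemma \<rho>_0: "x \<in> sphere 0 1 \<Longrightarrow> \<rho> 0 x = 1"
  by (simp add: \<rho>_def radial_one)

text \<open>By the cone formula this is N times the volume of the perturbed body, the factor already
  present in \<open>I_fun\<close>.\<close>

definition "vol \<epsilon> = sph_int (\<lambda>x. \<rho> \<epsilon> x ^ CARD('n))"
definition "mass p \<epsilon> = sph_int (\<lambda>x. pert \<epsilon> x powr p)"
definition "\<omega> = sph_int (\<lambda>x::real^'n. 1)"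

lemma \<omega>_pos: "\<omega> > 0" unfolding \<omega>_def by (rule sph_int_one_pos)

lemma vol_0: "vol 0 = \<omega>"
  unfolding vol_def \<omega>_def by (rule sph_int_cong) (simp add: \<rho>_0)

lemma I_fun_pert: "\<bar>\<epsilon>\<bar> \<le> \<delta> \<Longrightarrow> I_fun (pert \<epsilon>) = - vol \<epsilon>"
  using positive_sphere_fun.body_volume[OF pert_positive, of \<epsilon>] by (simp add: I_fun_def vol_def \<rho>_def)

lemma continuous_pert_powr: "\<bar>\<epsilon>\<bar> \<le> \<delta> \<Longrightarrow> continuous_on (sphere 0 1) (\<lambda>x. pert \<epsilon> x powr p)"
  using pert_bounds[of \<epsilon>] by (intro continuous_intros cont_\<xi>) force

lemma mass_pos:
  assumes e: "\<bar>\<epsilon>\<bar> \<le> \<delta>" shows "mass p \<epsilon> > 0"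
proof -
  \<comment> \<open>The sign of \<open>p\<close> decides at which end of the interval the power is
    smaller; the minimum serves both cases.\<close>
  let ?m = "min ((7/8) powr p) ((9/8) powr p)"
  have m: "?m > 0" by simp
  have "sph_int (\<lambda>x::real^'n. ?m * 1) \<le> mass p \<epsilon>"
    unfolding mass_def
  proof (rule sph_int_mono)
    fix x :: "real^'n" assume x: "x \<in> sphere 0 1"
    show "?m * 1 \<le> pert \<epsilon> x powr p"
    proof (cases "p \<ge> 0")
      case True
      then have "(7/8) powr p \<le> pert \<epsilon> x powr p" using pert_bounds[OF e x] by (intro powr_mono2) auto
      then show ?thesis by linarith
    next
      case False
      then have "(9/8) powr p \<le> pert \<epsilon> x powr p" using pert_bounds[OF e x] by (intro powr_mono2') auto
      then show ?thesis by linarith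
    qed
  qed (intro sph_integrable_continuous continuous_intros continuous_pert_powr e)+
  then show ?thesis using m sph_int_one_pos[where 'n='n] unfolding sph_int_cmult
    by (meson less_le_trans mult_pos_pos)
qed

lemma mass_0: "mass p 0 = \<omega>"
  by (simp add: mass_def \<omega>_def)

definition "cf p \<epsilon> = (mass p \<epsilon> / \<omega>) powr (- 1 / p)"

lemma phi_eq: "\<bar>\<epsilon>\<bar> \<le> \<delta> \<Longrightarrow> phi p \<xi> \<epsilon> = (\<lambda>x. cf p \<epsilon> * pert \<epsilon> x)"
  using mass_pos[of \<epsilon> p] \<omega>_pos
  by (auto simp: phi_def cf_def \<omega>_def[symmetric] mass_def[symmetric] fun_eq_iff powr_divide powr_minus divide_simps)

lemma cf_pos: "\<bar>\<epsilon>\<bar> \<le> \<delta> \<Longrightarrow> cf p \<epsilon> > 0"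
  using mass_pos[of \<epsilon> p] \<omega>_pos by (simp add: cf_def)

text \<open>Homogeneity of degree N turns the normalisation into a power of the mass, so only
  \<open>mass\<close> and \<open>vol\<close> remain to be differentiated.\<close>

lemma I_fun_phi:
  assumes e: "\<bar>\<epsilon>\<bar> \<le> \<delta>"
  shows "I_fun (phi p \<xi> \<epsilon>) = - ((mass p \<epsilon> / \<omega>) powr (- real CARD('n) / p) * vol \<epsilon>)"
proof -
  have "cf p \<epsilon> ^ CARD('n) = (mass p \<epsilon> / \<omega>) powr (- real CARD('n) / p)"
    using cf_pos[OF e, of p] by (simp add: cf_def powr_realpow[symmetric] powr_powr)
  then show ?thesis
    unfolding phi_eq[OF e] I_fun_scale[OF cf_pos[OF e]] I_fun_pert[OF e] by simp
qed

text \<open>The weight \<open>k\<close> allows two uses: \<open>k = 1\<close> differentiates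
  \<open>mass\<close>, and \<open>k = p * \<xi>\<close> differentiates the result once more.\<close>

lemma sph_int_pert_powr_deriv:
  assumes k: "continuous_on (sphere 0 1) k" and e: "\<bar>\<epsilon>\<bar> < \<delta>"
  shows "((\<lambda>\<epsilon>. sph_int (\<lambda>x. k x * pert \<epsilon> x powr a)) has_real_derivative
    sph_int (\<lambda>x. a * (k x * \<xi> x) * pert \<epsilon> x powr (a - 1))) (at \<epsilon>)"
proof -
  obtain K where K: "K \<ge> 0" "\<And>s t. 1/2 \<le> s \<Longrightarrow> s \<le> 3/2 \<Longrightarrow> 1/2 \<le> t \<Longrightarrow> t \<le> 3/2 \<Longrightarrow> \<bar>s powr a - t powr a\<bar> \<le> K * \<bar>s - t\<bar>"
    using powr_lipschitz by blast
  obtain B where B: "B \<ge> 0" "\<And>x. x \<in> sphere 0 1 \<Longrightarrow> \<bar>k x\<bar> \<le> B"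
    using sph_continuous_bounded[OF k] by blast
  show ?thesis
  proof (rule sph_int_dominated_derivative(2)[where d="\<delta> - \<bar>\<epsilon>\<bar>" and L="B * (K * M)"])
    show "\<delta> - \<bar>\<epsilon>\<bar> > 0" using e by simp
    fix t assume t: "\<bar>t - \<epsilon>\<bar> < \<delta> - \<bar>\<epsilon>\<bar>"
    then have t\<delta>: "\<bar>t\<bar> \<le> \<delta>" by linarith
    show "sph_integrable (\<lambda>x. k x * pert t x powr a)"
      by (intro sph_integrable_continuous continuous_on_mult k continuous_pert_powr t\<delta>)
    fix x :: "real^'n" assume x: "x \<in> sphere 0 1"
    have "\<bar>k x * pert t x powr a - k x * pert \<epsilon> x powr a\<bar> = \<bar>k x\<bar> * \<bar>pert t x powr a - pert \<epsilon> x powr a\<bar>"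
      by (simp add: abs_mult flip: right_diff_distrib)
    also have "\<dots> \<le> B * (K * \<bar>pert t x - pert \<epsilon> x\<bar>)"
      using pert_bounds[OF t\<delta> x] pert_bounds[of \<epsilon> x] x e B by (intro mult_mono K) auto
    also have "\<bar>pert t x - pert \<epsilon> x\<bar> = \<bar>\<xi> x\<bar> * \<bar>t - \<epsilon>\<bar>"
      by (simp add: abs_mult[symmetric] algebra_simps)
    also have "B * (K * (\<bar>\<xi> x\<bar> * \<bar>t - \<epsilon>\<bar>)) \<le> B * (K * (M * \<bar>t - \<epsilon>\<bar>))"
      using \<xi>_bound[OF x] B K by (intro mult_left_mono mult_right_mono) auto
    finally show "\<bar>k x * pert t x powr a - k x * pert \<epsilon> x powr a\<bar> \<le> B * (K * M) * \<bar>t - \<epsilon>\<bar>"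
      by (simp add: mult.assoc)
  next
    fix x :: "real^'n" assume x: "x \<in> sphere 0 1"
    have "pert \<epsilon> x > 0" using pert_bounds[of \<epsilon> x] e x by simp
    then show "((\<lambda>\<epsilon>. k x * pert \<epsilon> x powr a) has_real_derivative a * (k x * \<xi> x) * pert \<epsilon> x powr (a - 1)) (at \<epsilon>)"
      by (auto intro!: derivative_eq_intros simp: powr_diff divide_simps)
  qed
qed

text \<open>Serves twice: at 0 for a direction that is merely Lipschitz, and at every small
  parameter once the derivative of the radius is known there.\<close>

lemma vol_dominated_deriv:
  assumes e: "\<bar>\<epsilon>\<bar> < \<delta>"
    and deriv: "\<And>x. x \<in> sphere 0 1 \<Longrightarrow> ((\<lambda>t. \<rho> t x) has_real_derivative m x) (at \<epsilon>)"
    and lip: "\<And>t x. \<bar>t\<bar> \<le> \<delta> \<Longrightarrow> x \<in> sphere 0 1 \<Longrightarrow> \<bar>\<rho> t x - \<rho> \<epsilon> x\<bar> \<le> L * \<bar>t - \<epsilon>\<bar>"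
  shows "sph_integrable (\<lambda>x. real CARD('n) * \<rho> \<epsilon> x ^ (CARD('n) - 1) * m x) \<and>
    (vol has_real_derivative sph_int (\<lambda>x. real CARD('n) * \<rho> \<epsilon> x ^ (CARD('n) - 1) * m x)) (at \<epsilon>)"
proof -
  let ?N = "CARD('n)"
  have "\<delta> - \<bar>\<epsilon>\<bar> > 0" using e by simp
  moreover have "sph_integrable (\<lambda>x. \<rho> t x ^ ?N)" if t: "\<bar>t - \<epsilon>\<bar> < \<delta> - \<bar>\<epsilon>\<bar>" for t
    using t by (intro sph_integrable_continuous continuous_intros continuous_\<rho>) linarith
  moreover have "((\<lambda>t. \<rho> t x ^ ?N) has_real_derivative real ?N * \<rho> \<epsilon> x ^ (?N - 1) * m x) (at \<epsilon>)"
    if "x \<in> sphere 0 1" for x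
    by (auto intro!: derivative_eq_intros deriv[OF that])
  moreover have "\<bar>\<rho> t x ^ ?N - \<rho> \<epsilon> x ^ ?N\<bar> \<le> (real ?N * 2 ^ ?N * L) * \<bar>t - \<epsilon>\<bar>"
    if t: "\<bar>t - \<epsilon>\<bar> < \<delta> - \<bar>\<epsilon>\<bar>" and x: "x \<in> sphere 0 1" for t x
  proof -
    have t\<delta>: "\<bar>t\<bar> \<le> \<delta>" using t by linarith
    have "\<bar>\<rho> t x ^ ?N - \<rho> \<epsilon> x ^ ?N\<bar> \<le> real ?N * 2 ^ ?N * \<bar>\<rho> t x - \<rho> \<epsilon> x\<bar>"
      using \<rho>_bounds[OF t\<delta> x] \<rho>_bounds[of \<epsilon> x] e x by (intro power_lipschitz) auto
    also have "\<dots> \<le> real ?N * 2 ^ ?N * (L * \<bar>t - \<epsilon>\<bar>)"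
      by (intro mult_left_mono lip t\<delta> x) auto
    finally show ?thesis by (simp add: mult.assoc)
  qed
  ultimately show ?thesis
    using sph_int_dominated_derivative[of "\<delta> - \<bar>\<epsilon>\<bar>" \<epsilon> "\<lambda>t x. \<rho> t x ^ ?N"
        "\<lambda>x. real ?N * \<rho> \<epsilon> x ^ (?N - 1) * m x" "real ?N * 2 ^ ?N * L"]
    unfolding vol_def[abs_def] by blast
qed

text \<open>A contact normal at distance t from \<open>x\<close> costs order t^2 in the inner
  product and gains at most \<epsilon> L t in \<open>\<xi>\<close>. The best trade leaves the radius
  within L^2 \<epsilon>^2 of \<open>pert\<close>, so its derivative at 0 is
  \<open>\<xi>\<close>.\<close>

lemma vol_deriv_0:
  assumes L: "L \<ge> 0" "\<And>x y. x \<in> sphere 0 1 \<Longrightarrow> y \<in> sphere 0 1 \<Longrightarrow> \<bar>\<xi> x - \<xi> y\<bar> \<le> L * norm (x - y)"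
  shows "(vol has_real_derivative real CARD('n) * sph_int \<xi>) (at 0)"
proof -
  have low: "pert \<epsilon> x - L\<^sup>2 * \<epsilon>\<^sup>2 \<le> \<rho> \<epsilon> x" if e: "\<bar>\<epsilon>\<bar> \<le> \<delta>" and x: "x \<in> sphere 0 1" for \<epsilon> x
  proof -
    interpret positive_sphere_fun "pert \<epsilon>" by (rule pert_positive[OF e])
    obtain z where z: "z \<in> sphere 0 1" "\<rho> \<epsilon> x * (z \<bullet> x) = pert \<epsilon> z" using radial_contact[OF x] by (auto simp: \<rho>_def)
    define t where "t = norm (x - z)"
    have zx: "z \<bullet> x = 1 - t\<^sup>2 / 2" using inner_sphere[of x z] x z by (simp add: t_def)
    have "\<bar>\<epsilon> * (\<xi> x - \<xi> z)\<bar> \<le> \<bar>\<epsilon>\<bar> * (L * t)" unfolding abs_mult t_def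
      by (intro mult_left_mono L x z) auto
    then have "pert \<epsilon> x - \<bar>\<epsilon>\<bar> * (L * t) \<le> pert \<epsilon> z" by (simp add: algebra_simps abs_le_iff)
    also have "\<dots> = \<rho> \<epsilon> x - \<rho> \<epsilon> x * (t\<^sup>2 / 2)" using z(2) unfolding zx by (simp add: algebra_simps)
    also have "\<dots> \<le> \<rho> \<epsilon> x - 7/8 * (t\<^sup>2 / 2)"
      using \<rho>_bounds(1)[OF e x] by (intro diff_left_mono mult_right_mono) auto
    finally have "pert \<epsilon> x \<le> \<rho> \<epsilon> x + \<bar>\<epsilon>\<bar> * L * t - 7/16 * t\<^sup>2" by simp
    moreover have "\<bar>\<epsilon>\<bar> * L * t - 7/16 * t\<^sup>2 \<le> (\<bar>\<epsilon>\<bar> * L)\<^sup>2"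
    proof -
      \<comment> \<open>Completing the square, with 7/16 split as 1/4 + 3/16.\<close>
      have "(\<bar>\<epsilon>\<bar> * L)\<^sup>2 - (\<bar>\<epsilon>\<bar> * L) * t + 7/16 * t\<^sup>2 = ((\<bar>\<epsilon>\<bar> * L) - t / 2)\<^sup>2 + 3/16 * t\<^sup>2"
        by (simp add: power2_eq_square algebra_simps)
      moreover have "\<dots> \<ge> 0" by simp
      ultimately show ?thesis by linarith
    qed
    ultimately show ?thesis by (simp add: power_mult_distrib mult.commute)
  qed
  have "sph_integrable (\<lambda>x. real CARD('n) * \<rho> 0 x ^ (CARD('n) - 1) * \<xi> x) \<and>
    (vol has_real_derivative sph_int (\<lambda>x. real CARD('n) * \<rho> 0 x ^ (CARD('n) - 1) * \<xi> x)) (at 0)"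
  proof (rule vol_dominated_deriv[where L="M + L\<^sup>2 * \<delta>"])
    fix x :: "real^'n" assume x: "x \<in> sphere 0 1"
    have b: "\<bar>\<rho> t x - \<rho> 0 x - t * \<xi> x\<bar> \<le> L\<^sup>2 * t\<^sup>2" if "\<bar>t\<bar> \<le> \<delta>" for t
      using low[OF that x] \<rho>_bounds(2)[OF that x] \<rho>_0[OF x] by (auto simp: abs_le_iff)
    show "((\<lambda>t. \<rho> t x) has_real_derivative \<xi> x) (at 0)"
      unfolding DERIV_def
    proof (rule LIM_zero_cancel, rule Lim_null_comparison)
      show "\<forall>\<^sub>F t in at 0. norm ((\<rho> (0 + t) x - \<rho> 0 x) / t - \<xi> x) \<le> L\<^sup>2 * \<bar>t\<bar>"
        unfolding eventually_at
      proof (intro exI[of _ \<delta>] conjI ballI impI \<delta>_pos)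
        fix t :: real assume "t \<noteq> 0 \<and> dist t 0 < \<delta>"
        then have t: "t \<noteq> 0" "\<bar>t\<bar> \<le> \<delta>" by auto
        have "(\<rho> t x - \<rho> 0 x) / t - \<xi> x = (\<rho> t x - \<rho> 0 x - t * \<xi> x) / t" using t by (simp add: diff_divide_distrib)
        then have "\<bar>(\<rho> t x - \<rho> 0 x) / t - \<xi> x\<bar> = \<bar>\<rho> t x - \<rho> 0 x - t * \<xi> x\<bar> / \<bar>t\<bar>" by simp
        also have "\<dots> \<le> L\<^sup>2 * t\<^sup>2 / \<bar>t\<bar>" by (intro divide_right_mono b t) auto
        also have "\<dots> = L\<^sup>2 * \<bar>t\<bar>" using t by (simp add: power2_eq_square abs_if)
        finally show "norm ((\<rho> (0 + t) x - \<rho> 0 x) / t - \<xi> x) \<le> L\<^sup>2 * \<bar>t\<bar>" by simp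
      qed
      show "((\<lambda>t. L\<^sup>2 * \<bar>t\<bar>) \<longlongrightarrow> 0) (at 0)" by (auto intro!: tendsto_eq_intros)
    qed
    fix t assume t: "\<bar>t\<bar> \<le> \<delta>"
    have "\<bar>\<rho> t x - \<rho> 0 x\<bar> \<le> \<bar>t * \<xi> x\<bar> + L\<^sup>2 * t\<^sup>2" using b[OF t] by linarith
    also have "\<bar>t * \<xi> x\<bar> \<le> \<bar>t\<bar> * M" unfolding abs_mult by (intro mult_left_mono \<xi>_bound x) auto
    also have "L\<^sup>2 * t\<^sup>2 \<le> L\<^sup>2 * (\<delta> * \<bar>t\<bar>)"
    proof (intro mult_left_mono)
      have "\<bar>t\<bar> * \<bar>t\<bar> \<le> \<delta> * \<bar>t\<bar>" using t by (intro mult_right_mono) auto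
      then show "t\<^sup>2 \<le> \<delta> * \<bar>t\<bar>" by (simp add: power2_eq_square)
    qed auto
    finally show "\<bar>\<rho> t x - \<rho> 0 x\<bar> \<le> (M + L\<^sup>2 * \<delta>) * \<bar>t - 0\<bar>" by (simp add: algebra_simps)
  qed (use \<delta>_pos in auto)
  moreover have "sph_int (\<lambda>x. real CARD('n) * \<rho> 0 x ^ (CARD('n) - 1) * \<xi> x) = real CARD('n) * sph_int \<xi>"
    unfolding sph_int_cmult[symmetric] by (rule sph_int_cong) (simp add: \<rho>_0)
  ultimately show ?thesis by simp
qed

lemma mass_deriv: "\<bar>\<epsilon>\<bar> < \<delta> \<Longrightarrow>
    (mass p has_real_derivative sph_int (\<lambda>x. p * \<xi> x * pert \<epsilon> x powr (p - 1))) (at \<epsilon>)"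
  using sph_int_pert_powr_deriv[of "\<lambda>x. 1" \<epsilon> p] by (simp add: mass_def[abs_def])

lemma I_fun_phi_deriv:
  assumes e: "\<bar>\<epsilon>\<bar> < \<delta>" and v: "(vol has_real_derivative v) (at \<epsilon>)" and w: "(mass p has_real_derivative w) (at \<epsilon>)"
  shows "((\<lambda>\<epsilon>. I_fun (phi p \<xi> \<epsilon>)) has_real_derivative
    (real CARD('n) / p) * (mass p \<epsilon> / \<omega>) powr (- real CARD('n) / p - 1) * (w / \<omega>) * vol \<epsilon>
      - (mass p \<epsilon> / \<omega>) powr (- real CARD('n) / p) * v) (at \<epsilon>)"
proof -
  have "mass p \<epsilon> / \<omega> > 0" using mass_pos[of \<epsilon> p] e \<omega>_pos by simp
  then have "((\<lambda>\<epsilon>. - ((mass p \<epsilon> / \<omega>) powr (- real CARD('n) / p) * vol \<epsilon>)) has_real_derivative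
    (real CARD('n) / p) * (mass p \<epsilon> / \<omega>) powr (- real CARD('n) / p - 1) * (w / \<omega>) * vol \<epsilon>
      - (mass p \<epsilon> / \<omega>) powr (- real CARD('n) / p) * v) (at \<epsilon>)"
    using \<omega>_pos by (auto intro!: derivative_eq_intros v w simp: powr_diff field_simps)
  then show ?thesis
    by (rule has_field_derivative_transform_within[where d="\<delta> - \<bar>\<epsilon>\<bar>"])
       (use e in \<open>auto simp: dist_real_def I_fun_phi\<close>)
qed

text \<open>The mass term \<open>(N / p) * (p * sph_int \<xi> / \<omega>) * \<omega>\<close> cancels
  the volume term \<open>N * sph_int \<xi>\<close>, whatever the mean of
  \<open>\<xi>\<close>.\<close>

lemma I_fun_phi_critical:
  assumes L: "L \<ge> 0" "\<And>x y. x \<in> sphere 0 1 \<Longrightarrow> y \<in> sphere 0 1 \<Longrightarrow> \<bar>\<xi> x - \<xi> y\<bar> \<le> L * norm (x - y)"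
    and p: "p \<noteq> 0"
  shows "((\<lambda>\<epsilon>. I_fun (phi p \<xi> \<epsilon>)) has_real_derivative 0) (at 0)"
proof -
  have w: "(mass p has_real_derivative p * sph_int \<xi>) (at 0)"
    using mass_deriv[of 0 p] \<delta>_pos by (simp add: sph_int_cmult)
  show ?thesis
    using I_fun_phi_deriv[OF _ vol_deriv_0[OF L] w] \<delta>_pos p \<omega>_pos by (simp add: mass_0 vol_0)
qed

end

section \<open>Second variation\<close>

text \<open>\<open>G\<close> stands for the tangential gradient. Its size, its tangency and a
  quadratic Taylor remainder along chords are the regularity used; a single constant
  \<open>M\<close> lets one \<open>\<delta>\<close> serve all estimates.\<close>

locale smooth_perturbation = bounded_perturbation \<xi> M
  for \<xi> :: "real^'n \<Rightarrow> real" and M :: real +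
  fixes G :: "real^'n \<Rightarrow> real^'n"
  assumes cont_G: "continuous_on (sphere 0 1) G"
    and G_bound: "x \<in> sphere 0 1 \<Longrightarrow> norm (G x) \<le> M"
    and G_tangent: "x \<in> sphere 0 1 \<Longrightarrow> G x \<bullet> x = 0"
    and G_taylor: "x \<in> sphere 0 1 \<Longrightarrow> z \<in> sphere 0 1 \<Longrightarrow>
      \<bar>\<xi> x - \<xi> z - G z \<bullet> (x - z)\<bar> \<le> M * (norm (x - z))\<^sup>2"
begin

text \<open>The gradient of the 1-homogeneous extension of the perturbed support function.\<close>

definition "bdpt \<epsilon> z = pert \<epsilon> z *\<^sub>R z + \<epsilon> *\<^sub>R G z"

lemma bdpt_inner: "z \<in> sphere 0 1 \<Longrightarrow> z \<bullet> bdpt \<epsilon> z = pert \<epsilon> z"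
  using G_tangent[of z] by (simp add: bdpt_def inner_add_right norm_eq_1 inner_commute)

text \<open>The lower bound puts \<open>bdpt \<epsilon> z\<close> into the Wulff shape and separates
  contact normals quantitatively. The upper bound measures the cost of tilting a test direction away
  from the contact normal.\<close>

lemma support_gap:
  assumes e: "\<bar>\<epsilon>\<bar> \<le> \<delta>" and x: "x \<in> sphere 0 1" and z: "z \<in> sphere 0 1"
  shows "(norm (x - z))\<^sup>2 / 4 \<le> pert \<epsilon> x - x \<bullet> bdpt \<epsilon> z"
    and "pert \<epsilon> x - x \<bullet> bdpt \<epsilon> z \<le> (norm (x - z))\<^sup>2"
proof -
  define t where "t = (norm (x - z))\<^sup>2"
  have t: "t \<ge> 0" by (simp add: t_def)
  have xz: "x \<bullet> z = 1 - t / 2"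
    using inner_sphere[of z x] x z by (simp add: t_def norm_minus_commute)
  \<comment> \<open>The gap is \<open>t / 2 + \<epsilon> * B\<close>: the first term is the exact
    gap of the unit ball, and \<open>B\<close> collects the Taylor remainder and the effect of
    \<open>x \<bullet> z\<close> falling below 1.\<close>
  define B where "B = \<xi> x - \<xi> z - G z \<bullet> (x - z) + \<xi> z * (t / 2)"
  have "\<bar>B\<bar> \<le> \<bar>\<xi> x - \<xi> z - G z \<bullet> (x - z)\<bar> + \<bar>\<xi> z * (t / 2)\<bar>"
    unfolding B_def by (rule abs_triangle_ineq)
  also have "\<dots> \<le> M * t + M * (t / 2)"
    using G_taylor[OF x z] \<xi>_bound[OF z] t by (intro add_mono) (auto simp: t_def abs_mult intro!: mult_right_mono)
  finally have B: "\<bar>B\<bar> \<le> 3/2 * M * t" by simp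
  have "\<bar>\<epsilon> * B\<bar> \<le> \<delta> * (3/2 * M * t)"
    unfolding abs_mult by (intro mult_mono B e) (use \<delta>_pos in auto)
  also have "\<dots> = 3/16 * t" using M1 by (simp add: \<delta>_def)
  finally have eB: "\<bar>\<epsilon> * B\<bar> \<le> 3/16 * t" .
  have "G z \<bullet> x = G z \<bullet> (x - z)" using G_tangent[OF z] by (simp add: inner_diff_right)
  then have "x \<bullet> bdpt \<epsilon> z = pert \<epsilon> z * (1 - t / 2) + \<epsilon> * (G z \<bullet> (x - z))"
    unfolding bdpt_def inner_add_right by (simp add: xz inner_commute)
  then have "pert \<epsilon> x - x \<bullet> bdpt \<epsilon> z = t / 2 + \<epsilon> * B"
    unfolding B_def by (simp add: algebra_simps)
  with eB t show "(norm (x - z))\<^sup>2 / 4 \<le> pert \<epsilon> x - x \<bullet> bdpt \<epsilon> z"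
    "pert \<epsilon> x - x \<bullet> bdpt \<epsilon> z \<le> (norm (x - z))\<^sup>2"
    unfolding t_def[symmetric] by (auto simp: abs_le_iff)
qed

text \<open>A minimiser is merely selected; \<open>contact_hoelder\<close> shows that the selection
  is continuous in \<open>\<epsilon>\<close>.\<close>

definition "contact \<epsilon> x = (SOME z. z \<in> sphere 0 1 \<and> \<rho> \<epsilon> x * (z \<bullet> x) = pert \<epsilon> z)"

lemma
  assumes e: "\<bar>\<epsilon>\<bar> \<le> \<delta>" and x: "x \<in> sphere 0 1"
  shows contact_sphere: "contact \<epsilon> x \<in> sphere 0 1"
    and contact_eq: "\<rho> \<epsilon> x * (contact \<epsilon> x \<bullet> x) = pert \<epsilon> (contact \<epsilon> x)"
proof -
  interpret positive_sphere_fun "pert \<epsilon>" by (rule pert_positive[OF e])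
  have "\<exists>z. z \<in> sphere 0 1 \<and> \<rho> \<epsilon> x * (z \<bullet> x) = pert \<epsilon> z"
    using radial_contact[OF x] by (auto simp: \<rho>_def)
  from someI_ex[OF this] show "contact \<epsilon> x \<in> sphere 0 1"
    "\<rho> \<epsilon> x * (contact \<epsilon> x \<bullet> x) = pert \<epsilon> (contact \<epsilon> x)"
    unfolding contact_def by auto
qed

lemma \<rho>_inner_le:
  assumes "\<bar>\<epsilon>\<bar> \<le> \<delta>" "x \<in> sphere 0 1" "z \<in> sphere 0 1"
  shows "\<rho> \<epsilon> x * (z \<bullet> x) \<le> pert \<epsilon> z"
  unfolding \<rho>_def by (intro positive_sphere_fun.radial_inner_le pert_positive assms)

text \<open>7/9 is the lower bound 7/8 for \<open>pert\<close> divided by the upper bound 9/8 for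
  the radius.\<close>

lemma contact_inner:
  assumes e: "\<bar>\<epsilon>\<bar> \<le> \<delta>" and x: "x \<in> sphere 0 1"
  shows "7/9 \<le> contact \<epsilon> x \<bullet> x" "contact \<epsilon> x \<bullet> x \<le> 1"
proof -
  let ?z = "contact \<epsilon> x"
  note z = contact_sphere[OF e x]
  have *: "7/8 \<le> \<rho> \<epsilon> x * (?z \<bullet> x)" using contact_eq[OF e x] pert_bounds[OF e z] by simp
  have "0 < \<rho> \<epsilon> x * (?z \<bullet> x)" "0 < \<rho> \<epsilon> x" using * \<rho>_bounds(1)[OF e x] by linarith+
  then have "?z \<bullet> x \<ge> 0" using zero_less_mult_pos[of "\<rho> \<epsilon> x" "?z \<bullet> x"] by (intro less_imp_le)
  then have "\<rho> \<epsilon> x * (?z \<bullet> x) \<le> 9/8 * (?z \<bullet> x)"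
    using \<rho>_bounds(3)[OF e x] by (intro mult_right_mono)
  with * show "7/9 \<le> ?z \<bullet> x" by linarith
  show "?z \<bullet> x \<le> 1" using norm_cauchy_schwarz[of ?z x] z x by simp
qed

text \<open>First-order optimality at the contact normal, tested in the direction \<open>z - t / 2\<close>.\<close>

lemma contact_bdpt:
  assumes e: "\<bar>\<epsilon>\<bar> \<le> \<delta>" and x: "x \<in> sphere 0 1"
  shows "\<rho> \<epsilon> x *\<^sub>R x = bdpt \<epsilon> (contact \<epsilon> x)"
proof -
  let ?z = "contact \<epsilon> x"
  note z = contact_sphere[OF e x]
  \<comment> \<open>Both points have height \<open>pert \<epsilon> ?z\<close> in the direction
    \<open>?z\<close>, so their difference is tangential. The goal is to show that it
    vanishes.\<close>
  define t where "t = bdpt \<epsilon> ?z - \<rho> \<epsilon> x *\<^sub>R x"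
  have zt: "?z \<bullet> t = 0"
    unfolding t_def using bdpt_inner[OF z, of \<epsilon>] contact_eq[OF e x] by (simp add: inner_diff_right)
  have zz: "?z \<bullet> ?z = 1" using z by (simp add: norm_eq_1)
  define v where "v = ?z - (1/2) *\<^sub>R t"
  have vz: "v \<bullet> ?z = 1" using zt zz inner_commute[of t ?z] by (simp add: v_def inner_diff_left)
  have vt: "v \<bullet> t = - (norm t)\<^sup>2 / 2" using zt by (simp add: v_def inner_diff_left dot_square_norm)
  have vv: "(norm v)\<^sup>2 = 1 + (norm t)\<^sup>2 / 4"
  proof -
    have "v \<bullet> v = v \<bullet> ?z - (1/2) * (v \<bullet> t)" by (subst (2) v_def) (simp add: inner_diff_right)
    then show ?thesis using vz vt by (simp add: dot_square_norm)
  qed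
  have v0: "norm v > 0" using vv by (metis add_pos_nonneg divide_nonneg_pos zero_le_power2 zero_less_norm_iff zero_less_numeral zero_less_one norm_zero zero_power2 less_irrefl)
  define a where "a = v /\<^sub>R norm v"
  have a: "a \<in> sphere 0 1" using v0 by (simp add: a_def)
  have az: "(norm (a - ?z))\<^sup>2 = 2 - 2 * (a \<bullet> ?z)"
    using inner_sphere[of ?z a] a z by (simp add: norm_minus_commute)
  have "a \<bullet> (\<rho> \<epsilon> x *\<^sub>R x) \<le> pert \<epsilon> a" using \<rho>_inner_le[OF e x a] by simp
  then have "- (a \<bullet> t) \<le> (norm (a - ?z))\<^sup>2"
    using support_gap(2)[OF e a z] by (simp add: t_def inner_diff_right)
  then have "norm v * - (a \<bullet> t) \<le> norm v * (2 - 2 * (a \<bullet> ?z))"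
    unfolding az by (intro mult_left_mono) auto
  moreover have "- (v \<bullet> t) \<le> 2 * norm v - 2 * (v \<bullet> ?z)"
    if "norm v * - (a \<bullet> t) \<le> norm v * (2 - 2 * (a \<bullet> ?z))"
  proof -
    have "v = norm v *\<^sub>R a" using v0 by (simp add: a_def)
    then have "v \<bullet> t = norm v * (a \<bullet> t)" "v \<bullet> ?z = norm v * (a \<bullet> ?z)"
      by (metis inner_scaleR_left)+
    with that show ?thesis by (simp add: algebra_simps)
  qed
  ultimately have 1: "(norm t)\<^sup>2 / 2 \<le> 2 * norm v - 2" using vt vz by simp
  \<comment> \<open>This bounds \<open>2 * norm v - 2\<close> by
    \<open>(norm t)\<^sup>2 / 4\<close>, against the lower bound
    \<open>(norm t)\<^sup>2 / 2\<close>. A step s in place of 1/2 would compare s with s^2, so any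
    step strictly between 0 and 1 forces \<open>t = 0\<close>.\<close>
  have "(norm v - 1)\<^sup>2 \<ge> 0" by simp
  then have "2 * norm v \<le> 1 + (norm v)\<^sup>2" by (simp add: power2_eq_square algebra_simps)
  with 1 vv have "(norm t)\<^sup>2 \<le> 0" by linarith
  then show ?thesis by (simp add: t_def)
qed

section \<open>Derivative of the radius in the parameter\<close>

definition "dens \<epsilon> x = \<xi> (contact \<epsilon> x) / (contact \<epsilon> x \<bullet> x)"

lemma dens_bound:
  assumes e: "\<bar>\<epsilon>\<bar> \<le> \<delta>" and x: "x \<in> sphere 0 1"
  shows "\<bar>dens \<epsilon> x\<bar> \<le> 2 * M"
proof -
  have "\<bar>\<xi> (contact \<epsilon> x)\<bar> \<le> M * 1" using \<xi>_bound[OF contact_sphere[OF e x]] by simp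
  also have "\<dots> \<le> M * (2 * (contact \<epsilon> x \<bullet> x))" using contact_inner[OF e x] M1 by (intro mult_left_mono) auto
  finally show ?thesis using contact_inner[OF e x] by (simp add: dens_def divide_simps)
qed

text \<open>The contact normal at \<open>\<epsilon>\<close> remains an admissible test at
  \<open>t\<close>, where its constraint is affine in \<open>t\<close>: a supporting line from above
  for a concave function.\<close>

lemma \<rho>_secant:
  assumes e: "\<bar>\<epsilon>\<bar> \<le> \<delta>" and t: "\<bar>t\<bar> \<le> \<delta>" and x: "x \<in> sphere 0 1"
  shows "\<rho> t x \<le> \<rho> \<epsilon> x + (t - \<epsilon>) * dens \<epsilon> x"
proof -
  let ?z = "contact \<epsilon> x"
  have zx: "?z \<bullet> x > 0" using contact_inner[OF e x] by simp
  have "\<rho> t x * (?z \<bullet> x) \<le> pert \<epsilon> ?z + (t - \<epsilon>) * \<xi> ?z"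
    using \<rho>_inner_le[OF t x contact_sphere[OF e x]] by (simp add: algebra_simps)
  also have "\<dots> = (\<rho> \<epsilon> x + (t - \<epsilon>) * dens \<epsilon> x) * (?z \<bullet> x)"
    using zx contact_eq[OF e x] by (simp add: dens_def field_simps)
  finally show ?thesis using zx by simp
qed

lemma \<rho>_lipschitz:
  assumes e: "\<bar>\<epsilon>\<bar> \<le> \<delta>" and t: "\<bar>t\<bar> \<le> \<delta>" and x: "x \<in> sphere 0 1"
  shows "\<bar>\<rho> t x - \<rho> \<epsilon> x\<bar> \<le> 2 * M * \<bar>t - \<epsilon>\<bar>"
proof -
  have "\<bar>(t - \<epsilon>) * dens s x\<bar> \<le> \<bar>t - \<epsilon>\<bar> * (2 * M)" if "\<bar>s\<bar> \<le> \<delta>" for s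
    unfolding abs_mult by (intro mult_left_mono dens_bound that x) auto
  from this[OF e] this[OF t] \<rho>_secant[OF e t x] \<rho>_secant[OF t e x]
  show ?thesis by (simp add: algebra_simps abs_le_iff)
qed

text \<open>The quadratic gap at \<open>\<epsilon>\<close>, evaluated at the contact normal for
  \<open>t\<close>, is of order \<open>\<bar>t - \<epsilon>\<bar>\<close> because the constraint is
  active at \<open>t\<close>. The constant is 4 * (M + 2 * M).\<close>

lemma contact_hoelder:
  assumes e: "\<bar>\<epsilon>\<bar> \<le> \<delta>" and t: "\<bar>t\<bar> \<le> \<delta>" and x: "x \<in> sphere 0 1"
  shows "(norm (contact t x - contact \<epsilon> x))\<^sup>2 \<le> 12 * M * \<bar>t - \<epsilon>\<bar>"
proof -
  let ?z = "contact \<epsilon> x" and ?y = "contact t x"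
  have "(norm (?y - ?z))\<^sup>2 / 4 \<le> pert \<epsilon> ?y - ?y \<bullet> (\<rho> \<epsilon> x *\<^sub>R x)"
    unfolding contact_bdpt[OF e x] by (intro support_gap e contact_sphere t x)
  also have "\<dots> = (\<epsilon> - t) * \<xi> ?y + (\<rho> t x - \<rho> \<epsilon> x) * (?y \<bullet> x)"
    using contact_eq[OF t x] by (simp add: algebra_simps)
  also have "\<dots> \<le> \<bar>t - \<epsilon>\<bar> * M + (2 * M * \<bar>t - \<epsilon>\<bar>) * 1"
  proof (intro add_mono)
    have "(\<epsilon> - t) * \<xi> ?y \<le> \<bar>\<epsilon> - t\<bar> * \<bar>\<xi> ?y\<bar>" by (metis abs_ge_self abs_mult)
    also have "\<dots> \<le> \<bar>t - \<epsilon>\<bar> * M"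
      using \<xi>_bound[OF contact_sphere[OF t x]] by (intro mult_mono) auto
    finally show "(\<epsilon> - t) * \<xi> ?y \<le> \<bar>t - \<epsilon>\<bar> * M" .
    have "(\<rho> t x - \<rho> \<epsilon> x) * (?y \<bullet> x) \<le> \<bar>\<rho> t x - \<rho> \<epsilon> x\<bar> * (?y \<bullet> x)"
      using contact_inner[OF t x] by (intro mult_right_mono) auto
    also have "\<dots> \<le> (2 * M * \<bar>t - \<epsilon>\<bar>) * 1"
      using contact_inner[OF t x] M1 by (intro mult_mono \<rho>_lipschitz e t x) auto
    finally show "(\<rho> t x - \<rho> \<epsilon> x) * (?y \<bullet> x) \<le> (2 * M * \<bar>t - \<epsilon>\<bar>) * 1" .
  qed
  finally show ?thesis by (simp add: algebra_simps)
qed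

lemma eventually_\<delta>: "\<bar>\<epsilon>\<bar> < \<delta> \<Longrightarrow> \<forall>\<^sub>F t in at \<epsilon>. \<bar>t\<bar> \<le> \<delta>"
  unfolding eventually_at by (rule exI[of _ "\<delta> - \<bar>\<epsilon>\<bar>"]) (auto simp: dist_real_def)

lemma contact_tendsto:
  assumes e: "\<bar>\<epsilon>\<bar> < \<delta>" and x: "x \<in> sphere 0 1"
  shows "((\<lambda>t. contact t x) \<longlongrightarrow> contact \<epsilon> x) (at \<epsilon>)"
proof (rule LIM_zero_cancel, rule Lim_null_comparison)
  show "\<forall>\<^sub>F t in at \<epsilon>. norm (contact t x - contact \<epsilon> x) \<le> sqrt (12 * M * \<bar>t - \<epsilon>\<bar>)"
    using eventually_\<delta>[OF e]
    by eventually_elim (use e contact_hoelder[OF _ _ x] in \<open>auto intro!: real_le_rsqrt\<close>)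
  show "((\<lambda>t. sqrt (12 * M * \<bar>t - \<epsilon>\<bar>)) \<longlongrightarrow> 0) (at \<epsilon>)"
    by (auto intro!: tendsto_eq_intros)
qed

lemma tendsto_along_contact:
  fixes F :: "real^'n \<Rightarrow> 'b::topological_space"
  assumes e: "\<bar>\<epsilon>\<bar> < \<delta>" and x: "x \<in> sphere 0 1" and F: "continuous_on (sphere 0 1) F"
  shows "((\<lambda>t. F (contact t x)) \<longlongrightarrow> F (contact \<epsilon> x)) (at \<epsilon>)"
proof (rule continuous_on_tendsto_compose[OF F contact_tendsto[OF e x]])
  show "\<forall>\<^sub>F t in at \<epsilon>. contact t x \<in> sphere 0 1"
    using eventually_\<delta>[OF e] by eventually_elim (rule contact_sphere[OF _ x])
qed (use contact_sphere[OF _ x] e in auto)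

lemma dens_tendsto:
  assumes e: "\<bar>\<epsilon>\<bar> < \<delta>" and x: "x \<in> sphere 0 1"
  shows "((\<lambda>t. dens t x) \<longlongrightarrow> dens \<epsilon> x) (at \<epsilon>)"
  unfolding dens_def
  using contact_inner[OF _ x, of \<epsilon>] e
  by (intro tendsto_intros tendsto_along_contact contact_tendsto cont_\<xi> e x) auto

text \<open>Danskin's theorem: the secant bound at both end points pinches the difference quotient.\<close>

lemma \<rho>_deriv:
  assumes e: "\<bar>\<epsilon>\<bar> < \<delta>" and x: "x \<in> sphere 0 1"
  shows "((\<lambda>t. \<rho> t x) has_real_derivative dens \<epsilon> x) (at \<epsilon>)"
  unfolding has_field_derivative_iff
proof (rule LIM_zero_cancel, rule Lim_null_comparison)
  have "\<forall>\<^sub>F t in at \<epsilon>. t \<noteq> \<epsilon>" by (simp add: eventually_at_filter)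
  with eventually_\<delta>[OF e]
  show "\<forall>\<^sub>F t in at \<epsilon>. norm ((\<rho> t x - \<rho> \<epsilon> x) / (t - \<epsilon>) - dens \<epsilon> x) \<le> \<bar>dens t x - dens \<epsilon> x\<bar>"
  proof eventually_elim
    case (elim t)
    have e': "\<bar>\<epsilon>\<bar> \<le> \<delta>" using e by simp
    have *: "\<rho> t x - \<rho> \<epsilon> x \<le> (t - \<epsilon>) * dens \<epsilon> x" "(t - \<epsilon>) * dens t x \<le> \<rho> t x - \<rho> \<epsilon> x"
      using \<rho>_secant[OF e' elim(1) x] \<rho>_secant[OF elim(1) e' x] by (auto simp: algebra_simps)
    show ?case
    proof (cases "t > \<epsilon>")
      case True
      then have "(\<rho> t x - \<rho> \<epsilon> x) / (t - \<epsilon>) \<le> dens \<epsilon> x" "dens t x \<le> (\<rho> t x - \<rho> \<epsilon> x) / (t - \<epsilon>)"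
        using * by (auto simp: divide_simps mult.commute)
      then show ?thesis by simp
    next
      case False
      then have "t - \<epsilon> < 0" using elim(2) by simp
      then have "dens \<epsilon> x \<le> (\<rho> t x - \<rho> \<epsilon> x) / (t - \<epsilon>)" "(\<rho> t x - \<rho> \<epsilon> x) / (t - \<epsilon>) \<le> dens t x"
        using * by (auto simp: neg_le_divide_eq neg_divide_le_eq mult.commute)
      then show ?thesis by simp
    qed
  qed
  show "((\<lambda>t. \<bar>dens t x - dens \<epsilon> x\<bar>) \<longlongrightarrow> 0) (at \<epsilon>)"
    using tendsto_rabs[OF LIM_zero[OF dens_tendsto[OF e x]]] by simp
qed

definition "vol' \<epsilon> = sph_int (\<lambda>x. real CARD('n) * \<rho> \<epsilon> x ^ (CARD('n) - 1) * dens \<epsilon> x)"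

text \<open>\<open>contact\<close> is a bare choice, so nothing is known directly about how
  \<open>dens\<close> depends on \<open>x\<close>. Its integrability is inherited from the
  continuous radii through their difference quotients.\<close>

lemma
  assumes e: "\<bar>\<epsilon>\<bar> < \<delta>"
  shows vol'_integrable: "sph_integrable (\<lambda>x. real CARD('n) * \<rho> \<epsilon> x ^ (CARD('n) - 1) * dens \<epsilon> x)"
    and vol_deriv: "(vol has_real_derivative vol' \<epsilon>) (at \<epsilon>)"
proof -
  have e': "\<bar>\<epsilon>\<bar> \<le> \<delta>" using e by simp
  from vol_dominated_deriv[OF e \<rho>_deriv[OF e] \<rho>_lipschitz[OF e']]
  show "sph_integrable (\<lambda>x. real CARD('n) * \<rho> \<epsilon> x ^ (CARD('n) - 1) * dens \<epsilon> x)"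
    "(vol has_real_derivative vol' \<epsilon>) (at \<epsilon>)"
    unfolding vol'_def by auto
qed

lemma contact_0:
  assumes x: "x \<in> sphere 0 1" shows "contact 0 x = x"
proof -
  have 0: "\<bar>0::real\<bar> \<le> \<delta>" using \<delta>_pos by simp
  have "contact 0 x \<bullet> x = 1" using contact_eq[OF 0 x] \<rho>_0[OF x] by simp
  then show ?thesis using inner_sphere[of x "contact 0 x"] x contact_sphere[OF 0 x] by simp
qed

lemma dens_0: "x \<in> sphere 0 1 \<Longrightarrow> dens 0 x = \<xi> x"
  by (simp add: dens_def contact_0 norm_eq_1)

text \<open>Around 0 the formula for the boundary point improves the square-root rate of
  \<open>contact_hoelder\<close> to a linear one, so squared distances are O(\<epsilon>^2) and pass
  into the remainder of \<open>dens_expansion\<close>.\<close>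

lemma contact_near:
  assumes e: "\<bar>\<epsilon>\<bar> \<le> \<delta>" and x: "x \<in> sphere 0 1"
  shows "norm (x - contact \<epsilon> x) \<le> 4 * M * \<bar>\<epsilon>\<bar>"
proof -
  let ?z = "contact \<epsilon> x"
  note z = contact_sphere[OF e x]
  have "x - ?z = (1 - \<rho> \<epsilon> x) *\<^sub>R x + \<epsilon> *\<^sub>R (\<xi> ?z *\<^sub>R ?z + G ?z)"
    using contact_bdpt[OF e x] by (simp add: bdpt_def algebra_simps)
  then have "norm (x - ?z) \<le> norm ((1 - \<rho> \<epsilon> x) *\<^sub>R x) + norm (\<epsilon> *\<^sub>R (\<xi> ?z *\<^sub>R ?z + G ?z))"
    using norm_triangle_ineq by metis
  also have "\<dots> \<le> 2 * M * \<bar>\<epsilon>\<bar> + \<bar>\<epsilon>\<bar> * (M + M)"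
  proof (intro add_mono)
    show "norm ((1 - \<rho> \<epsilon> x) *\<^sub>R x) \<le> 2 * M * \<bar>\<epsilon>\<bar>"
      using \<rho>_lipschitz[OF _ e x, of 0] \<delta>_pos x \<rho>_0[OF x] by (simp add: abs_minus_commute)
    have "norm (\<xi> ?z *\<^sub>R ?z + G ?z) \<le> norm (\<xi> ?z *\<^sub>R ?z) + norm (G ?z)" by (rule norm_triangle_ineq)
    also have "\<dots> \<le> M + M" using \<xi>_bound[OF z] G_bound[OF z] z by simp
    finally show "norm (\<epsilon> *\<^sub>R (\<xi> ?z *\<^sub>R ?z + G ?z)) \<le> \<bar>\<epsilon>\<bar> * (M + M)"
      unfolding norm_scaleR real_norm_def by (intro mult_left_mono) auto
  qed
  finally show ?thesis by (simp add: algebra_simps)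
qed

text \<open>Taylor expansion at the contact normal, whose linear term is evaluated exactly through
  \<open>contact_bdpt\<close>. Keeping \<open>G\<close> at the contact normal and the divisor
  \<open>\<rho>\<close> leaves a remainder of order \<epsilon>^2; the constant is
  \<open>2 * M * (4 * M * \<epsilon>) ^ 2\<close>.\<close>

lemma dens_expansion:
  assumes e: "\<bar>\<epsilon>\<bar> \<le> \<delta>" and x: "x \<in> sphere 0 1"
  shows "\<bar>dens \<epsilon> x - \<xi> x + \<epsilon> * ((norm (G (contact \<epsilon> x)))\<^sup>2 / \<rho> \<epsilon> x)\<bar> \<le> 32 * M ^ 3 * \<epsilon>\<^sup>2"
proof -
  let ?z = "contact \<epsilon> x"
  note z = contact_sphere[OF e x]
  have r: "\<rho> \<epsilon> x > 0" using \<rho>_bounds(1)[OF e x] by simp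
  have "(norm (x - ?z))\<^sup>2 \<le> (4 * M * \<bar>\<epsilon>\<bar>)\<^sup>2"
    using contact_near[OF e x] by (intro power_mono) auto
  then have n2: "(norm (x - ?z))\<^sup>2 \<le> 16 * M\<^sup>2 * \<epsilon>\<^sup>2" by (simp add: power_mult_distrib)
  \<comment> \<open>Tangency kills the component of \<open>bdpt\<close> along \<open>?z\<close>, so
    only \<open>\<epsilon> *\<^sub>R G ?z\<close> contributes.\<close>
  have "G ?z \<bullet> (\<rho> \<epsilon> x *\<^sub>R x) = \<epsilon> * (norm (G ?z))\<^sup>2"
    unfolding contact_bdpt[OF e x] bdpt_def using G_tangent[OF z]
    by (simp add: inner_add_right dot_square_norm)
  then have "G ?z \<bullet> (x - ?z) = \<epsilon> * ((norm (G ?z))\<^sup>2 / \<rho> \<epsilon> x)"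
    using r G_tangent[OF z] by (simp add: inner_diff_right field_simps)
  moreover have "dens \<epsilon> x - \<xi> ?z = dens \<epsilon> x * ((norm (x - ?z))\<^sup>2 / 2)"
  proof -
    have "dens \<epsilon> x * (?z \<bullet> x) = \<xi> ?z" using contact_inner(1)[OF e x] by (simp add: dens_def)
    moreover have "?z \<bullet> x = 1 - (norm (x - ?z))\<^sup>2 / 2" using inner_sphere[of x ?z] x z by simp
    ultimately show ?thesis by (simp add: right_diff_distrib)
  qed
  ultimately have "dens \<epsilon> x - \<xi> x + \<epsilon> * ((norm (G ?z))\<^sup>2 / \<rho> \<epsilon> x)
      = dens \<epsilon> x * ((norm (x - ?z))\<^sup>2 / 2) - (\<xi> x - \<xi> ?z - G ?z \<bullet> (x - ?z))" by simp
  also have "\<bar>\<dots>\<bar> \<le> \<bar>dens \<epsilon> x * ((norm (x - ?z))\<^sup>2 / 2)\<bar> + \<bar>\<xi> x - \<xi> ?z - G ?z \<bullet> (x - ?z)\<bar>"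
    by (rule abs_triangle_ineq4)
  also have "\<dots> \<le> 2 * M * ((norm (x - ?z))\<^sup>2 / 2) + M * (norm (x - ?z))\<^sup>2"
  proof (intro add_mono G_taylor x z)
    show "\<bar>dens \<epsilon> x * ((norm (x - ?z))\<^sup>2 / 2)\<bar> \<le> 2 * M * ((norm (x - ?z))\<^sup>2 / 2)"
      unfolding abs_mult abs_of_nonneg[OF divide_nonneg_pos[OF zero_le_power2 zero_less_numeral]]
      by (intro mult_right_mono dens_bound e x) auto
  qed
  also have "\<dots> = 2 * M * (norm (x - ?z))\<^sup>2" by simp
  also have "\<dots> \<le> 2 * M * (16 * M\<^sup>2 * \<epsilon>\<^sup>2)" using n2 M1 by (intro mult_left_mono) auto
  finally show ?thesis by (simp add: power3_eq_cube power2_eq_square mult.assoc)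
qed

text \<open>Domination for the second differentiation. 6 is 2 + 4: the factor 8/7 of the gradient
  term is rounded up to 2, and \<open>32 * M ^ 3 * \<delta>\<close> equals
  \<open>4 * M ^ 2\<close>.\<close>

lemma dens_lipschitz_0:
  assumes e: "\<bar>\<epsilon>\<bar> \<le> \<delta>" and x: "x \<in> sphere 0 1"
  shows "\<bar>dens \<epsilon> x - \<xi> x\<bar> \<le> 6 * M\<^sup>2 * \<bar>\<epsilon>\<bar>"
proof -
  let ?z = "contact \<epsilon> x"
  note z = contact_sphere[OF e x]
  have "(norm (G ?z))\<^sup>2 / \<rho> \<epsilon> x \<le> M\<^sup>2 / (7/8)"
    using G_bound[OF z] \<rho>_bounds(1)[OF e x] M1 by (intro frac_le power_mono) auto
  moreover have "(norm (G ?z))\<^sup>2 / \<rho> \<epsilon> x \<ge> 0" using \<rho>_bounds(1)[OF e x] by simp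
  moreover have "M\<^sup>2 / (7/8) \<le> 2 * M\<^sup>2" by simp
  ultimately have "\<bar>(norm (G ?z))\<^sup>2 / \<rho> \<epsilon> x\<bar> \<le> 2 * M\<^sup>2"
    by (metis abs_of_nonneg order_trans)
  then have "\<bar>\<epsilon> * ((norm (G ?z))\<^sup>2 / \<rho> \<epsilon> x)\<bar> \<le> \<bar>\<epsilon>\<bar> * (2 * M\<^sup>2)"
    unfolding abs_mult[of \<epsilon>] by (intro mult_left_mono) auto
  moreover have "32 * M ^ 3 * \<epsilon>\<^sup>2 \<le> 4 * M\<^sup>2 * \<bar>\<epsilon>\<bar>"
  proof -
    have "32 * M ^ 3 * \<epsilon>\<^sup>2 = (32 * M ^ 3 * \<bar>\<epsilon>\<bar>) * \<bar>\<epsilon>\<bar>" by (simp add: power2_eq_square)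
    also have "\<dots> \<le> (32 * M ^ 3 * \<delta>) * \<bar>\<epsilon>\<bar>" using e M1 by (intro mult_left_mono mult_right_mono) auto
    also have "32 * M ^ 3 * \<delta> = 4 * M\<^sup>2" using M1 by (simp add: \<delta>_def power3_eq_cube power2_eq_square)
    finally show ?thesis .
  qed
  moreover have "\<bar>d\<bar> \<le> 6 * m * a" if "\<bar>k\<bar> \<le> a * (2 * m)" "c \<le> 4 * m * a" "\<bar>d + k\<bar> \<le> c" for d k a m c :: real
  proof -
    have "a * (2 * m) = 2 * (m * a)" "4 * m * a = 4 * (m * a)" "6 * m * a = 6 * (m * a)" by simp_all
    with that show ?thesis by linarith
  qed
  ultimately show ?thesis using dens_expansion[OF e x] by blast
qed

lemma dens_deriv_0:
  assumes x: "x \<in> sphere 0 1"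
  shows "((\<lambda>t. dens t x) has_real_derivative - (norm (G x))\<^sup>2) (at 0)"
proof -
  let ?h = "\<lambda>t. - ((norm (G (contact t x)))\<^sup>2 / \<rho> t x)"
  have 0: "\<bar>0::real\<bar> < \<delta>" using \<delta>_pos by simp
  have "(?h \<longlongrightarrow> - ((norm (G (contact 0 x)))\<^sup>2 / \<rho> 0 x)) (at 0)"
    using DERIV_isCont[OF \<rho>_deriv[OF 0 x]] \<rho>_0[OF x]
    by (intro tendsto_intros tendsto_along_contact 0 x cont_G) (auto simp: isCont_def)
  then have h: "(?h \<longlongrightarrow> - (norm (G x))\<^sup>2) (at 0)" by (simp add: contact_0[OF x] \<rho>_0[OF x])
  have "((\<lambda>t. (dens t x - dens 0 x) / (t - 0) - ?h t) \<longlongrightarrow> 0) (at 0)"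
  proof (rule Lim_null_comparison)
    have "\<forall>\<^sub>F t in at 0. t \<noteq> (0::real)" by (simp add: eventually_at_filter)
    with eventually_\<delta>[OF 0]
    show "\<forall>\<^sub>F t in at 0. norm ((dens t x - dens 0 x) / (t - 0) - ?h t) \<le> 32 * M ^ 3 * \<bar>t\<bar>"
    proof eventually_elim
      case (elim t)
      have "(dens t x - dens 0 x) / (t - 0) - ?h t =
          (dens t x - \<xi> x + t * ((norm (G (contact t x)))\<^sup>2 / \<rho> t x)) / t"
        using elim by (simp add: dens_0[OF x] add_divide_distrib)
      then have "norm ((dens t x - dens 0 x) / (t - 0) - ?h t) \<le> 32 * M ^ 3 * t\<^sup>2 / \<bar>t\<bar>"
        using dens_expansion[OF elim(1) x] by (simp add: divide_right_mono)
      also have "\<dots> = 32 * M ^ 3 * \<bar>t\<bar>" using elim by (simp add: power2_eq_square abs_if)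
      finally show ?case .
    qed
    show "((\<lambda>t. 32 * M ^ 3 * \<bar>t\<bar>) \<longlongrightarrow> 0) (at 0)" by (auto intro!: tendsto_eq_intros)
  qed
  from tendsto_add[OF this h] show ?thesis unfolding has_field_derivative_iff by simp
qed

text \<open>The classical second variation of volume at the unit ball, from the product rule: the
  power of the radius yields the \<open>\<xi>\<close> term, the slope \<open>dens\<close> the
  gradient term.\<close>

lemma vol'_deriv_0:
  "(vol' has_real_derivative
    real CARD('n) * ((real CARD('n) - 1) * sph_int (\<lambda>x. (\<xi> x)\<^sup>2) - sph_int (\<lambda>x. (norm (G x))\<^sup>2))) (at 0)"
proof -
  let ?N = "CARD('n)"
  let ?d = "\<lambda>x. real ?N * ((real ?N - 1) * (\<xi> x)\<^sup>2 - (norm (G x))\<^sup>2)"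
  have "((\<lambda>\<epsilon>. sph_int (\<lambda>x. real ?N * \<rho> \<epsilon> x ^ (?N - 1) * dens \<epsilon> x)) has_real_derivative sph_int ?d) (at 0)"
  \<comment> \<open>\<open>L\<close> mirrors the product rule: the Lipschitz constant of the power
    of \<open>\<rho>\<close> times the bound \<open>2 * M\<close> on \<open>dens\<close>, plus the
    constant of \<open>dens_lipschitz_0\<close>.\<close>
  proof (rule sph_int_dominated_derivative(2)[where d=\<delta> and
        L="real ?N * (real (?N - 1) * 2 ^ (?N - 1) * (2 * M) * (2 * M) + 6 * M\<^sup>2)"])
    show "\<delta> > 0" by (rule \<delta>_pos)
    show "sph_integrable (\<lambda>x. real ?N * \<rho> t x ^ (?N - 1) * dens t x)" if "\<bar>t - 0\<bar> < \<delta>" for t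
      using that by (intro vol'_integrable) simp
    fix x :: "real^'n" assume x: "x \<in> sphere 0 1"
    have 0: "\<bar>0::real\<bar> < \<delta>" using \<delta>_pos by simp
    have N1: "real (?N - 1) = real ?N - 1" by (simp add: of_nat_diff Suc_leI)
    have "((\<lambda>t. real ?N * \<rho> t x ^ (?N - 1) * dens t x) has_real_derivative
      real ?N * (real (?N - 1) * dens 0 x * \<rho> 0 x ^ (?N - 1 - 1)) * dens 0 x
        + real ?N * \<rho> 0 x ^ (?N - 1) * (- (norm (G x))\<^sup>2)) (at 0)"
      by (auto intro!: derivative_eq_intros \<rho>_deriv[OF 0 x] dens_deriv_0[OF x] simp: algebra_simps)
    then show "((\<lambda>t. real ?N * \<rho> t x ^ (?N - 1) * dens t x) has_real_derivative ?d x) (at 0)"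
      by (simp add: \<rho>_0[OF x] dens_0[OF x] N1 algebra_simps power2_eq_square)
    fix t assume "\<bar>t - 0\<bar> < \<delta>"
    then have t: "\<bar>t\<bar> \<le> \<delta>" by simp
    have 1: "\<bar>\<rho> t x ^ (?N - 1) - 1\<bar> \<le> real (?N - 1) * 2 ^ (?N - 1) * (2 * M * \<bar>t\<bar>)"
    proof -
      have "\<bar>\<rho> t x ^ (?N - 1) - 1 ^ (?N - 1)\<bar> \<le> real (?N - 1) * 2 ^ (?N - 1) * \<bar>\<rho> t x - 1\<bar>"
        using \<rho>_bounds[OF t x] by (intro power_lipschitz) auto
      also have "\<dots> \<le> real (?N - 1) * 2 ^ (?N - 1) * (2 * M * \<bar>t\<bar>)"
        using \<rho>_lipschitz[OF _ t x, of 0] \<delta>_pos \<rho>_0[OF x] by (intro mult_left_mono) auto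
      finally show ?thesis by simp
    qed
    have "\<bar>\<rho> t x ^ (?N - 1) * dens t x - \<xi> x\<bar> \<le> \<bar>(\<rho> t x ^ (?N - 1) - 1) * dens t x\<bar> + \<bar>dens t x - \<xi> x\<bar>"
      using abs_triangle_ineq[of "(\<rho> t x ^ (?N - 1) - 1) * dens t x" "dens t x - \<xi> x"] by (simp add: algebra_simps)
    also have "\<dots> \<le> (real (?N - 1) * 2 ^ (?N - 1) * (2 * M * \<bar>t\<bar>)) * (2 * M) + 6 * M\<^sup>2 * \<bar>t\<bar>"
      unfolding abs_mult using M1
      by (intro add_mono mult_mono 1 dens_bound t x dens_lipschitz_0) auto
    finally have 2: "\<bar>\<rho> t x ^ (?N - 1) * dens t x - \<xi> x\<bar> \<le>
        (real (?N - 1) * 2 ^ (?N - 1) * (2 * M) * (2 * M) + 6 * M\<^sup>2) * \<bar>t\<bar>" by (simp add: algebra_simps)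
    have "\<bar>real ?N * \<rho> t x ^ (?N - 1) * dens t x - real ?N * \<rho> 0 x ^ (?N - 1) * dens 0 x\<bar>
        = real ?N * \<bar>\<rho> t x ^ (?N - 1) * dens t x - \<xi> x\<bar>"
      by (simp add: \<rho>_0[OF x] dens_0[OF x] mult.assoc abs_mult flip: right_diff_distrib)
    also have "\<dots> \<le> real ?N * ((real (?N - 1) * 2 ^ (?N - 1) * (2 * M) * (2 * M) + 6 * M\<^sup>2) * \<bar>t\<bar>)"
      by (intro mult_left_mono 2) auto
    finally show "\<bar>real ?N * \<rho> t x ^ (?N - 1) * dens t x - real ?N * \<rho> 0 x ^ (?N - 1) * dens 0 x\<bar>
       \<le> real ?N * (real (?N - 1) * 2 ^ (?N - 1) * (2 * M) * (2 * M) + 6 * M\<^sup>2) * \<bar>t - 0\<bar>"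
      by (simp add: mult.assoc)
  qed
  moreover have "sph_int ?d = real ?N * ((real ?N - 1) * sph_int (\<lambda>x. (\<xi> x)\<^sup>2) - sph_int (\<lambda>x. (norm (G x))\<^sup>2))"
    unfolding sph_int_cmult
    by (subst sph_int_diff, (intro sph_integrable_continuous continuous_intros cont_\<xi> cont_G)+) (simp add: sph_int_cmult)
  ultimately show ?thesis unfolding vol'_def[abs_def] by simp
qed

text \<open>The scaled point \<open>bdpt \<epsilon> x\<close> lies in the Wulff shape by the lower
  gap and has height \<open>v x\<close> in direction \<open>x\<close>, so the supremum defining the
  support function is attained there.\<close>

lemma phi_in_Hstar_plus:
  assumes e: "\<bar>\<epsilon>\<bar> \<le> \<delta>"
  shows "phi p \<xi> \<epsilon> \<in> Hstar_plus"
proof -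
  define c where "c = cf p \<epsilon>"
  have c: "c > 0" using cf_pos[OF e] by (simp add: c_def)
  define v where "v = (\<lambda>x. c * pert \<epsilon> x)"
  have v: "phi p \<xi> \<epsilon> = v" unfolding v_def c_def by (rule phi_eq[OF e])
  interpret positive_sphere_fun v
    using c pert_bounds[OF e] unfolding v_def
    by unfold_locales (force intro: continuous_intros cont_\<xi>)+
  have sup: "support_fun (body v) x = v x" if x: "x \<in> sphere 0 1" for x
    unfolding support_fun_def
  proof (rule cSup_eq_maximum)
    have "z \<bullet> (c *\<^sub>R bdpt \<epsilon> x) \<le> v z" if "norm z = 1" for z
    proof -
      have "(norm (z - x))\<^sup>2 / 4 \<ge> 0" by simp
      moreover have "(norm (z - x))\<^sup>2 / 4 \<le> pert \<epsilon> z - z \<bullet> bdpt \<epsilon> x"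
        using support_gap(1)[OF e, of z x] that x by (simp only: mem_sphere_0)
      ultimately have "z \<bullet> bdpt \<epsilon> x \<le> pert \<epsilon> z" by linarith
      then show ?thesis using c by (simp add: v_def)
    qed
    then have "c *\<^sub>R bdpt \<epsilon> x \<in> body v" by (simp add: body_iff)
    moreover have "v x = x \<bullet> (c *\<^sub>R bdpt \<epsilon> x)" using bdpt_inner[OF x, of \<epsilon>] by (simp add: v_def)
    ultimately show "v x \<in> (\<bullet>) x ` body v" by blast
    show "y \<le> v x" if "y \<in> (\<bullet>) x ` body v" for y using that x by (auto simp: body_iff)
  qed
  show ?thesis
    unfolding v Hstar_plus_def
    using convex_body compact_body zero_in_body sup pos lmeasurable_compact[OF compact_body]
    by (auto intro!: exI[of _ "body v"] simp: fmeasurable_def)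
qed

end

section \<open>Smooth functions: polynomials, Lipschitz bounds and criticality\<close>

lemma real_polynomial_function_gradient:
  fixes f :: "'a::euclidean_space \<Rightarrow> real"
  assumes "real_polynomial_function f"
  shows "\<exists>f'. \<forall>x. (f has_derivative f' x) (at x) \<and> (\<forall>v. real_polynomial_function (\<lambda>x. f' x v))"
  using assms
proof (induction f rule: real_polynomial_function.induct)
  case (linear f)
  then show ?case
    by (intro exI[of _ "\<lambda>x. f"]) (auto intro: bounded_linear_imp_has_derivative real_polynomial_function.intros)
next
  case (const c)
  then show ?case by (intro exI[of _ "\<lambda>x v. 0"]) (auto intro: real_polynomial_function.intros)
next
  case (add f g)
  then obtain f' g' where "\<forall>x. (f has_derivative f' x) (at x) \<and> (\<forall>v. real_polynomial_function (\<lambda>x. f' x v))"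
    "\<forall>x. (g has_derivative g' x) (at x) \<and> (\<forall>v. real_polynomial_function (\<lambda>x. g' x v))" by blast
  then show ?case
    by (intro exI[of _ "\<lambda>x v. f' x v + g' x v"]) (auto intro: has_derivative_add real_polynomial_function.intros)
next
  case (mult f g)
  then obtain f' g' where "\<forall>x. (f has_derivative f' x) (at x) \<and> (\<forall>v. real_polynomial_function (\<lambda>x. f' x v))"
    "\<forall>x. (g has_derivative g' x) (at x) \<and> (\<forall>v. real_polynomial_function (\<lambda>x. g' x v))" by blast
  then show ?case using mult.hyps
    by (intro exI[of _ "\<lambda>x v. f x * g' x v + f' x v * g x"])
       (auto intro!: has_derivative_mult real_polynomial_function.intros(3,4))
qed

text \<open>Directional derivatives of polynomials are again polynomials, so these functions form an
  invariant for the coinduction.\<close>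

lemma smooth_fun_polynomial:
  fixes f :: "real^'n \<Rightarrow> real"
  assumes "real_polynomial_function f"
  shows "smooth_fun f"
  using assms
proof (coinduction arbitrary: f rule: smooth_fun.coinduct)
  case (smooth_fun f)
  from real_polynomial_function_gradient[OF this]
  obtain f' where f': "\<And>x. (f has_derivative f' x) (at x)" "\<And>v. real_polynomial_function (\<lambda>x. f' x v)"
    by metis
  have "f differentiable (at x)" for x using f'(1) by (rule differentiableI)
  moreover have "frechet_derivative f (at x) = f' x" for x
    by (rule frechet_derivative_at[OF f'(1), symmetric])
  then have "real_polynomial_function (\<lambda>x. frechet_derivative f (at x) v)" for v
    using f'(2) by (simp only:)
  ultimately show ?case by blast
qed

text \<open>Unfolding \<open>smooth_fun\<close> once gives the derivative; unfolding it for the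
  partial derivatives makes the gradient continuous, hence bounded on the ball.\<close>

lemma smooth_fun_lipschitz:
  fixes f :: "real^'n \<Rightarrow> real"
  assumes "smooth_fun f"
  obtains L where "L \<ge> 0" "continuous_on (sphere 0 1) f"
    "\<And>x y. x \<in> sphere 0 1 \<Longrightarrow> y \<in> sphere 0 1 \<Longrightarrow> \<bar>f x - f y\<bar> \<le> L * norm (x - y)"
proof -
  define D where "D x = (\<Sum>b\<in>Basis. frechet_derivative f (at x) b *\<^sub>R b)" for x
  have diff: "f differentiable (at x)" and dd: "smooth_fun (\<lambda>x. frechet_derivative f (at x) v)" for x v
    using assms by (auto elim: smooth_fun.cases)
  have cont: "continuous_on A g" if "smooth_fun g" for A and g :: "real^'n \<Rightarrow> real"
    using that by (intro continuous_at_imp_continuous_on)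
      (auto elim: smooth_fun.cases intro: differentiable_imp_continuous_within)
  have "(f has_derivative (\<lambda>v. D x \<bullet> v)) (at x)" for x
  proof -
    have lin: "linear (frechet_derivative f (at x))" using diff by (rule linear_frechet_derivative)
    have "frechet_derivative f (at x) v = D x \<bullet> v" for v
    proof -
      have "frechet_derivative f (at x) v = frechet_derivative f (at x) (\<Sum>b\<in>Basis. (v \<bullet> b) *\<^sub>R b)"
        by (simp add: euclidean_representation)
      also have "\<dots> = (\<Sum>b\<in>Basis. (v \<bullet> b) * frechet_derivative f (at x) b)"
        by (simp add: linear_sum[OF lin] linear_scale[OF lin])
      also have "\<dots> = D x \<bullet> v"
        unfolding D_def inner_sum_left inner_scaleR_left
        by (rule sum.cong[OF refl]) (simp add: inner_commute mult.commute)
      finally show ?thesis .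
    qed
    then have "frechet_derivative f (at x) = (\<lambda>v. D x \<bullet> v)" by blast
    then show ?thesis using diff by (metis frechet_derivative_works)
  qed
  moreover have "continuous_on UNIV D"
    unfolding D_def by (intro continuous_intros cont dd)
  ultimately obtain L where "L \<ge> 0" "\<And>x y. x \<in> cball 0 1 \<Longrightarrow> y \<in> cball 0 1 \<Longrightarrow> \<bar>f x - f y\<bar> \<le> L * norm (x - y)"
    using gradient_lipschitz_on_ball by blast
  then show ?thesis using cont[OF assms] by (intro that[of L]) auto
qed

lemma I_fun_phi_critical_smooth:
  fixes \<xi> :: "real^'n \<Rightarrow> real"
  assumes "smooth_fun \<xi>" "p \<noteq> 0"
  shows "((\<lambda>\<epsilon>. I_fun (phi p \<xi> \<epsilon>)) has_real_derivative 0) (at 0)"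
proof -
  obtain L where L: "L \<ge> 0" "continuous_on (sphere 0 1) \<xi>"
    "\<And>x y. x \<in> sphere 0 1 \<Longrightarrow> y \<in> sphere 0 1 \<Longrightarrow> \<bar>\<xi> x - \<xi> y\<bar> \<le> L * norm (x - y)"
    using smooth_fun_lipschitz[OF assms(1)] by blast
  obtain B where B: "\<And>x. x \<in> sphere 0 1 \<Longrightarrow> \<bar>\<xi> x\<bar> \<le> B" using sph_continuous_bounded[OF L(2)] by blast
  interpret bounded_perturbation \<xi> "max B 1"
    using L(2) B by unfold_locales (auto simp: le_max_iff_disj)
  show ?thesis by (rule I_fun_phi_critical[OF L(1,3) assms(2)])
qed

section \<open>Second variation of the normalised functional\<close>

context smooth_perturbation
begin

text \<open>With J the integral of the square of \<open>\<xi>\<close>, mean zero makes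
  \<open>w 0\<close> and \<open>vol' 0\<close> vanish, so products of first derivatives drop out.
  The mass contributes N (p - 1) J and the volume - N ((N - 1) J - k J).\<close>

lemma I_fun_phi_second_variation:
  assumes p: "p \<noteq> 0" and mean: "sph_int \<xi> = 0"
    and grad: "sph_int (\<lambda>x. (norm (G x))\<^sup>2) = k * sph_int (\<lambda>x. (\<xi> x)\<^sup>2)"
  obtains g where "\<And>\<epsilon>. \<bar>\<epsilon>\<bar> < \<delta> \<Longrightarrow> ((\<lambda>\<epsilon>. I_fun (phi p \<xi> \<epsilon>)) has_real_derivative g \<epsilon>) (at \<epsilon>)" "g 0 = 0"
    "(g has_real_derivative real CARD('n) * (p - real CARD('n) + k) * sph_int (\<lambda>x. (\<xi> x)\<^sup>2)) (at 0)"
proof -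
  let ?N = "real CARD('n)" and ?J = "sph_int (\<lambda>x. (\<xi> x)\<^sup>2)"
  define w where "w \<epsilon> = sph_int (\<lambda>x. p * \<xi> x * pert \<epsilon> x powr (p - 1))" for \<epsilon>
  define g where "g \<epsilon> = (?N / p) * (mass p \<epsilon> / \<omega>) powr (- ?N / p - 1) * (w \<epsilon> / \<omega>) * vol \<epsilon>
      - (mass p \<epsilon> / \<omega>) powr (- ?N / p) * vol' \<epsilon>" for \<epsilon>
  have m: "(mass p has_real_derivative w \<epsilon>) (at \<epsilon>)" if "\<bar>\<epsilon>\<bar> < \<delta>" for \<epsilon>
    unfolding w_def by (rule mass_deriv[OF that])
  have 0: "\<bar>0::real\<bar> < \<delta>" using \<delta>_pos by simp
  have w0: "w 0 = 0" unfolding w_def using mean by (simp add: sph_int_cmult)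
  have v0: "vol' 0 = 0"
  proof -
    have "vol' 0 = sph_int (\<lambda>x. ?N * \<xi> x)"
      unfolding vol'_def by (rule sph_int_cong) (simp add: \<rho>_0 dens_0)
    then show ?thesis by (simp add: sph_int_cmult mean)
  qed
  have w': "(w has_real_derivative p * (p - 1) * ?J) (at 0)"
  proof -
    have "((\<lambda>\<epsilon>. sph_int (\<lambda>x. (p * \<xi> x) * pert \<epsilon> x powr (p - 1))) has_real_derivative
        sph_int (\<lambda>x. (p - 1) * ((p * \<xi> x) * \<xi> x) * pert 0 x powr (p - 1 - 1))) (at 0)"
      by (rule sph_int_pert_powr_deriv[OF _ 0]) (intro continuous_intros cont_\<xi>)
    moreover have "sph_int (\<lambda>x. (p - 1) * ((p * \<xi> x) * \<xi> x) * pert 0 x powr (p - 1 - 1)) = p * (p - 1) * ?J"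
      unfolding sph_int_cmult[symmetric] by (rule sph_int_cong) (simp add: power2_eq_square algebra_simps)
    ultimately show ?thesis unfolding w_def[abs_def] by simp
  qed
  have "((\<lambda>\<epsilon>. I_fun (phi p \<xi> \<epsilon>)) has_real_derivative g \<epsilon>) (at \<epsilon>)" if "\<bar>\<epsilon>\<bar> < \<delta>" for \<epsilon>
    unfolding g_def by (rule I_fun_phi_deriv[OF that vol_deriv[OF that] m[OF that]])
  moreover have "g 0 = 0" by (simp add: g_def w0 v0)
  moreover have "(g has_real_derivative ?N * (p - ?N + k) * ?J) (at 0)"
  proof -
    \<comment> \<open>Since \<open>w 0 = 0\<close>, every power of the mass ratio is stationary; the
      exponent stays general because \<open>g\<close> contains two of them.\<close>
    have A: "((\<lambda>\<epsilon>. (mass p \<epsilon> / \<omega>) powr a) has_real_derivative 0) (at 0)" for a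
    proof -
      have "((\<lambda>\<epsilon>. (mass p \<epsilon> / \<omega>) powr a) has_real_derivative a * (mass p 0 / \<omega>) powr (a - 1) * (w 0 / \<omega>)) (at 0)"
        using \<omega>_pos mass_0[of p]
        by (auto intro!: derivative_eq_intros m[OF 0] simp: w0)
      then show ?thesis by (simp add: w0)
    qed
    have "(g has_real_derivative
      ((?N / p) * 0 * (w 0 / \<omega>) + (p * (p - 1) * ?J / \<omega>) * ((?N / p) * (mass p 0 / \<omega>) powr (- ?N / p - 1))) * vol 0
        + vol' 0 * ((?N / p) * (mass p 0 / \<omega>) powr (- ?N / p - 1) * (w 0 / \<omega>))
       - (0 * vol' 0 + (?N * ((?N - 1) * ?J - sph_int (\<lambda>x. (norm (G x))\<^sup>2))) * (mass p 0 / \<omega>) powr (- ?N / p))) (at 0)"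
      unfolding g_def[abs_def]
      by (intro DERIV_diff DERIV_mult DERIV_cmult DERIV_cdivide A w' vol_deriv[OF 0] vol'_deriv_0)
    moreover have "(?N / p) * (p * (p - 1) * ?J / \<omega>) * \<omega> - ?N * ((?N - 1) * ?J - k * ?J) = ?N * (p - ?N + k) * ?J"
      using p \<omega>_pos by (simp add: field_simps)
    ultimately show ?thesis
      using \<omega>_pos by (simp add: mass_0 vol_0 w0 v0 grad mult.commute)
  qed
  ultimately show ?thesis by (rule that)
qed

end

lemma negative_second_derivative_decrease:
  fixes f g :: "real \<Rightarrow> real"
  assumes d: "d > 0" and f: "\<And>t. \<bar>t\<bar> < d \<Longrightarrow> (f has_real_derivative g t) (at t)"
    and g: "g 0 = 0" "(g has_real_derivative d2) (at 0)" "d2 < 0"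
  obtains t where "0 < t" "t < d" "f t < f 0"
proof -
  obtain e where e: "e > 0" "\<And>h. 0 < h \<Longrightarrow> h < e \<Longrightarrow> g h < 0"
    using DERIV_neg_dec_right[OF g(2,3)] g(1) by auto
  let ?t = "min d e / 2"
  have t: "0 < ?t" "?t < d" "?t < e" using d e by auto
  have "f ?t < f 0"
  proof (rule DERIV_neg_imp_decreasing_open[OF t(1)])
    show "\<exists>y. (f has_real_derivative y) (at x) \<and> y < 0" if "0 < x" "x < ?t" for x
      using f[of x] e(2)[of x] that t by (intro exI[of _ "g x"]) auto
    show "continuous_on {0..?t} f"
      using t by (intro continuous_at_imp_continuous_on ballI DERIV_isCont[OF f]) auto
  qed
  then show ?thesis using t that by blast
qed

section \<open>The simplex cubic\<close>

text \<open>Otherwise the integral over a box around \<open>a / 2\<close>, an interior point of the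
  ball that projects to \<open>a\<close>, would vanish, and a continuous nonnegative integrand would
  be zero there.\<close>

lemma sph_int_pos:
  fixes f :: "real^'n \<Rightarrow> real"
  assumes f: "continuous_on (sphere 0 1) f" and nn: "\<And>x. x \<in> sphere 0 1 \<Longrightarrow> f x \<ge> 0"
    and a: "a \<in> sphere 0 1" "f a > 0"
  shows "sph_int f > 0"
proof -
  let ?h = "\<lambda>x. f (x /\<^sub>R norm x)"
  let ?A = "ball (0::real^'n) 1 - {0}"
  have hc: "continuous_on ?A ?h"
    by (rule continuous_on_compose2[OF f])
       (auto intro!: continuous_intros simp del: norm_scaleR simp: norm_dir image_subset_iff)
  have "(1/2) *\<^sub>R a \<in> ?A" "open ?A" using a by auto
  then obtain c d where cd: "cbox c d \<subseteq> ?A" "(1/2) *\<^sub>R a \<in> box c d"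
    using open_contains_cbox by metis
  have hcd: "continuous_on (cbox c d) ?h" using hc cd(1) by (rule continuous_on_subset)
  have nnh: "?h x \<ge> 0" if "x \<noteq> 0" for x using nn[of "x /\<^sub>R norm x"] that by simp
  have h: "?h integrable_on cball 0 1 - {0}" "sph_int f = real CARD('n) * integral (cball 0 1 - {0}) ?h"
    using sph_integrable_continuous[OF f] integrable_integral_minus_origin[of ?h]
    unfolding sph_integrable_def sph_int_def by auto
  show ?thesis
  proof (rule ccontr)
    assume "\<not> ?thesis"
    then have "integral (cball 0 1 - {0}) ?h \<le> 0" by (simp add: h(2) mult_le_0_iff not_less)
    moreover have "integral (cbox c d) ?h \<le> integral (cball 0 1 - {0}) ?h"
      using cd(1) h(1) nnh by (intro integral_subset_le integrable_continuous hcd) (auto simp: subset_iff)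
    moreover have "integral (cbox c d) ?h \<ge> 0"
      using cd(1) nnh by (intro Henstock_Kurzweil_Integration.integral_nonneg integrable_continuous hcd) auto
    ultimately have "integral (cbox c d) ?h = 0" by linarith
    then have "(?h has_integral 0) (cbox c d)"
      using integrable_integral[OF integrable_continuous[OF hcd]] by simp
    moreover have "0 \<le> ?h x" if "x \<in> box c d" for x
      using nnh[of x] that cd(1) box_subset_cbox by blast
    ultimately have "?h ((1/2) *\<^sub>R a) = 0"
      using has_integral_0_cbox_imp_0[OF hcd] cd(2) box_subset_cbox by blast
    then show False using a by simp
  qed
qed

definition simplex_cubic :: "(nat \<Rightarrow> real^'n) \<Rightarrow> real^'n \<Rightarrow> real" where
  "simplex_cubic q x = (\<Sum>i<CARD('n) + 1. (q i \<bullet> x) ^ 3)"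

definition simplex_cubic_grad :: "(nat \<Rightarrow> real^'n) \<Rightarrow> real^'n \<Rightarrow> real^'n" where
  "simplex_cubic_grad q x = (\<Sum>i<CARD('n) + 1. (3 * (q i \<bullet> x)\<^sup>2) *\<^sub>R q i)"

text \<open>By Euler's identity the radial component of the gradient on the unit sphere is three
  times the cubic.\<close>

definition simplex_cubic_tangent :: "(nat \<Rightarrow> real^'n) \<Rightarrow> real^'n \<Rightarrow> real^'n" where
  "simplex_cubic_tangent q x = simplex_cubic_grad q x - (3 * simplex_cubic q x) *\<^sub>R x"

lemma simplex_cubic_deriv:
  fixes q :: "nat \<Rightarrow> real^'n"
  shows "(simplex_cubic q has_derivative (\<lambda>v. simplex_cubic_grad q x \<bullet> v)) (at x)"
proof -
  have "((\<lambda>x. \<Sum>i<CARD('n) + 1. (q i \<bullet> x) ^ 3) has_derivative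
      (\<lambda>v. \<Sum>i<CARD('n) + 1. ((3 * (q i \<bullet> x)\<^sup>2) *\<^sub>R q i) \<bullet> v)) (at x)"
    by (intro has_derivative_sum) (auto intro!: derivative_eq_intros simp: fun_eq_iff)
  then show ?thesis
    unfolding simplex_cubic_def[abs_def] simplex_cubic_grad_def inner_sum_left .
qed

lemma continuous_simplex_cubic [continuous_intros]:
  "continuous_on A (simplex_cubic q)" "continuous_on A (simplex_cubic_grad q)"
  "continuous_on A (simplex_cubic_tangent q)"
proof -
  show *: "continuous_on A (simplex_cubic q)" "continuous_on A (simplex_cubic_grad q)"
    unfolding simplex_cubic_def simplex_cubic_grad_def by (intro continuous_intros)+
  show "continuous_on A (simplex_cubic_tangent q)"
    unfolding simplex_cubic_tangent_def by (intro continuous_intros *)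
qed

lemma simplex_cubic_euler: "simplex_cubic_grad q x \<bullet> x = 3 * simplex_cubic q x"
  unfolding simplex_cubic_def simplex_cubic_grad_def inner_sum_left sum_distrib_left
  by (rule sum.cong[OF refl]) (simp add: power3_eq_cube power2_eq_square)

lemma smooth_simplex_cubic: "smooth_fun (simplex_cubic q)"
proof (rule smooth_fun_polynomial)
  show "real_polynomial_function (simplex_cubic q)"
    unfolding simplex_cubic_def
    by (intro real_polynomial_function_sum real_polynomial_function_power real_polynomial_function.intros(1)
        bounded_linear_inner_right) auto
qed

context
  fixes q :: "nat \<Rightarrow> real^'n"
  assumes simplex: "regular_simplex q"
begin

lemma simplex_norm: "i < CARD('n) + 1 \<Longrightarrow> norm (q i) = 1"
  using simplex by (simp add: regular_simplex_def)

lemma simplex_inner: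
  "i < CARD('n) + 1 \<Longrightarrow> j < CARD('n) + 1 \<Longrightarrow> i \<noteq> j \<Longrightarrow> q i \<bullet> q j = - 1 / real CARD('n)"
  using simplex by (simp add: regular_simplex_def)

text \<open>A row of the Gram matrix. \<open>F\<close> is the identity for the sum of the vertices
  and the cube for the value of the cubic at a vertex.\<close>

lemma simplex_inner_sum:
  fixes F :: "real \<Rightarrow> real"
  assumes j: "j < CARD('n) + 1"
  shows "(\<Sum>i<CARD('n) + 1. F (q i \<bullet> q j)) = F 1 + real CARD('n) * F (- 1 / real CARD('n))"
proof -
  have "(\<Sum>i<CARD('n) + 1. F (q i \<bullet> q j)) = F (q j \<bullet> q j) + (\<Sum>i\<in>{..<CARD('n) + 1} - {j}. F (q i \<bullet> q j))"
    using j by (subst sum.remove[of _ j]) auto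
  also have "(\<Sum>i\<in>{..<CARD('n) + 1} - {j}. F (q i \<bullet> q j)) = (\<Sum>i\<in>{..<CARD('n) + 1} - {j}. F (- 1 / real CARD('n)))"
    using j by (intro sum.cong) (auto simp: simplex_inner)
  also have "q j \<bullet> q j = 1" using simplex_norm[OF j] by (simp add: norm_eq_1)
  finally show ?thesis using j by simp
qed

text \<open>The squared norm of the sum is the total of the Gram matrix, whose rows each add up to
  0.\<close>

lemma simplex_sum: "(\<Sum>i<CARD('n) + 1. q i) = 0"
proof -
  have "(\<Sum>i<CARD('n) + 1. q i) \<bullet> (\<Sum>j<CARD('n) + 1. q j) = (\<Sum>j<CARD('n) + 1. \<Sum>i<CARD('n) + 1. q i \<bullet> q j)"
    by (simp only: inner_sum_left inner_sum_right)
  also have "\<dots> = (\<Sum>j<CARD('n) + 1. 0)"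
    using simplex_inner_sum[of _ "\<lambda>t. t"] by (intro sum.cong) auto
  finally show ?thesis by simp
qed

lemma simplex_inner_le:
  assumes "x \<in> sphere 0 1" "i < CARD('n) + 1" shows "\<bar>q i \<bullet> x\<bar> \<le> 1"
  using Cauchy_Schwarz_ineq2[of "q i" x] simplex_norm[OF assms(2)] assms(1) by simp

text \<open>With K = N + 1 vertices, gradient and radial part are each at most 3 K, hence the 6. The
  Taylor remainder, 3 K plus 3/2 K for the removed radial part, fits as well.\<close>

lemma simplex_cubic_perturbation:
  "smooth_perturbation (simplex_cubic q) (6 * (real CARD('n) + 1)) (simplex_cubic_tangent q)"
proof -
  let ?K = "real CARD('n) + 1" and ?I = "{..<CARD('n) + 1}"
  have cb: "\<bar>simplex_cubic q x\<bar> \<le> ?K" if x: "x \<in> sphere 0 1" for x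
  proof -
    have "\<bar>simplex_cubic q x\<bar> \<le> (\<Sum>i\<in>?I. \<bar>(q i \<bullet> x) ^ 3\<bar>)" unfolding simplex_cubic_def by (rule sum_abs)
    also have "\<dots> \<le> (\<Sum>i\<in>?I. 1)"
      using simplex_inner_le[OF x] by (intro sum_mono) (auto simp: power_abs intro: power_le_one)
    finally show ?thesis by simp
  qed
  have gb: "norm (simplex_cubic_grad q x) \<le> 3 * ?K" if x: "x \<in> sphere 0 1" for x
  proof -
    have "norm (simplex_cubic_grad q x) \<le> (\<Sum>i\<in>?I. norm ((3 * (q i \<bullet> x)\<^sup>2) *\<^sub>R q i))"
      unfolding simplex_cubic_grad_def by (rule norm_sum)
    also have "\<dots> \<le> (\<Sum>i\<in>?I. 3)"
      using simplex_inner_le[OF x] by (intro sum_mono) (auto simp: simplex_norm abs_square_le_1)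
    finally show ?thesis by simp
  qed
  show ?thesis
  proof
    fix x :: "real^'n" assume x: "x \<in> sphere 0 1"
    show "\<bar>simplex_cubic q x\<bar> \<le> 6 * ?K" using cb[OF x] by simp
    have "norm (simplex_cubic_tangent q x) \<le> norm (simplex_cubic_grad q x) + norm ((3 * simplex_cubic q x) *\<^sub>R x)"
      unfolding simplex_cubic_tangent_def by (rule norm_triangle_ineq4)
    then show "norm (simplex_cubic_tangent q x) \<le> 6 * ?K"
      using gb[OF x] cb[OF x] x by (simp add: abs_mult)
    have "x \<bullet> x = 1" using x by (simp add: norm_eq_1)
    then show "simplex_cubic_tangent q x \<bullet> x = 0"
      by (simp add: simplex_cubic_tangent_def inner_diff_left simplex_cubic_euler)
    fix z :: "real^'n" assume z: "z \<in> sphere 0 1"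
    define t where "t = (norm (x - z))\<^sup>2"
    \<comment> \<open>Termwise a^3 - b^3 - 3 b^2 (a - b) = (a - b)^2 (a + 2 b), with the last factor
      at most 3 in modulus.\<close>
    have taylor: "simplex_cubic q x - simplex_cubic q z - simplex_cubic_grad q z \<bullet> (x - z) =
       (\<Sum>i\<in>?I. (q i \<bullet> (x - z))\<^sup>2 * (q i \<bullet> x + 2 * (q i \<bullet> z)))"
      unfolding simplex_cubic_def simplex_cubic_grad_def inner_sum_left sum_subtractf[symmetric]
      by (rule sum.cong[OF refl])
         (simp add: inner_diff_right power3_eq_cube power2_eq_square algebra_simps)
    have "\<bar>simplex_cubic q x - simplex_cubic q z - simplex_cubic_grad q z \<bullet> (x - z)\<bar> \<le>
        (\<Sum>i\<in>?I. \<bar>(q i \<bullet> (x - z))\<^sup>2 * (q i \<bullet> x + 2 * (q i \<bullet> z))\<bar>)"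
      unfolding taylor by (rule sum_abs)
    also have "\<dots> \<le> (\<Sum>i\<in>?I. t * 3)"
    proof (rule sum_mono)
      fix i assume "i \<in> ?I"
      then have i: "i < CARD('n) + 1" by simp
      have "\<bar>q i \<bullet> (x - z)\<bar> \<le> norm (x - z)"
        using Cauchy_Schwarz_ineq2[of "q i" "x - z"] simplex_norm[OF i] by simp
      then have "(q i \<bullet> (x - z))\<^sup>2 \<le> t" unfolding t_def by (metis abs_ge_zero power2_abs power_mono)
      then show "\<bar>(q i \<bullet> (x - z))\<^sup>2 * (q i \<bullet> x + 2 * (q i \<bullet> z))\<bar> \<le> t * 3"
        unfolding abs_mult using simplex_inner_le[OF x i] simplex_inner_le[OF z i]
        by (intro mult_mono) (auto simp: t_def)
    qed
    finally have 1: "\<bar>simplex_cubic q x - simplex_cubic q z - simplex_cubic_grad q z \<bullet> (x - z)\<bar> \<le> 3 * ?K * t"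
      by (simp add: algebra_simps)
    \<comment> \<open>A chord of the sphere is normal to \<open>z\<close> only to first order; this
      is what projecting the gradient costs in the remainder.\<close>
    have "z \<bullet> (x - z) = - t / 2"
      using inner_sphere[of x z] x z by (simp add: t_def inner_diff_right norm_eq_1)
    then have 2: "simplex_cubic_tangent q z \<bullet> (x - z) = simplex_cubic_grad q z \<bullet> (x - z) + 3/2 * (simplex_cubic q z * t)"
      by (simp add: simplex_cubic_tangent_def inner_diff_left)
    have "\<bar>simplex_cubic q z * t\<bar> \<le> ?K * t"
      unfolding abs_mult using cb[OF z] by (intro mult_mono) (auto simp: t_def)
    moreover have "6 * ?K * t = 3 * ?K * t + 3 * (?K * t)" by (simp add: algebra_simps)
    moreover have "0 \<le> ?K * t" by (simp add: t_def)
    ultimately show "\<bar>simplex_cubic q x - simplex_cubic q z - simplex_cubic_tangent q z \<bullet> (x - z)\<bar> \<le> 6 * ?K * (norm (x - z))\<^sup>2"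
      using 1 unfolding 2 t_def[symmetric] by linarith
  qed (auto intro: continuous_intros)
qed

text \<open>Integration by parts with the square of \<open>q i \<bullet> x\<close> turns each cubic
  moment into a linear one, and the linear moments cancel in the sum over the vertices.\<close>

lemma sph_int_simplex_cubic: "sph_int (simplex_cubic q) = 0"
proof -
  let ?I = "{..<CARD('n) + 1}"
  have one: "2 * sph_int (\<lambda>x. q i \<bullet> x) = (real CARD('n) + 1) * sph_int (\<lambda>x. (q i \<bullet> x) ^ 3)" if "i \<in> ?I" for i
  proof -
    have qq: "q i \<bullet> q i = 1" using simplex_norm[of i] that by (simp add: norm_eq_1)
    have "sph_int (\<lambda>x. ((2 * (q i \<bullet> x)) *\<^sub>R q i) \<bullet> q i) = (real CARD('n) - 1) * sph_int (\<lambda>x. (x \<bullet> q i) * (q i \<bullet> x)\<^sup>2)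
      + sph_int (\<lambda>x. (x \<bullet> q i) * (((2 * (q i \<bullet> x)) *\<^sub>R q i) \<bullet> x))"
      by (rule sph_int_gradient) (auto intro!: derivative_eq_intros continuous_intros simp: fun_eq_iff)
    also have "(\<lambda>x. (x \<bullet> q i) * (q i \<bullet> x)\<^sup>2) = (\<lambda>x. (q i \<bullet> x) ^ 3)"
      by (auto simp: power3_eq_cube power2_eq_square inner_commute)
    also have "(\<lambda>x. (x \<bullet> q i) * (((2 * (q i \<bullet> x)) *\<^sub>R q i) \<bullet> x)) = (\<lambda>x. 2 * (q i \<bullet> x) ^ 3)"
      by (auto simp: power3_eq_cube inner_commute)
    finally show ?thesis by (simp add: qq sph_int_cmult algebra_simps)
  qed
  have "(real CARD('n) + 1) * sph_int (simplex_cubic q) = (\<Sum>i\<in>?I. (real CARD('n) + 1) * sph_int (\<lambda>x. (q i \<bullet> x) ^ 3))"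
    unfolding simplex_cubic_def[abs_def] sum_distrib_left[symmetric]
    by (subst sph_int_sum) (auto intro!: sph_integrable_continuous continuous_intros)
  also have "\<dots> = 2 * (\<Sum>i\<in>?I. sph_int (\<lambda>x. q i \<bullet> x))"
    unfolding sum_distrib_left by (rule sum.cong[OF refl]) (simp add: one)
  also have "(\<Sum>i\<in>?I. sph_int (\<lambda>x. q i \<bullet> x)) = sph_int (\<lambda>x. \<Sum>i\<in>?I. q i \<bullet> x)"
    by (rule sph_int_sum[symmetric]) (auto intro!: sph_integrable_continuous continuous_intros)
  also have "(\<lambda>x. \<Sum>i\<in>?I. q i \<bullet> x) = (\<lambda>x. 0)"
    using simplex_sum by (simp only: inner_sum_left[symmetric] inner_zero_left)
  finally show ?thesis by (simp add: sph_int_def)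
qed

text \<open>Integrate by parts with the product of \<open>(q i \<bullet> x) ^ 2\<close> and the
  cubic, in direction \<open>q i\<close>. This product has degree 5, so Euler's identity gives N - 1
  + 5 = N + 4. After summation the term with \<open>q i \<bullet> x\<close> disappears, which is
  harmonicity in disguise, and a third of the squared gradient remains.\<close>

lemma sph_int_simplex_cubic_grad:
  "sph_int (\<lambda>x. (norm (simplex_cubic_grad q x))\<^sup>2) = 3 * (real CARD('n) + 4) * sph_int (\<lambda>x. (simplex_cubic q x)\<^sup>2)"
proof -
  let ?I = "{..<CARD('n) + 1}" and ?c = "simplex_cubic q" and ?g = "simplex_cubic_grad q"
  let ?D = "\<lambda>i x. (2 * (q i \<bullet> x) * ?c x) *\<^sub>R q i + (q i \<bullet> x)\<^sup>2 *\<^sub>R ?g x"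
  have one: "sph_int (\<lambda>x. ?D i x \<bullet> q i) = (real CARD('n) + 4) * sph_int (\<lambda>x. (q i \<bullet> x) ^ 3 * ?c x)" for i
  proof -
    have "sph_int (\<lambda>x. ?D i x \<bullet> q i) = (real CARD('n) - 1) * sph_int (\<lambda>x. (x \<bullet> q i) * ((q i \<bullet> x)\<^sup>2 * ?c x))
      + sph_int (\<lambda>x. (x \<bullet> q i) * (?D i x \<bullet> x))"
      by (rule sph_int_gradient)
         (auto intro!: derivative_eq_intros simplex_cubic_deriv continuous_intros
            simp: fun_eq_iff inner_add_left algebra_simps)
    also have "(\<lambda>x. (x \<bullet> q i) * ((q i \<bullet> x)\<^sup>2 * ?c x)) = (\<lambda>x. (q i \<bullet> x) ^ 3 * ?c x)"
      by (auto simp: power3_eq_cube power2_eq_square inner_commute)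
    also have "(\<lambda>x. (x \<bullet> q i) * (?D i x \<bullet> x)) = (\<lambda>x. 5 * ((q i \<bullet> x) ^ 3 * ?c x))"
      by (auto simp: power3_eq_cube power2_eq_square inner_add_left simplex_cubic_euler inner_commute[of _ "q i"] algebra_simps)
    finally show ?thesis unfolding sph_int_cmult distrib_right[symmetric] by simp
  qed
  have sumD: "(\<Sum>i\<in>?I. ?D i x \<bullet> q i) = (1/3) * (norm (?g x))\<^sup>2" if x: "x \<in> sphere 0 1" for x
  proof -
    have "?D i x \<bullet> q i = (2 * ?c x) * (q i \<bullet> x) + (1/3) * (((3 * (q i \<bullet> x)\<^sup>2) *\<^sub>R q i) \<bullet> ?g x)" if "i \<in> ?I" for i
      using simplex_norm[of i] that by (simp add: inner_add_left norm_eq_1 inner_commute[of "?g x" "q i"])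
    then have "(\<Sum>i\<in>?I. ?D i x \<bullet> q i) = (2 * ?c x) * (\<Sum>i\<in>?I. q i \<bullet> x) + (1/3) * (\<Sum>i\<in>?I. ((3 * (q i \<bullet> x)\<^sup>2) *\<^sub>R q i) \<bullet> ?g x)"
      unfolding sum_distrib_left sum.distrib[symmetric] by (rule sum.cong[OF refl])
    also have "(\<Sum>i\<in>?I. q i \<bullet> x) = 0"
      using simplex_sum by (simp only: inner_sum_left[symmetric] inner_zero_left)
    also have "(\<Sum>i\<in>?I. ((3 * (q i \<bullet> x)\<^sup>2) *\<^sub>R q i) \<bullet> ?g x) = ?g x \<bullet> ?g x"
      unfolding inner_sum_left[symmetric] simplex_cubic_grad_def ..
    finally show ?thesis by (simp add: dot_square_norm)
  qed
  have "(1/3) * sph_int (\<lambda>x. (norm (?g x))\<^sup>2) = sph_int (\<lambda>x. \<Sum>i\<in>?I. ?D i x \<bullet> q i)"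
    unfolding sph_int_cmult[symmetric] by (rule sph_int_cong, rule sumD[symmetric])
  also have "\<dots> = (\<Sum>i\<in>?I. sph_int (\<lambda>x. ?D i x \<bullet> q i))"
    by (rule sph_int_sum) (auto intro!: sph_integrable_continuous continuous_intros)
  also have "\<dots> = (real CARD('n) + 4) * (\<Sum>i\<in>?I. sph_int (\<lambda>x. (q i \<bullet> x) ^ 3 * ?c x))"
    unfolding sum_distrib_left one ..
  also have "(\<Sum>i\<in>?I. sph_int (\<lambda>x. (q i \<bullet> x) ^ 3 * ?c x)) = sph_int (\<lambda>x. \<Sum>i\<in>?I. (q i \<bullet> x) ^ 3 * ?c x)"
    by (rule sph_int_sum[symmetric]) (auto intro!: sph_integrable_continuous continuous_intros)
  also have "(\<lambda>x. \<Sum>i\<in>?I. (q i \<bullet> x) ^ 3 * ?c x) = (\<lambda>x. (?c x)\<^sup>2)"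
    unfolding sum_distrib_right[symmetric] by (simp add: simplex_cubic_def power2_eq_square)
  finally show ?thesis by simp
qed

text \<open>Removing the radial part subtracts 9 times the squared cubic, and 3 (N + 4) - 9 = 3 (N +
  1) is the eigenvalue k (k + N - 2) at k = 3.\<close>

lemma sph_int_simplex_cubic_tangent:
  "sph_int (\<lambda>x. (norm (simplex_cubic_tangent q x))\<^sup>2) = 3 * (real CARD('n) + 1) * sph_int (\<lambda>x. (simplex_cubic q x)\<^sup>2)"
proof -
  have "sph_int (\<lambda>x. (norm (simplex_cubic_tangent q x))\<^sup>2)
    = sph_int (\<lambda>x. (norm (simplex_cubic_grad q x))\<^sup>2 - 9 * (simplex_cubic q x)\<^sup>2)"
  proof (rule sph_int_cong)
    fix x :: "real^'n" assume "x \<in> sphere 0 1"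
    then have "x \<bullet> x = 1" by (simp add: norm_eq_1)
    moreover have "x \<bullet> simplex_cubic_grad q x = 3 * simplex_cubic q x"
      using simplex_cubic_euler[of q x] by (simp add: inner_commute)
    ultimately show "(norm (simplex_cubic_tangent q x))\<^sup>2 = (norm (simplex_cubic_grad q x))\<^sup>2 - 9 * (simplex_cubic q x)\<^sup>2"
      unfolding power2_norm_eq_inner simplex_cubic_tangent_def
      by (simp add: inner_diff_left inner_diff_right simplex_cubic_euler power2_eq_square)
  qed
  also have "\<dots> = sph_int (\<lambda>x. (norm (simplex_cubic_grad q x))\<^sup>2) - 9 * sph_int (\<lambda>x. (simplex_cubic q x)\<^sup>2)"
    by (subst sph_int_diff) (auto intro!: sph_integrable_continuous continuous_intros simp: sph_int_cmult)
  finally show ?thesis by (simp add: sph_int_simplex_cubic_grad algebra_simps)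
qed

text \<open>The value at a vertex is 1 - 1 / N^2, which is nonzero because N is at least 2.\<close>

lemma sph_int_simplex_cubic_square_pos:
  assumes "CARD('n) \<ge> 2"
  shows "sph_int (\<lambda>x. (simplex_cubic q x)\<^sup>2) > 0"
proof (rule sph_int_pos)
  have "simplex_cubic q (q 0) = 1 + real CARD('n) * (- 1 / real CARD('n)) ^ 3"
    unfolding simplex_cubic_def using simplex_inner_sum[of 0 "\<lambda>t. t ^ 3"] by simp
  also have "\<dots> = 1 - 1 / (real CARD('n))\<^sup>2"
    using assms by (simp add: power3_eq_cube power2_eq_square field_simps)
  also have "\<dots> \<noteq> 0"
  proof -
    have "1 * 1 < real CARD('n) * real CARD('n)" using assms by (intro mult_strict_mono) auto
    then show ?thesis by (simp add: power2_eq_square)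
  qed
  finally show "(simplex_cubic q (q 0))\<^sup>2 > 0" by simp
  show "q 0 \<in> sphere 0 1" using simplex_norm[of 0] by simp
qed (auto intro: continuous_intros)

text \<open>The group permutes the vertex set and preserves inner products. Passing from indices to
  the vertex set needs distinct vertices, which the negative inner products guarantee.\<close>

lemma symmetric_simplex_cubic: "symmetric_fun q (simplex_cubic q)"
proof -
  let ?I = "{..<CARD('n) + 1}"
  have inj: "inj_on q ?I"
  proof (rule inj_onI, rule ccontr)
    fix i j assume ij: "i \<in> ?I" "j \<in> ?I" "q i = q j" "i \<noteq> j"
    then have "q i \<bullet> q j = 1" using simplex_norm[of j] by (simp add: norm_eq_1)
    moreover have "q i \<bullet> q j < 0" using simplex_inner[of i j] ij by simp
    ultimately show False by simp
  qed
  have eq: "simplex_cubic q x = (\<Sum>y\<in>q ` ?I. (y \<bullet> x) ^ 3)" for x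
    using sum.reindex[OF inj, of "\<lambda>y. (y \<bullet> x) ^ 3"] by (simp only: simplex_cubic_def o_def)
  have "simplex_cubic q (A *v x) = simplex_cubic q x" if "A \<in> sym_group q" for A x
  proof -
    have A: "orthogonal_matrix A" "(\<lambda>x. A *v x) ` (q ` ?I) = q ` ?I"
      using that by (auto simp: sym_group_def)
    have orth: "orthogonal_transformation (\<lambda>x. A *v x)"
      using A(1) by (simp add: orthogonal_transformation_matrix matrix_of_matrix_vector_mul)
    then have "inj_on (\<lambda>x. A *v x) (q ` ?I)"
      using orthogonal_transformation_inj inj_on_subset by blast
    then have "(\<Sum>y\<in>(\<lambda>x. A *v x) ` (q ` ?I). (y \<bullet> (A *v x)) ^ 3) = (\<Sum>y\<in>q ` ?I. ((A *v y) \<bullet> (A *v x)) ^ 3)"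
      by (simp add: sum.reindex)
    then show ?thesis
      unfolding A(2) eq using orth by (simp add: orthogonal_transformation_def)
  qed
  then show ?thesis by (simp add: symmetric_fun_def)
qed

end

section \<open>Membership of the perturbations in the constraint set, and conclusion\<close>

context bounded_perturbation
begin

lemma phi_0: "phi p \<xi> 0 = (\<lambda>x. 1)"
  using phi_eq[of 0 p] \<delta>_pos \<omega>_pos by (simp add: cf_def mass_0)

lemma phi_mass:
  assumes e: "\<bar>\<epsilon>\<bar> \<le> \<delta>" and p: "p \<noteq> 0"
  shows "sph_int (\<lambda>x. phi p \<xi> \<epsilon> x powr p) = sph_int (\<lambda>x::real^'n. 1)"
proof -
  have "sph_int (\<lambda>x. phi p \<xi> \<epsilon> x powr p) = sph_int (\<lambda>x. cf p \<epsilon> powr p * pert \<epsilon> x powr p)"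
  proof (rule sph_int_cong)
    fix x :: "real^'n" assume x: "x \<in> sphere 0 1"
    show "phi p \<xi> \<epsilon> x powr p = cf p \<epsilon> powr p * pert \<epsilon> x powr p"
      unfolding phi_eq[OF e] using cf_pos[OF e, of p] pert_bounds[OF e x] by (intro powr_mult)
  qed
  also have "\<dots> = cf p \<epsilon> powr p * mass p \<epsilon>" by (simp add: sph_int_cmult mass_def)
  also have "cf p \<epsilon> powr p = \<omega> / mass p \<epsilon>"
  proof -
    have "cf p \<epsilon> powr p = (mass p \<epsilon> / \<omega>) powr (- 1)"
      unfolding cf_def powr_powr using p by simp
    then show ?thesis using mass_pos[OF e, of p] \<omega>_pos by (simp add: powr_neg_one)
  qed
  finally show ?thesis using mass_pos[OF e, of p] by (simp add: \<omega>_def)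
qed

end

lemma (in smooth_perturbation) phi_in_B_set:
  assumes "\<bar>\<epsilon>\<bar> \<le> \<delta>" "p \<noteq> 0" "symmetric_fun q \<xi>"
  shows "phi p \<xi> \<epsilon> \<in> B_set q p"
  using phi_in_Hstar_plus[OF assms(1)] phi_mass[OF assms(1,2)] assms(3)
  by (simp add: B_set_def symmetric_fun_def phi_def)

theorem theorem7p1:
  fixes q :: "nat \<Rightarrow> real^'n" and p :: real
  assumes n_ge: "CARD('n) \<ge> 2"
    and simplex: "regular_simplex q"
    and p_lt: "p < - 2 * (real CARD('n) - 1) - 5"
  shows "(\<lambda>x::real^'n. 1) \<in> B_set q p
    \<and> (\<forall>\<xi>. smooth_fun \<xi> \<and> symmetric_fun q \<xi> \<longrightarrow>
          ((\<lambda>\<epsilon>. I_fun (phi p \<xi> \<epsilon>)) has_real_derivative 0) (at 0))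
    \<and> (\<exists>\<xi>. smooth_fun \<xi> \<and> symmetric_fun q \<xi> \<and>
          (\<exists>g d2. (\<forall>\<^sub>F \<epsilon> in nhds 0.
                     ((\<lambda>e. I_fun (phi p \<xi> e)) has_real_derivative g \<epsilon>) (at \<epsilon>))
                 \<and> (g has_real_derivative d2) (at 0) \<and> d2 < 0))
    \<and> (\<exists>v \<in> B_set q p. I_fun v < I_fun (\<lambda>x::real^'n. 1))"
proof -
  let ?\<xi> = "simplex_cubic q" and ?J = "sph_int (\<lambda>x. (simplex_cubic q x)\<^sup>2)"
  interpret smooth_perturbation ?\<xi> "6 * (real CARD('n) + 1)" "simplex_cubic_tangent q"
    by (rule simplex_cubic_perturbation[OF simplex])
  have p: "p \<noteq> 0" using p_lt n_ge by auto
  define d2 where "d2 = real CARD('n) * (p - real CARD('n) + 3 * (real CARD('n) + 1)) * ?J"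
  obtain g where g: "\<And>\<epsilon>. \<bar>\<epsilon>\<bar> < \<delta> \<Longrightarrow> ((\<lambda>\<epsilon>. I_fun (phi p ?\<xi> \<epsilon>)) has_real_derivative g \<epsilon>) (at \<epsilon>)"
    "g 0 = 0" "(g has_real_derivative d2) (at 0)"
    unfolding d2_def
    using I_fun_phi_second_variation[OF p sph_int_simplex_cubic[OF simplex] sph_int_simplex_cubic_tangent[OF simplex]]
    by blast
  \<comment> \<open>The left side is p + 2 N + 3, so its negativity is precisely the hypothesis on
    \<open>p\<close>.\<close>
  have "p - real CARD('n) + 3 * (real CARD('n) + 1) < 0" using p_lt by simp
  then have d2: "d2 < 0"
    unfolding d2_def using sph_int_simplex_cubic_square_pos[OF simplex n_ge]
    by (simp add: mult_less_0_iff)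
  \<comment> \<open>At parameter 0 the perturbation is the constant 1: the strict decrease gives a
    better competitor, and membership at parameter 0 places the constant in
    \<open>B_set\<close>.\<close>
  obtain t where t: "0 < t" "t < \<delta>" "I_fun (phi p ?\<xi> t) < I_fun (phi p ?\<xi> 0)"
    using negative_second_derivative_decrease[OF \<delta>_pos g d2] by blast
  have "phi p ?\<xi> t \<in> B_set q p" "phi p ?\<xi> 0 \<in> B_set q p"
    using t \<delta>_pos by (auto intro!: phi_in_B_set p symmetric_simplex_cubic[OF simplex])
  moreover have "\<forall>\<^sub>F \<epsilon> in nhds 0. ((\<lambda>e. I_fun (phi p ?\<xi> e)) has_real_derivative g \<epsilon>) (at \<epsilon>)"
    unfolding eventually_nhds_metric using g(1) \<delta>_pos by (auto simp: dist_real_def)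
  ultimately show ?thesis
    using t(3) g(3) d2 I_fun_phi_critical_smooth[OF _ p] smooth_simplex_cubic symmetric_simplex_cubic[OF simplex]
    unfolding phi_0 by blast
qed

end
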